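(* Let $n$ be an odd prime, let $A$ be a cyclic division algebra over $\mathbb{Q}$ of degree $n$ (so of dimension $n^2$ over $\mathbb{Q}$) with a canonical generation $(\sigma, Z, S)$, $Z=\mathbb{Q}(\eta)$, where $\eta$ is the associated Gaussian period, and let $\mathfrak{m}$ be a maximal order of $A$ associated with this canonical generation. Suppose that 1. $3 \nmid \sigma$, and 2. $3 \nmid N_{\mathbb{Q}(\eta)/\mathbb{Q}}(\eta)$. Then for every integer $r\ge 2$, every matrix $C \in M_r(\mathfrak{m})$ is a (finite) sum of cubes of matrices in $M_r(\mathfrak{m})$.
   Context: Cyclic algebra. Let $Z/\mathbb{Q}$ be a cyclic field extension of degree $n$, let $S$ be a generator of its Galois group (write $z^S$ for the image of $z$ under $S$), and let $\sigma \in \mathbb{Q}$, $\sigma\neq 0$. The cyclic algebra $(\sigma, Z, S)$ is the $\mathbb{Q}$-algebra $\bigoplus_{i=0}^{n-1} u^i Z$ of dimension $n^2$ over $\mathbb{Q}$, with multiplication determined by $zu = u z^S$ for $z\in Z$ and $u^n = \sigma$. A cyclic generation of $A$ is a presentation $A = (\sigma, Z, S)$. Canonical generation. Let $A$ be a cyclic division algebra of odd prime degree $n$ over $\mathbb{Q}$, and let $q_1,\dots,q_s$ ($s\ge 2$) be the distinct rational primes at which $A$ does not split. A canonical generation of $A$ is a cyclic generation $A=(\sigma, Z, S)$ such that $\sigma = q_1 q_2\cdots q_s$ and, for some rational prime $p$: $p\equiv 1 \pmod n$; $p \nmid \sigma$; each $q_i$ is not an $n$-th power modulo $p$; $\sigma$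 is an $n$-th power modulo $p$; $Z$ is the unique cyclic field of degree $n$ over $\mathbb{Q}$ of conductor $p$ (discriminant $p^{n-1}$); and $S$ is a generator of $\mathrm{Gal}(Z/\mathbb{Q})$. Associated Gaussian period and maximal order. Given such a canonical generation, write $p = hn+1$, let $g$ be a primitive root modulo $p$ and $\xi$ a primitive $p$-th root of unity. Put $\eta = \sum_{r=0}^{h-1} \xi^{g^{nr}}$ (the Gaussian period), so $Z = \mathbb{Q}(\eta)$, and the conjugates $\eta, \eta^S, \dots, \eta^{S^{n-1}}$ form a normal $\mathbb{Z}$-basis of the ring of integers of $Z$. Put $\beta = \prod_{r=0}^{h-1}(1-\xi^{g^{nr}}) \in Z$ and $\alpha = \beta^{n-1}$. Let $\lambda$ be a rational integer with $\lambda^n \equiv \sigma \pmod p$, and define $y\in A$ by $py = (\lambda - u)\alpha$. The set $I(\lambda)$ of all $\mathbb{Z}$-linear combinations of the elements $y^i \eta^{S^k}$, $0\le i,k\le n-1$, is a maximal order in $A$ (a theorem of R. Hull). A maximal order associated with the canonical generation is any $\mathfrak{m}= I(\lambda)$ of this form. $M_r(\mathfrak{m})$ denotes the ring of $r\times r$ matrices over $\mathfrak{m}$. *)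

theory Defs
  imports
    "HOL-Analysis.Analysis"
    "HOL-Algebra.QuotRing"
    "HOL-Library.Poly_Mapping"
    "HOL-Number_Theory.Number_Theory"
    "Jordan_Normal_Form.Matrix"
begin

definition is_subfield :: "complex set \<Rightarrow> bool" where
  "is_subfield Z \<longleftrightarrow> 1 \<in> Z \<and> (\<forall>x\<in>Z. \<forall>y\<in>Z. x - y \<in> Z \<and> x * y \<in> Z) \<and> (\<forall>x\<in>Z. inverse x \<in> Z)"

text \<open>The dimension over \<open>\<rat>\<close>; its value is \<open>0\<close> if the extension is infinite.\<close>

definition field_degree :: "complex set \<Rightarrow> nat" where
  "field_degree Z = vector_space.dim (\<lambda>(c::rat) (x::complex). of_rat c * x) Z"

definition rat_adjoin :: "complex \<Rightarrow> complex set" where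
  "rat_adjoin x = \<Inter>{K. is_subfield K \<and> x \<in> K}"

text \<open>Automorphisms of \<open>Z\<close> are automatically \<open>\<rat>\<close>-linear; extensionality makes the
  group finite when it should be.\<close>

definition gal :: "complex set \<Rightarrow> (complex \<Rightarrow> complex) set" where
  "gal Z = {f \<in> extensional Z. bij_betw f Z Z \<and>
     (\<forall>x\<in>Z. \<forall>y\<in>Z. f (x + y) = f x + f y \<and> f (x * y) = f x * f y)}"

definition cyclic_field :: "nat \<Rightarrow> complex set \<Rightarrow> (complex \<Rightarrow> complex) \<Rightarrow> bool" where
  "cyclic_field n Z S \<longleftrightarrow>
     is_subfield Z \<and> field_degree Z = n \<and>
     {z \<in> Z. \<forall>f\<in>gal Z. f z = z} = \<rat> \<and>
     S \<in> gal Z \<and> (\<forall>f\<in>gal Z. \<exists>k. \<forall>z\<in>Z. f z = (S ^^ k) z)"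

text \<open>This is the norm to \<open>\<rat>\<close> only when \<open>Z\<close> is Galois over \<open>\<rat>\<close>.\<close>

definition field_norm :: "complex set \<Rightarrow> complex \<Rightarrow> complex" where
  "field_norm Z x = (\<Prod>f\<in>gal Z. f x)"

definition has_conductor :: "complex set \<Rightarrow> nat \<Rightarrow> bool" where
  "has_conductor Z m \<longleftrightarrow> m > 0 \<and> Z \<subseteq> rat_adjoin (cis (2 * pi / real m)) \<and>
     (\<forall>k. 0 < k \<and> k < m \<longrightarrow> \<not> Z \<subseteq> rat_adjoin (cis (2 * pi / real k)))"

text \<open>\<open>\<rat>\<^sub>q\<close> is the completion of \<open>\<rat>\<close>: \<open>q\<close>-adic Cauchy sequences modulo null sequences.  As \<open>q\<close>
  varies over a set of primes it has to be a carrier-based ring rather than a type.\<close>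

definition padic_abs :: "nat \<Rightarrow> rat \<Rightarrow> real" where
  "padic_abs q x = (if x = 0 then 0 else
     real q powi (int (multiplicity (int q) (snd (quotient_of x)))
                  - int (multiplicity (int q) (fst (quotient_of x)))))"

definition padic_cauchy_ring :: "nat \<Rightarrow> (nat \<Rightarrow> rat) ring" where
  "padic_cauchy_ring q =
     \<lparr>carrier = {X. \<forall>e>0. \<exists>N. \<forall>i\<ge>N. \<forall>j\<ge>N. padic_abs q (X i - X j) < e},
      mult = (\<lambda>X Y i. X i * Y i), one = (\<lambda>_. 1), zero = (\<lambda>_. 0), add = (\<lambda>X Y i. X i + Y i)\<rparr>"

definition padic_null :: "nat \<Rightarrow> (nat \<Rightarrow> rat) set" where
  "padic_null q = {X. (\<lambda>i. padic_abs q (X i)) \<longlonglongrightarrow> 0}"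

definition padic_field :: "nat \<Rightarrow> (nat \<Rightarrow> rat) set ring" where
  "padic_field q = padic_cauchy_ring q Quot padic_null q"

definition padic_of_rat :: "nat \<Rightarrow> rat \<Rightarrow> (nat \<Rightarrow> rat) set" where
  "padic_of_rat q c = padic_null q +>\<^bsub>padic_cauchy_ring q\<^esub> (\<lambda>_. c)"

text \<open>A division ring of characteristic \<open>0\<close> is an algebra over \<open>\<rat>\<close> in exactly one way.\<close>

definition rat_embed :: "rat \<Rightarrow> 'a::{division_ring,ring_char_0}" where
  "rat_embed c = of_int (fst (quotient_of c)) * inverse (of_int (snd (quotient_of c)))"

text \<open>The tensor product over \<open>\<rat>\<close> of \<open>'a\<close> and a ring \<open>K\<close> with structure map \<open>j\<close>: the integral
  monoid ring of the multiplicative monoid \<open>UNIV \<times> carrier K\<close>, modulo the bilinearity relations.\<close>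

definition pair_monoid_ring ::
    "('k,'m) ring_scheme \<Rightarrow> ('a::{division_ring,ring_char_0} \<times> 'k \<Rightarrow>\<^sub>0 int) ring" where
  "pair_monoid_ring K =
     \<lparr>carrier = {f. Poly_Mapping.keys f \<subseteq> UNIV \<times> carrier K},
      mult = (\<lambda>f g. \<Sum>(a, c)\<in>Poly_Mapping.keys f. \<Sum>(b, d)\<in>Poly_Mapping.keys g.
        Poly_Mapping.single (a * b, c \<otimes>\<^bsub>K\<^esub> d)
          (Poly_Mapping.lookup f (a, c) * Poly_Mapping.lookup g (b, d))),
      one = Poly_Mapping.single (1, \<one>\<^bsub>K\<^esub>) 1, zero = 0, add = (+)\<rparr>"

definition tensor_relations ::
    "('k,'m) ring_scheme \<Rightarrow> (rat \<Rightarrow> 'k) \<Rightarrow> ('a::{division_ring,ring_char_0} \<times> 'k \<Rightarrow>\<^sub>0 int) set" where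
  "tensor_relations K j =
     {Poly_Mapping.single (a + b, c) 1 - Poly_Mapping.single (a, c) 1
        - Poly_Mapping.single (b, c) 1 | a b c. c \<in> carrier K} \<union>
     {Poly_Mapping.single (a, c \<oplus>\<^bsub>K\<^esub> d) 1 - Poly_Mapping.single (a, c) 1
        - Poly_Mapping.single (a, d) 1 | a c d. c \<in> carrier K \<and> d \<in> carrier K} \<union>
     {Poly_Mapping.single (a * rat_embed t, c) 1 - Poly_Mapping.single (a, j t \<otimes>\<^bsub>K\<^esub> c) 1
        | a t c. c \<in> carrier K}"

definition tensor_ideal ::
    "('k,'m) ring_scheme \<Rightarrow> (rat \<Rightarrow> 'k) \<Rightarrow> ('a::{division_ring,ring_char_0} \<times> 'k \<Rightarrow>\<^sub>0 int) set" where
  "tensor_ideal K j = Idl\<^bsub>pair_monoid_ring K\<^esub> (tensor_relations K j)"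

definition tensor_ring ::
    "('k,'m) ring_scheme \<Rightarrow> (rat \<Rightarrow> 'k) \<Rightarrow> ('a::{division_ring,ring_char_0} \<times> 'k \<Rightarrow>\<^sub>0 int) set ring" where
  "tensor_ring K j = pair_monoid_ring K Quot tensor_ideal K j"

definition pure_tensor ::
    "('k,'m) ring_scheme \<Rightarrow> (rat \<Rightarrow> 'k) \<Rightarrow> 'a::{division_ring,ring_char_0} \<Rightarrow> 'k
      \<Rightarrow> ('a \<times> 'k \<Rightarrow>\<^sub>0 int) set" where
  "pure_tensor K j a c =
     tensor_ideal K j +>\<^bsub>pair_monoid_ring K\<^esub> Poly_Mapping.single (a, c) 1"

text \<open>The matrix type of the library takes its operations from type classes, hence is not
  available over a ring given by a carrier.\<close>

definition scalar_matrix :: "nat \<Rightarrow> ('k,'m) ring_scheme \<Rightarrow> 'k \<Rightarrow> nat \<times> nat \<Rightarrow> 'k" where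
  "scalar_matrix n K c = (\<lambda>(i, j)\<in>{..<n} \<times> {..<n}. if i = j then c else \<zero>\<^bsub>K\<^esub>)"

definition matrix_ring :: "nat \<Rightarrow> ('k,'m) ring_scheme \<Rightarrow> (nat \<times> nat \<Rightarrow> 'k) ring" where
  "matrix_ring n K =
     \<lparr>carrier = {..<n} \<times> {..<n} \<rightarrow>\<^sub>E carrier K,
      mult = (\<lambda>M N. \<lambda>(i, j)\<in>{..<n} \<times> {..<n}. \<Oplus>\<^bsub>K\<^esub>k\<in>{..<n}. M (i, k) \<otimes>\<^bsub>K\<^esub> N (k, j)),
      one = scalar_matrix n K \<one>\<^bsub>K\<^esub>, zero = scalar_matrix n K \<zero>\<^bsub>K\<^esub>,
      add = (\<lambda>M N. \<lambda>(i, j)\<in>{..<n} \<times> {..<n}. M (i, j) \<oplus>\<^bsub>K\<^esub> N (i, j))\<rparr>"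

text \<open>Here \<open>n\<close> is the degree of the algebra: \<open>A \<otimes> \<rat>\<^sub>q\<close> and the \<open>n \<times> n\<close> matrices over
  \<open>\<rat>\<^sub>q\<close> are isomorphic as \<open>\<rat>\<^sub>q\<close>-algebras.\<close>

definition splits_at :: "'a::{division_ring,ring_char_0} itself \<Rightarrow> nat \<Rightarrow> nat \<Rightarrow> bool" where
  "splits_at A n q \<longleftrightarrow>
     (\<exists>\<Phi> \<in> ring_iso (tensor_ring (padic_field q) (padic_of_rat q)
                      :: ('a \<times> (nat \<Rightarrow> rat) set \<Rightarrow>\<^sub>0 int) set ring)
                   (matrix_ring n (padic_field q)).
        \<forall>c\<in>carrier (padic_field q).
          \<Phi> (pure_tensor (padic_field q) (padic_of_rat q) 1 c) = scalar_matrix n (padic_field q) c)"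

definition nonsplit_primes :: "'a::{division_ring,ring_char_0} itself \<Rightarrow> nat \<Rightarrow> nat set" where
  "nonsplit_primes A n = {q. prime q \<and> \<not> splits_at A n q}"

text \<open>The division algebra is the type \<open>'a\<close>, and \<open>\<iota>\<close> embeds the number field \<open>Z\<close> into it;
  only the values of \<open>\<iota>\<close> on \<open>Z\<close> matter.\<close>

definition cyclic_generation ::
    "nat \<Rightarrow> rat \<Rightarrow> complex set \<Rightarrow> (complex \<Rightarrow> complex) \<Rightarrow>
     (complex \<Rightarrow> 'a::{division_ring,ring_char_0}) \<Rightarrow> 'a \<Rightarrow> bool" where
  "cyclic_generation n \<sigma> Z S \<iota> u \<longleftrightarrow>
     cyclic_field n Z S \<and> \<sigma> \<noteq> 0 \<and>
     \<iota> 1 = 1 \<and> (\<forall>x\<in>Z. \<forall>y\<in>Z. \<iota> (x + y) = \<iota> x + \<iota> y \<and> \<iota> (x * y) = \<iota> x * \<iota> y) \<and>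
     (\<forall>a. \<exists>!w. w \<in> {..<n} \<rightarrow>\<^sub>E Z \<and> a = (\<Sum>i<n. u ^ i * \<iota> (w i))) \<and>
     (\<forall>z\<in>Z. \<iota> z * u = u * \<iota> (S z)) \<and>
     u ^ n = rat_embed \<sigma>"

definition canonical_generation ::
    "nat \<Rightarrow> nat \<Rightarrow> int \<Rightarrow> complex set \<Rightarrow> (complex \<Rightarrow> complex) \<Rightarrow>
     (complex \<Rightarrow> 'a::{division_ring,ring_char_0}) \<Rightarrow> 'a \<Rightarrow> bool" where
  "canonical_generation n p \<sigma> Z S \<iota> u \<longleftrightarrow>
     cyclic_generation n (of_int \<sigma>) Z S \<iota> u \<and>
     finite (nonsplit_primes TYPE('a) n) \<and> card (nonsplit_primes TYPE('a) n) \<ge> 2 \<and>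
     \<sigma> = (\<Prod>q\<in>nonsplit_primes TYPE('a) n. int q) \<and>
     prime p \<and> [p = 1] (mod n) \<and> \<not> int p dvd \<sigma> \<and>
     (\<forall>q\<in>nonsplit_primes TYPE('a) n. \<not> (\<exists>x::int. [x ^ n = int q] (mod int p))) \<and>
     (\<exists>x::int. [x ^ n = \<sigma>] (mod int p)) \<and>
     has_conductor Z p"

definition primitive_root_of_unity :: "nat \<Rightarrow> complex \<Rightarrow> bool" where
  "primitive_root_of_unity p \<xi> \<longleftrightarrow> \<xi> ^ p = 1 \<and> (\<forall>k. 0 < k \<and> k < p \<longrightarrow> \<xi> ^ k \<noteq> 1)"

definition gaussian_period :: "nat \<Rightarrow> nat \<Rightarrow> nat \<Rightarrow> complex \<Rightarrow> complex" where
  "gaussian_period n p g \<xi> = (\<Sum>r<(p - 1) div n. \<xi> ^ (g ^ (n * r)))"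

definition period_product :: "nat \<Rightarrow> nat \<Rightarrow> nat \<Rightarrow> complex \<Rightarrow> complex" where
  "period_product n p g \<xi> = (\<Prod>r<(p - 1) div n. 1 - \<xi> ^ (g ^ (n * r)))"

definition hull_order ::
    "nat \<Rightarrow> (complex \<Rightarrow> complex) \<Rightarrow> (complex \<Rightarrow> 'a::{division_ring,ring_char_0}) \<Rightarrow>
     complex \<Rightarrow> 'a \<Rightarrow> 'a set" where
  "hull_order n S \<iota> \<eta> y =
     {\<Sum>i<n. \<Sum>k<n. of_int (c i k) * (y ^ i * \<iota> ((S ^^ k) \<eta>)) | c :: nat \<Rightarrow> nat \<Rightarrow> int. True}"

definition associated_order ::
    "nat \<Rightarrow> nat \<Rightarrow> int \<Rightarrow> (complex \<Rightarrow> complex) \<Rightarrow> (complex \<Rightarrow> 'a::{division_ring,ring_char_0}) \<Rightarrow> 'a \<Rightarrow>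
     nat \<Rightarrow> complex \<Rightarrow> 'a set \<Rightarrow> bool" where
  "associated_order n p \<sigma> S \<iota> u g \<xi> \<O> \<longleftrightarrow>
     residue_primroot p g \<and> primitive_root_of_unity p \<xi> \<and>
     (\<exists>l y. [l ^ n = \<sigma>] (mod int p) \<and>
        of_nat p * y = (of_int l - u) * \<iota> (period_product n p g \<xi> ^ (n - 1)) \<and>
        \<O> = hull_order n S \<iota> (gaussian_period n p g \<xi>) y)"

definition matrices_over :: "nat \<Rightarrow> 'a set \<Rightarrow> 'a mat set" where
  "matrices_over r R = {M \<in> carrier_mat r r. elements_mat M \<subseteq> R}"

definition sum_of_cubes :: "nat \<Rightarrow> 'a::ring_1 set \<Rightarrow> 'a mat \<Rightarrow> bool" where
  "sum_of_cubes r R C \<longleftrightarrow>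
     (\<exists>Xs. set Xs \<subseteq> matrices_over r R \<and> C = foldr (\<lambda>X M. X ^\<^sub>m 3 + M) Xs (0\<^sub>m r r))"

end

theory Submission
  imports Defs "Subresultants.More_Homomorphisms" "HOL-Computational_Algebra.Field_as_Ring"
begin

text \<open>Let \<open>\<O> = I(\<lambda>)\<close>. In \<open>M\<^sub>r(\<O>)\<close> with \<open>r \<ge> 2\<close> the sums of cubes contain every matrix
  as soon as \<open>\<O>\<close> is spanned by \<open>3\<O>\<close>, the commutators \<open>[\<O>, \<O>]\<close> and the cubes of \<open>\<O>\<close>.
  As \<open>3\<close> divides neither \<open>p\<close> nor \<open>\<sigma>\<close>, one may replace \<open>\<O>\<close> by \<open>\<Oplus> u\<^sup>i \<int>\<^sub>Z\<close>, where \<open>\<int>\<^sub>Z\<close> is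
  spanned by the conjugate periods. The commutators \<open>[z, u\<^sup>i w] = u\<^sup>i (S\<^sup>i z - z) w\<close> give \<open>p u\<^sup>i \<int>\<^sub>Z\<close>
  for \<open>i\<close> not divisible by \<open>n\<close>, because \<open>p\<close> lies in the ideal generated by the \<open>S\<^sup>i z - z\<close>; the commutators
  \<open>[u z, u\<^sup>n\<^sup>-\<^sup>1]\<close> identify the conjugates of \<open>\<eta>\<close>. Finally \<open>Tr \<eta> = -1\<close> and
  \<open>Tr (\<eta>\<^sup>3) \<equiv> (Tr \<eta>)\<^sup>3 (mod 3)\<close>, so the cube \<open>\<eta>\<^sup>3\<close> is congruent to \<open>\<eta>\<close>, which is therefore
  reached as well.

  That \<open>\<O>\<close> is a ring rests on the total ramification of \<open>p\<close>: \<open>S z - z\<close> is divisible by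
  \<open>\<beta>\<close>, and the characteristic polynomial of \<open>y\<close> has integral coefficients.\<close>

text \<open>Passing to powers of \<open>u\<close> is only done up to integer factors: the proof
  exhibits a multiple of \<open>u\<close> by a power of \<open>p\<close> in the order, and does not
  compare the two lattices exactly. This suffices because a subgroup that contains all triples can
  be divided, within the order, by integers prime to 3. Hence the role of 3 not dividing
  \<open>p\<close> or \<open>\<sigma>\<close>; the first holds because p = 3 would force the odd
  prime \<open>n\<close> to divide 2. The generator \<open>S\<close> is given abstractly, whereas
  periods, traces and valuations are computed with the explicit automorphisms
  \<open>\<xi> \<mapsto> \<xi> ^ t\<close>. The conductor places \<open>Z\<close> inside the p-th
  cyclotomic field, and since \<open>n\<close> is prime the two descriptions are related by an
  exponent invertible modulo \<open>n\<close>. That the n-th power of \<open>S\<close> is the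
  identity is read off from the algebra, where \<open>u ^ n\<close> is central. Integrality is
  tested in the ring generated by \<xi>: there 1 - \<xi> serves as a uniformizer at
  \<open>p\<close>, and rational elements are integers.\<close>

hide_const (open) up_ring.monom up_ring.coeff module.smult Fraction_Field.Fract

section \<open>Matrices as sums of cubes\<close>

text \<open>A 2 by 2 matrix on the coordinates \<open>i\<close> and \<open>j\<close>, with zeros and
  not ones elsewhere: sums and products then stay in the block.\<close>

definition block_mat :: "nat \<Rightarrow> nat \<Rightarrow> nat \<Rightarrow> 'a::ring_1 \<Rightarrow> 'a \<Rightarrow> 'a \<Rightarrow> 'a \<Rightarrow> 'a mat" where
  "block_mat r i j a b c d = mat r r (\<lambda>(k, l).
     if k = i \<and> l = i then a else if k = i \<and> l = j then b
     else if k = j \<and> l = i then c else if k = j \<and> l = j then d else 0)"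

lemma block_mat_mult:
  assumes "i < r" "j < r" "i \<noteq> j"
  shows "block_mat r i j a b c d * block_mat r i j a' b' c' d' =
    block_mat r i j (a * a' + b * c') (a * b' + b * d') (c * a' + d * c') (c * b' + d * d')"
proof (rule eq_matI)
  fix k l assume "k < dim_row (block_mat r i j (a * a' + b * c') (a * b' + b * d') (c * a' + d * c') (c * b' + d * d'))"
    "l < dim_col (block_mat r i j (a * a' + b * c') (a * b' + b * d') (c * a' + d * c') (c * b' + d * d'))"
  then have kl: "k < r" "l < r" by (auto simp: block_mat_def)
  define f where "f m = block_mat r i j a b c d $$ (k, m) * block_mat r i j a' b' c' d' $$ (m, l)" for m
  have "(block_mat r i j a b c d * block_mat r i j a' b' c' d') $$ (k, l) = (\<Sum>m\<in>{0..<r}. f m)"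
    using kl by (simp add: scalar_prod_def block_mat_def f_def)
  also have "\<dots> = (\<Sum>m\<in>{i, j}. f m)"
    by (rule sum.mono_neutral_right) (use assms kl in \<open>auto simp: f_def block_mat_def\<close>)
  also have "\<dots> = f i + f j"
    using assms by simp
  finally show "(block_mat r i j a b c d * block_mat r i j a' b' c' d') $$ (k, l) =
     block_mat r i j (a * a' + b * c') (a * b' + b * d') (c * a' + d * c') (c * b' + d * d') $$ (k, l)"
    using assms kl by (auto simp: f_def block_mat_def)
qed (auto simp: block_mat_def)

lemma block_mat_add:
  "block_mat r i j a b c d + block_mat r i j a' b' c' d' =
    block_mat r i j (a + a') (b + b') (c + c') (d + d')"
  by (rule eq_matI) (auto simp: block_mat_def)

lemma block_mat_uminus: "- block_mat r i j a b c d = block_mat r i j (- a) (- b) (- c) (- d)"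
  by (rule eq_matI) (auto simp: block_mat_def)

lemma block_mat_swap: "i \<noteq> j \<Longrightarrow> block_mat r i j a b c d = block_mat r j i d c b a"
  by (rule eq_matI) (auto simp: block_mat_def)

lemma block_mat_in_matrices_over:
  assumes "{0, a, b, c, d} \<subseteq> R"
  shows "block_mat r i j a b c d \<in> matrices_over r R"
  using assms by (auto simp: matrices_over_def elements_mat_def block_mat_def split: if_splits)

section \<open>Closure properties of sums of cubes\<close>

lemma pow_mat_3: "A \<in> carrier_mat r r \<Longrightarrow> A ^\<^sub>m 3 = A * A * (A :: 'a::semiring_1 mat)"
  by (simp add: numeral_3_eq_3)

lemma sum_of_cubes_carrier: "sum_of_cubes r R C \<Longrightarrow> C \<in> carrier_mat r r"
proof -
  have "foldr (\<lambda>X M. X ^\<^sub>m 3 + M) Xs (0\<^sub>m r r) \<in> carrier_mat r r"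
    if "set Xs \<subseteq> matrices_over r R" for Xs :: "'a mat list"
    using that by (induction Xs) (auto simp: matrices_over_def)
  then show "sum_of_cubes r R C \<Longrightarrow> C \<in> carrier_mat r r"
    by (auto simp: sum_of_cubes_def)
qed

lemma sum_of_cubes_zero: "sum_of_cubes r R (0\<^sub>m r r)"
  unfolding sum_of_cubes_def by (rule exI[of _ "[]"]) auto

lemma sum_of_cubes_cube:
  assumes "X \<in> matrices_over r R"
  shows "sum_of_cubes r R (X * X * X)"
  unfolding sum_of_cubes_def
  by (rule exI[of _ "[X]"]) (use assms in \<open>auto simp: matrices_over_def pow_mat_3\<close>)

lemma sum_of_cubes_add:
  assumes "sum_of_cubes r R C" "sum_of_cubes r R D"
  shows "sum_of_cubes r R (C + D)"
proof -
  obtain Ys where Ys: "set Ys \<subseteq> matrices_over r R" "D = foldr (\<lambda>X M. X ^\<^sub>m 3 + M) Ys (0\<^sub>m r r)"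
    using assms by (auto simp: sum_of_cubes_def)
  obtain Xs where Xs: "set Xs \<subseteq> matrices_over r R" "C = foldr (\<lambda>X M. X ^\<^sub>m 3 + M) Xs (0\<^sub>m r r)"
    using assms by (auto simp: sum_of_cubes_def)
  have D: "D \<in> carrier_mat r r" using sum_of_cubes_carrier assms by blast
  have "foldr (\<lambda>X M. X ^\<^sub>m 3 + M) Xs (0\<^sub>m r r) \<in> carrier_mat r r \<and>
      foldr (\<lambda>X M. X ^\<^sub>m 3 + M) Xs (0\<^sub>m r r) + D = foldr (\<lambda>X M. X ^\<^sub>m 3 + M) (Xs @ Ys) (0\<^sub>m r r)"
    using Xs(1)
  proof (induction Xs)
    case Nil
    then show ?case using D Ys by simp
  next
    case (Cons X Xs)
    then have "X ^\<^sub>m 3 \<in> carrier_mat r r" by (auto simp: matrices_over_def)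
    with Cons D show ?case by (auto simp: assoc_add_mat[of _ r r])
  qed
  with Xs Ys show ?thesis
    unfolding sum_of_cubes_def by (intro exI[of _ "Xs @ Ys"]) auto
qed

lemma sum_of_cubes_uminus:
  assumes R: "\<And>x. x \<in> R \<Longrightarrow> - x \<in> R" and "sum_of_cubes r R C"
  shows "sum_of_cubes r R (- C)"
proof -
  obtain Xs where Xs: "set Xs \<subseteq> matrices_over r R" "C = foldr (\<lambda>X M. X ^\<^sub>m 3 + M) Xs (0\<^sub>m r r)"
    using assms by (auto simp: sum_of_cubes_def)
  show ?thesis unfolding Xs(2) using Xs(1)
  proof (induction Xs)
    case Nil
    have "- 0\<^sub>m r r = (0\<^sub>m r r :: 'a mat)" by (rule eq_matI) auto
    then show ?case using sum_of_cubes_zero by simp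
  next
    case (Cons X Xs)
    let ?T = "foldr (\<lambda>X M. X ^\<^sub>m 3 + M) Xs (0\<^sub>m r r)"
    have X: "X \<in> carrier_mat r r" and Xm: "X \<in> matrices_over r R"
      using Cons by (auto simp: matrices_over_def)
    have T: "?T \<in> carrier_mat r r"
      using Cons(2) by (intro sum_of_cubes_carrier[of r R]) (auto simp: sum_of_cubes_def)
    have "- X \<in> matrices_over r R"
      using Xm R by (auto simp: matrices_over_def elements_mat_def)
    then have "sum_of_cubes r R ((- X) * (- X) * (- X))" by (rule sum_of_cubes_cube)
    also have "(- X) * (- X) * (- X) = - (X * X * X)"
      using X by (simp add: uminus_mult_left_mat uminus_mult_right_mat)
    also have "X * X * X = X ^\<^sub>m 3" using X by (simp add: pow_mat_3)
    finally have "sum_of_cubes r R (- (X ^\<^sub>m 3) + - ?T)"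
      using Cons by (intro sum_of_cubes_add) auto
    also have "- (X ^\<^sub>m 3) + - ?T = - (X ^\<^sub>m 3 + ?T)"
      by (rule eq_matI) (use X T in auto)
    finally show ?case by simp
  qed
qed

definition subring_set :: "'a::ring_1 set \<Rightarrow> bool" where
  "subring_set R \<longleftrightarrow> 1 \<in> R \<and> (\<forall>x\<in>R. \<forall>y\<in>R. x - y \<in> R \<and> x * y \<in> R)"

definition additive_subgroup_set :: "'a::ring_1 set \<Rightarrow> bool" where
  "additive_subgroup_set H \<longleftrightarrow> 0 \<in> H \<and> (\<forall>x\<in>H. \<forall>y\<in>H. x - y \<in> H)"

lemma subring_setD:
  assumes "subring_set R"
  shows "1 \<in> R" "0 \<in> R" "\<And>x y. x \<in> R \<Longrightarrow> y \<in> R \<Longrightarrow> x - y \<in> R"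
    "\<And>x y. x \<in> R \<Longrightarrow> y \<in> R \<Longrightarrow> x * y \<in> R" "\<And>x. x \<in> R \<Longrightarrow> - x \<in> R"
    "\<And>x y. x \<in> R \<Longrightarrow> y \<in> R \<Longrightarrow> x + y \<in> R"
proof -
  show 1: "1 \<in> R" and 2: "\<And>x y. x \<in> R \<Longrightarrow> y \<in> R \<Longrightarrow> x - y \<in> R"
    and "\<And>x y. x \<in> R \<Longrightarrow> y \<in> R \<Longrightarrow> x * y \<in> R"
    using assms by (auto simp: subring_set_def)
  show 3: "0 \<in> R" using 2[OF 1 1] by simp
  show 4: "\<And>x. x \<in> R \<Longrightarrow> - x \<in> R" using 2[OF 3] by simp
  show "\<And>x y. x \<in> R \<Longrightarrow> y \<in> R \<Longrightarrow> x + y \<in> R" using 2 4 by fastforce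
qed

lemma additive_subgroup_setD:
  assumes "additive_subgroup_set H"
  shows "0 \<in> H" "x \<in> H \<Longrightarrow> x' \<in> H \<Longrightarrow> x - x' \<in> H" "x \<in> H \<Longrightarrow> - x \<in> H"
    "x \<in> H \<Longrightarrow> x' \<in> H \<Longrightarrow> x + x' \<in> H" "x \<in> H \<Longrightarrow> of_int m * x \<in> H"
    "(\<And>i. i \<in> A \<Longrightarrow> f i \<in> H) \<Longrightarrow> sum f A \<in> H"
proof -
  show 0: "0 \<in> H" and diff: "x \<in> H \<Longrightarrow> x' \<in> H \<Longrightarrow> x - x' \<in> H" for x x'
    using assms by (auto simp: additive_subgroup_set_def)
  show minus: "x \<in> H \<Longrightarrow> - x \<in> H" for x using diff[OF 0] by simp
  show add: "x \<in> H \<Longrightarrow> x' \<in> H \<Longrightarrow> x + x' \<in> H" for x x'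
    using diff[OF _ minus, of x x'] by simp
  have "of_nat k * x \<in> H" if "x \<in> H" for x k
    using that by (induction k) (auto simp: 0 add distrib_right)
  then show "x \<in> H \<Longrightarrow> of_int m * x \<in> H"
    by (cases m rule: int_cases2) (auto simp: minus)
  show "(\<And>i. i \<in> A \<Longrightarrow> f i \<in> H) \<Longrightarrow> sum f A \<in> H"
    by (induction A rule: infinite_finite_induct) (auto simp: 0 add)
qed

lemma sum_of_cubes_block_mat_diff:
  assumes R: "subring_set R"
    and "sum_of_cubes r R (block_mat r i j a b c d)" "sum_of_cubes r R (block_mat r i j a' b' c' d')"
  shows "sum_of_cubes r R (block_mat r i j (a - a') (b - b') (c - c') (d - d'))"
  using sum_of_cubes_add[OF assms(2) sum_of_cubes_uminus[OF subring_setD(5)[OF R] assms(3)]]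
  by (simp add: block_mat_uminus block_mat_add)

text \<open>\<open>(1 b; 0 0)\<close> is idempotent, hence a cube, and subtracting
  \<open>(1 0; 0 0)\<close> leaves its corner; so off-diagonal entries can always be discarded. The
  cubes of \<open>(a x; 1 0)\<close> and \<open>(a 1; x 0)\<close> have diagonals
  \<open>(a^3 + x a + a x, a x)\<close> and \<open>(a^3 + x a + a x, x a)\<close>: removing
  \<open>a^3\<close> from the first gives the third claim, and their difference is the commutator of
  the fourth.\<close>

lemma sum_of_cubes_block_mat:
  assumes R: "subring_set R" and ij: "i < r" "j < r" "i \<noteq> j"
  shows "b \<in> R \<Longrightarrow> sum_of_cubes r R (block_mat r i j 0 b 0 0)"
    and "a \<in> R \<Longrightarrow> sum_of_cubes r R (block_mat r i j (a * a * a) 0 0 0)"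
    and "a \<in> R \<Longrightarrow> x \<in> R \<Longrightarrow> sum_of_cubes r R (block_mat r i j (x * a + a * x) 0 0 (a * x))"
    and "a \<in> R \<Longrightarrow> x \<in> R \<Longrightarrow> sum_of_cubes r R (block_mat r i j 0 0 0 (a * x - x * a))"
proof -
  note RD = subring_setD[OF R]
  let ?B = "block_mat r i j"
  let ?G = "sum_of_cubes r R"
  note diff = sum_of_cubes_block_mat_diff[OF R]
  have cube: "?G (?B a b c d * ?B a b c d * ?B a b c d)" if "a \<in> R" "b \<in> R" "c \<in> R" "d \<in> R" for a b c d
    using sum_of_cubes_cube[OF block_mat_in_matrices_over] that RD by blast
  show upper: "?G (?B 0 b 0 0)" if "b \<in> R" for b
    using diff[of r i j 1 b 0 0 1 0 0 0] cube[of 1 b 0 0] cube[of 1 0 0 0] that RD ij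
    by (simp add: block_mat_mult)
  have lower: "?G (?B 0 0 c 0)" if "c \<in> R" for c
    using diff[of r i j 1 0 c 0 1 0 0 0] cube[of 1 0 c 0] cube[of 1 0 0 0] that RD ij
    by (simp add: block_mat_mult)
  show diag: "?G (?B (a * a * a) 0 0 0)" if "a \<in> R" for a
    using cube[of a 0 0 0] that RD ij by (simp add: block_mat_mult)
  have offdiag: "?G (?B a 0 0 d)" if "?G (?B a b c d)" "b \<in> R" "c \<in> R" for a b c d
    using diff[OF diff[OF that(1) upper[OF that(2)]] lower[OF that(3)]] by simp
  show 1: "?G (?B (x * a + a * x) 0 0 (a * x))" if "a \<in> R" "x \<in> R" for a x
  proof -
    have "?G (?B ((a * a + x) * a + a * x) 0 0 (a * x))"
      using cube[of a x 1 0] that RD ij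
      by (intro offdiag[of _ "(a * a + x) * x" "a * a + x"]) (simp_all add: block_mat_mult)
    from diff[OF this diag[OF that(1)]] show ?thesis by (simp add: algebra_simps)
  qed
  have 2: "?G (?B (x * a + a * x) 0 0 (x * a))" if "a \<in> R" "x \<in> R" for a x
  proof -
    have "?G (?B ((a * a + x) * a + a * x) 0 0 (x * a))"
      using cube[of a 1 x 0] that RD ij
      by (intro offdiag[of _ "a * a + x" "x * a * a + x * x"]) (simp_all add: block_mat_mult algebra_simps)
    from diff[OF this diag[OF that(1)]] show ?thesis by (simp add: algebra_simps)
  qed
  show "?G (?B 0 0 0 (a * x - x * a))" if "a \<in> R" "x \<in> R" for a x
    using diff[OF 1[OF that] 2[OF that]] by simp
qed

text \<open>Modulo sums of cubes a matrix is determined by its trace, and the trace only matters modulo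
  \<open>3R + [R, R]\<close> and cubes.\<close>

theorem all_matrices_sum_of_cubes:
  fixes R :: "'a::ring_1 set"
  assumes R: "subring_set R" and "2 \<le> r" and C: "C \<in> matrices_over r R"
    and gen: "\<And>H. additive_subgroup_set H \<Longrightarrow> (\<And>x. x \<in> R \<Longrightarrow> 3 * x \<in> H) \<Longrightarrow>
      (\<And>x y. x \<in> R \<Longrightarrow> y \<in> R \<Longrightarrow> x * y - y * x \<in> H) \<Longrightarrow> (\<And>x. x \<in> R \<Longrightarrow> x * x * x \<in> H) \<Longrightarrow> R \<subseteq> H"
  shows "sum_of_cubes r R C"
proof -
  note RD = subring_setD[OF R]
  let ?G = "sum_of_cubes r R"
  note diff = sum_of_cubes_block_mat_diff[OF R]
  have diag: "?G (block_mat r i j x 0 0 0)" if ij: "i < r" "j < r" "i \<noteq> j" and "x \<in> R" for i j x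
  proof -
    have swap: "block_mat r i j a b c d = block_mat r j i d c b a" for a b c d :: 'a
      using ij by (intro block_mat_swap)
    note main = sum_of_cubes_block_mat[OF R]
    define H where "H = {x. ?G (block_mat r i j x 0 0 0)}"
    have "R \<subseteq> H"
    proof (rule gen)
      have "block_mat r i j 0 0 0 0 = (0\<^sub>m r r :: 'a mat)"
        by (rule eq_matI) (auto simp: block_mat_def)
      then show "additive_subgroup_set H"
        using sum_of_cubes_zero diff[of r i j _ 0 0 0 _ 0 0 0]
        by (auto simp: additive_subgroup_set_def H_def)
      show "x * y - y * x \<in> H" if "x \<in> R" "y \<in> R" for x y
        using main(4)[OF ij(2,1) ij(3)[symmetric] that] by (simp add: H_def swap)
      show "x * x * x \<in> H" if "x \<in> R" for x
        using main(2)[OF ij that] by (simp add: H_def)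
      fix x assume x: "x \<in> R"
      \<comment> \<open>Taking \<open>a = 1\<close> gives the diagonal (2x, x) and, with
        \<open>i\<close> and \<open>j\<close> exchanged, (x, 2x); then (3x, 0) = (2x, x) - (x, 2x) +
        (2x, x).\<close>
      have 1: "?G (block_mat r i j (x + x) 0 0 x)"
        using main(3)[OF ij RD(1) x] by simp
      have 2: "?G (block_mat r i j x 0 0 (x + x))"
        using main(3)[OF ij(2,1) ij(3)[symmetric] RD(1) x] by (simp add: swap)
      have "?G (block_mat r i j (x + (x + x)) 0 0 0)"
        using sum_of_cubes_add[OF diff[OF 1 2] 1] by (simp add: block_mat_add)
      also have "x + (x + x) = 3 * x"
        by (simp only: numeral.simps distrib_right mult_1_left add.assoc)
      finally show "3 * x \<in> H" by (simp add: H_def)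
    qed
    with that show ?thesis by (auto simp: H_def)
  qed
  have CR: "C $$ (i, j) \<in> R" if "i < r" "j < r" for i j
    using C that elements_matI[of C r r i j] by (auto simp: matrices_over_def)
  \<comment> \<open>The matrix is built up entry by entry; \<open>F\<close> is the set of positions
    already filled.\<close>
  have "?G (mat r r (\<lambda>ij. if ij \<in> F then C $$ ij else 0))" if "finite F" "F \<subseteq> {..<r} \<times> {..<r}" for F
    using that
  proof (induction F rule: finite_induct)
    case empty
    have "mat r r (\<lambda>ij. if ij \<in> {} then C $$ ij else 0) = 0\<^sub>m r r" by (rule eq_matI) auto
    then show ?case using sum_of_cubes_zero by simp
  next
    case (insert ij F)
    obtain i j where ij: "ij = (i, j)" "i < r" "j < r" using insert by auto
    \<comment> \<open>A diagonal entry needs a second coordinate to complete its block; this is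
      where \<open>2 \<le> r\<close> enters.\<close>
    obtain k where k: "k < r" "k \<noteq> i"
      using \<open>2 \<le> r\<close> by (cases "i = 0") (auto intro: that[of 0] that[of 1])
    define E where "E = (if i = j then block_mat r i k (C $$ ij) 0 0 0 else block_mat r i j 0 (C $$ ij) 0 0)"
    have "?G E"
      using sum_of_cubes_block_mat(1)[OF R ij(2,3)] diag[OF ij(2) k(1)] k CR[OF ij(2,3)] ij(1)
      by (auto simp: E_def)
    moreover have "mat r r (\<lambda>kl. if kl \<in> insert ij F then C $$ kl else 0) =
        mat r r (\<lambda>ij. if ij \<in> F then C $$ ij else 0) + E"
      by (rule eq_matI) (use insert ij k in \<open>auto simp: E_def block_mat_def\<close>)
    ultimately show ?case using insert by (auto intro: sum_of_cubes_add)
  qed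
  from this[of "{..<r} \<times> {..<r}"] have "?G (mat r r (\<lambda>ij. if ij \<in> {..<r} \<times> {..<r} then C $$ ij else 0))"
    by simp
  also have "mat r r (\<lambda>ij. if ij \<in> {..<r} \<times> {..<r} then C $$ ij else 0) = C"
    by (rule eq_matI) (use C in \<open>auto simp: matrices_over_def\<close>)
  finally show ?thesis .
qed

section \<open>Irreducibility of the prime cyclotomic polynomial\<close>

text \<open>For prime \<open>p\<close> this is the p-th cyclotomic polynomial. The coefficient ring
  is left open because it is used over the integers, the rationals and the complex numbers.\<close>

definition prime_cyclotomic :: "nat \<Rightarrow> 'a::comm_ring_1 poly" where
  "prime_cyclotomic p = (\<Sum>i<p. monom 1 i)"

lemma poly_prime_cyclotomic: "poly (prime_cyclotomic p) x = (\<Sum>i<p. x ^ i)"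
  by (simp add: prime_cyclotomic_def poly_sum poly_monom)

lemma coeff_prime_cyclotomic: "coeff (prime_cyclotomic p) i = (if i < p then 1 else 0)"
  by (simp add: prime_cyclotomic_def coeff_sum)

lemma degree_prime_cyclotomic:
  assumes "p > 0" shows "degree (prime_cyclotomic p :: 'a::comm_ring_1 poly) = p - 1"
proof (rule antisym)
  show "degree (prime_cyclotomic p :: 'a poly) \<le> p - 1"
    by (rule degree_le) (auto simp: coeff_prime_cyclotomic)
  show "p - 1 \<le> degree (prime_cyclotomic p :: 'a poly)"
    by (rule le_degree) (use assms in \<open>auto simp: coeff_prime_cyclotomic\<close>)
qed

text \<open>If \<open>p\<close> misses the constant term of \<open>b\<close> in
  \<open>f = a * b\<close>, comparing coefficients from the bottom upwards shows that
  \<open>p\<close> divides every coefficient of \<open>a\<close> of index below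
  \<open>degree f\<close>. A nonconstant \<open>b\<close> would put the leading coefficient of
  \<open>a\<close>, a divisor of 1, among them. As \<open>p^2\<close> does not divide
  \<open>coeff f 0\<close>, one of the two factors is in this situation.\<close>

lemma eisenstein_int:
  fixes f :: "int poly"
  assumes p: "prime p" and monic: "lead_coeff f = 1" and deg: "degree f > 0"
    and low: "\<And>i. i < degree f \<Longrightarrow> p dvd coeff f i" and const: "\<not> p^2 dvd coeff f 0"
  shows "irreducible f"
proof -
  have key: "b dvd 1" if ab: "f = a * b" and pb: "\<not> p dvd coeff b 0" for a b
  proof -
    have nz: "a \<noteq> 0" "b \<noteq> 0" using ab deg by auto
    have degf: "degree f = degree a + degree b" using ab nz by (simp add: degree_mult_eq)
    have lc: "lead_coeff a * lead_coeff b = 1" using monic ab by (simp add: lead_coeff_mult)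
    have pa: "p dvd coeff a i" if "i < degree f" for i using that
    proof (induction i rule: less_induct)
      case (less i)
      have "coeff f i = (\<Sum>j\<le>i. coeff a j * coeff b (i - j))" by (simp add: ab coeff_mult)
      also have "{..i} = insert i {..<i}" by auto
      also have "(\<Sum>j\<in>insert i {..<i}. coeff a j * coeff b (i - j)) =
          coeff a i * coeff b 0 + (\<Sum>j<i. coeff a j * coeff b (i - j))" by simp
      finally have eq: "coeff a i * coeff b 0 = coeff f i - (\<Sum>j<i. coeff a j * coeff b (i - j))"
        by simp
      have "p dvd (\<Sum>j<i. coeff a j * coeff b (i - j))"
        using less by (intro dvd_sum) auto
      then have "p dvd coeff a i * coeff b 0" unfolding eq using low[OF less(2)] by (rule dvd_diff[rotated])
      then show ?case using p pb by (simp add: prime_dvd_mult_iff)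
    qed
    have "degree b = 0"
    proof (rule ccontr)
      assume "degree b \<noteq> 0"
      then have "p dvd lead_coeff a" using pa[of "degree a"] degf by simp
      then have "p dvd 1" unfolding lc[symmetric] by simp
      then show False using p by (simp add: prime_int_iff)
    qed
    then obtain c where c: "b = [:c:]" by (rule degree_eq_zeroE)
    with lc have "1 = c * lead_coeff a" by (simp add: mult.commute)
    then have "c dvd 1" by (rule dvdI)
    then show ?thesis using c by (simp add: is_unit_const_poly_iff)
  qed
  show ?thesis
  proof (rule irreducibleI)
    show "f \<noteq> 0" using deg by auto
    show "\<not> f dvd 1" using deg by (auto simp: is_unit_poly_iff)
    fix a b assume ab: "f = a * b"
    have "coeff f 0 = coeff a 0 * coeff b 0" by (simp add: ab coeff_mult)
    then have "\<not> (p dvd coeff a 0 \<and> p dvd coeff b 0)"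
      using const by (auto simp: power2_eq_square intro: mult_dvd_mono)
    then show "a dvd 1 \<or> b dvd 1"
      using key[OF ab] key[of b a] ab mult.commute[of a b] by metis
  qed
qed

lemma irreducible_pcompose_shiftD:
  fixes f :: "int poly"
  assumes "irreducible (pcompose f [:c, 1:])"
  shows "irreducible f"
proof (rule irreducibleI)
  let ?s = "\<lambda>h. pcompose h [:c, 1:]"
  have deg: "degree (?s h) = degree h" for h by (simp add: degree_pcompose)
  have unit: "h dvd 1" if "?s h dvd 1" for h
  proof -
    have "degree (?s h) = 0" using that unfolding is_unit_poly_iff by (metis degree_pCons_0)
    then have "degree h = 0" by (simp only: deg)
    then obtain d where "h = [:d:]" by (rule degree_eq_zeroE)
    then show ?thesis using that by (simp add: pcompose_const)
  qed
  show "f \<noteq> 0" using assms by auto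
  show "\<not> f dvd 1"
  proof
    assume "f dvd 1"
    then obtain d where "f = [:d:]" "d dvd 1" by (auto simp: is_unit_poly_iff)
    then show False using assms by (auto simp: pcompose_const irreducible_def)
  qed
  fix a b assume "f = a * b"
  then have "?s f = ?s a * ?s b" by (simp add: pcompose_mult)
  from irreducibleD[OF assms this] unit show "a dvd 1 \<or> b dvd 1" by blast
qed

text \<open>Eisenstein applies after the shift to X + 1: X times the shifted polynomial is (X + 1)^p
  - 1, so the coefficients are the binomials \<open>p choose Suc k\<close>, with constant term
  \<open>p\<close>.\<close>

lemma irreducible_prime_cyclotomic:
  assumes p: "prime (p::nat)"
  shows "irreducible (prime_cyclotomic p :: int poly)"
proof (rule irreducible_pcompose_shiftD[of _ 1], rule eisenstein_int[of "int p"])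
  let ?f = "prime_cyclotomic p :: int poly"
  let ?g = "pcompose ?f [:1, 1:]"
  have p2: "p \<ge> 2" using p by (simp add: prime_ge_2_nat)
  have degf: "degree ?f = p - 1" using p2 by (intro degree_prime_cyclotomic) auto
  have deg: "degree ?g = p - 1" by (simp add: degree_pcompose degf)
  have "?f = (\<Sum>i<p. [:0, 1:] ^ i)" by (simp add: prime_cyclotomic_def monom_altdef)
  then have g: "?g = (\<Sum>i<p. [:1, 1:] ^ i)"
    by (simp add: pcompose_sum pcompose_hom.hom_power pcompose_pCons)
  have "[:1, 1:] - 1 = [:0, 1::int:]" by (rule poly_eqI) (auto simp: coeff_pCons split: nat.split)
  then have shift: "[:0, 1:] * ?g = [:1, 1:] ^ p - 1"
    unfolding g power_diff_1_eq[of "[:1, 1:] :: int poly" p] by simp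
  have co: "coeff ?g k = int (p choose Suc k)" if "k < p" for k
  proof -
    have "coeff ?g k = coeff ([:0, 1:] * ?g) (Suc k)" by simp
    also have "\<dots> = coeff ([:1, 1:] ^ p) (Suc k)" unfolding shift by (simp add: coeff_1)
    also have "\<dots> = int (p choose Suc k)"
      using that by (subst coeff_linear_poly_power) auto
    finally show ?thesis .
  qed
  show "prime (int p)" using p by simp
  show "lead_coeff ?g = 1" using co[of "p - 1"] deg p2 by simp
  show "degree ?g > 0" using deg p2 by simp
  show "int p dvd coeff ?g i" if "i < degree ?g" for i
    using that deg co[of i] dvd_choose_prime[of "Suc i" p] p p2 by simp
  show "\<not> (int p)\<^sup>2 dvd coeff ?g 0"
    using co[of 0] p2 by (auto simp: power2_eq_square)
qed

text \<open>Pseudo-divide the cyclotomic polynomial by \<open>f\<close>. A nonzero remainder also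
  vanishes at \<xi> and has smaller degree, so induction applies. If the remainder is zero, the
  cyclotomic polynomial, a prime element, divides \<open>f\<close> or the quotient; in the second
  case \<open>f\<close> would be constant, impossible for a nonzero polynomial with a root.\<close>

lemma prime_cyclotomic_dvd_int_degree:
  fixes f :: "int poly" and \<xi> :: complex
  assumes p: "prime (p::nat)" and \<xi>: "\<xi> ^ p = 1" "\<xi> \<noteq> 1"
    and f: "poly (of_int_poly f) \<xi> = 0" "f \<noteq> 0"
  shows "p - 1 \<le> degree f"
  using f
proof (induction "degree f" arbitrary: f rule: less_induct)
  case less
  let ?P = "prime_cyclotomic p :: int poly"
  have p2: "p \<ge> 2" using p by (simp add: prime_ge_2_nat)
  have degP: "degree ?P = p - 1" using p2 by (intro degree_prime_cyclotomic) auto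
  have "of_int_poly ?P = (prime_cyclotomic p :: complex poly)"
    by (rule poly_eqI) (simp add: coeff_prime_cyclotomic)
  moreover have "poly (prime_cyclotomic p) \<xi> = 0"
    using \<xi> power_diff_1_eq[of \<xi> p] by (simp add: poly_prime_cyclotomic)
  ultimately have root: "poly (of_int_poly ?P) \<xi> = 0" by simp
  obtain c q where cq: "c \<noteq> 0" "smult c ?P = f * q + pseudo_mod ?P f"
    using pseudo_mod(1)[OF less(3), of ?P] by metis
  have "poly (of_int_poly (pseudo_mod ?P f)) \<xi> = 0"
  proof -
    have "of_int_poly (smult c ?P) = (of_int_poly f * of_int_poly q + of_int_poly (pseudo_mod ?P f) :: complex poly)"
      unfolding cq(2) by (simp add: of_int_poly_hom.hom_add of_int_poly_hom.hom_mult)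
    then have "poly (of_int_poly (smult c ?P)) \<xi> = poly (of_int_poly (pseudo_mod ?P f)) \<xi>"
      using less(2) by simp
    then show ?thesis using root by (simp add: of_int_hom.map_poly_hom_smult)
  qed
  show ?case
  proof (cases "pseudo_mod ?P f = 0")
    case False
    then have "degree (pseudo_mod ?P f) < degree f"
      using pseudo_mod(2)[OF less(3), of ?P] by simp
    moreover from this have "p - 1 \<le> degree (pseudo_mod ?P f)"
      using less(1)[OF _ \<open>poly (of_int_poly (pseudo_mod ?P f)) \<xi> = 0\<close> False] by simp
    ultimately show ?thesis by simp
  next
    case True
    then have eq: "smult c ?P = f * q" using cq by simp
    have q: "q \<noteq> 0" using eq cq degP p2 by auto
    have "?P dvd f * q" unfolding eq[symmetric] by (intro dvd_smult) simp
    moreover have "prime_elem ?P"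
      using irreducible_prime_cyclotomic[OF p] by (rule irreducible_imp_prime_elem)
    ultimately consider "?P dvd f" | "?P dvd q" using prime_elem_dvd_multD by blast
    then show ?thesis
    proof cases
      case 1
      then show ?thesis using dvd_imp_degree_le[OF _ less(3)] degP by force
    next
      case 2
      then have "degree ?P \<le> degree q" using q dvd_imp_degree_le by blast
      moreover have "degree ?P = degree f + degree q"
        using arg_cong[OF eq, of degree] cq(1) q less(3) by (simp add: degree_mult_eq)
      ultimately have "degree f = 0" by simp
      then obtain d where "f = [:d:]" by (rule degree_eq_zeroE)
      then show ?thesis using less(2,3) by simp
    qed
  qed
qed

lemma rat_poly_clear_denominators:
  fixes f :: "rat poly"
  obtains m F where "m > (0::int)" "smult (of_int m) f = of_int_poly F"
proof -
  have "\<exists>m F. m > (0::int) \<and> smult (of_int m) f = of_int_poly F"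
  proof (induction f)
    case 0
    then show ?case by (intro exI[of _ 1] exI[of _ 0]) simp
  next
    case (pCons a f)
    then obtain m F where mF: "m > (0::int)" "smult (of_int m) f = of_int_poly F" by blast
    obtain b d where a: "a = Fract b d" "d > 0" by (cases a)
    then have "a * of_int d = of_int b" by (simp add: Fract_of_int_quotient)
    with a(2) have "smult (of_int (d * m)) (pCons a f) = of_int_poly (pCons (b * m) (smult d F))"
      by (simp add: of_int_hom.map_poly_pCons_hom of_int_hom.map_poly_hom_smult mF(2)[symmetric] mult_ac)
    then show ?case using mF a by (intro exI[of _ "d * m"] exI conjI) auto
  qed
  then show thesis using that by blast
qed

interpretation of_rat_poly_hom: map_poly_comm_ring_hom "of_rat :: rat \<Rightarrow> complex" ..

text \<open>The remainder modulo the cyclotomic polynomial still vanishes at \<xi> but has degree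
  below p - 1; after clearing denominators the integral bound forces it to be zero. This
  divisibility is what makes the automorphisms \<open>sig\<close> well defined.\<close>

lemma prime_cyclotomic_dvd:
  fixes f :: "rat poly" and \<xi> :: complex
  assumes p: "prime (p::nat)" and \<xi>: "\<xi> ^ p = 1" "\<xi> \<noteq> 1"
    and f: "poly (map_poly of_rat f) \<xi> = 0"
  shows "prime_cyclotomic p dvd f"
proof -
  let ?P = "prime_cyclotomic p :: rat poly"
  have p2: "p \<ge> 2" using p by (simp add: prime_ge_2_nat)
  have degP: "degree ?P = p - 1" using p2 by (intro degree_prime_cyclotomic) auto
  have "map_poly of_rat ?P = (prime_cyclotomic p :: complex poly)"
    by (rule poly_eqI) (simp add: coeff_prime_cyclotomic)
  moreover have "poly (prime_cyclotomic p) \<xi> = 0"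
    using \<xi> power_diff_1_eq[of \<xi> p] by (simp add: poly_prime_cyclotomic)
  ultimately have root: "poly (map_poly of_rat ?P) \<xi> = 0" by simp
  define r where "r = f mod ?P"
  have "f = ?P * (f div ?P) + r" by (simp add: r_def)
  then have "map_poly of_rat f = (map_poly of_rat ?P * map_poly of_rat (f div ?P) + map_poly of_rat r :: complex poly)"
    by (metis of_rat_hom.map_poly_hom_add of_rat_poly_hom.hom_mult)
  then have r0: "poly (map_poly of_rat r) \<xi> = 0" using f root by simp
  have "r = 0"
  proof (rule ccontr)
    assume r: "r \<noteq> 0"
    then have deg: "degree r < p - 1" using degree_mod_less'[of ?P f] degP p2 by (cases "?P = 0") (auto simp: r_def)
    obtain m F where mF: "m > (0::int)" "smult (of_int m) r = of_int_poly F"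
      by (rule rat_poly_clear_denominators)
    have "F \<noteq> 0" using mF r by auto
    have "map_poly of_rat (of_int_poly F) = (of_int_poly F :: complex poly)"
      by (rule poly_eqI) simp
    moreover have "map_poly of_rat (smult (of_int m) r) = smult (of_int m) (map_poly of_rat r :: complex poly)"
      by (simp add: of_rat_hom.map_poly_hom_smult)
    ultimately have "poly (of_int_poly F) \<xi> = 0" using mF(2) r0 by simp
    from prime_cyclotomic_dvd_int_degree[OF p \<xi> this \<open>F \<noteq> 0\<close>] have "p - 1 \<le> degree F" .
    also have "degree F = degree (of_int_poly F :: rat poly)"
      by (subst degree_map_poly) auto
    also have "\<dots> = degree (smult (of_int m) r)" by (simp only: mF(2))
    also have "\<dots> = degree r" using mF(1) by simp
    finally show False using deg by simp
  qed
  then show ?thesis by (simp add: r_def mod_eq_0_iff_dvd)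
qed

section \<open>The prime cyclotomic field\<close>

lemma sum_periodic_shift:
  fixes F :: "nat \<Rightarrow> 'a::ab_group_add"
  assumes "\<And>i. F (i + N) = F i"
  shows "(\<Sum>i<N. F (i + k)) = (\<Sum>i<N. F i)"
proof (induction k)
  case (Suc k)
  have "(\<Sum>i<N. F (i + Suc k)) + F k = (\<Sum>i<Suc N. F (i + k))"
    unfolding sum.lessThan_Suc_shift by (simp add: add.commute)
  also have "\<dots> = (\<Sum>i<N. F (i + k)) + F k"
    using assms[of k] by (simp add: add.commute)
  finally show ?case using Suc by simp
qed simp

lemma prod_periodic_shift:
  fixes F :: "nat \<Rightarrow> 'a::comm_monoid_mult"
  assumes "\<And>i. F (i + N) = F i"
  shows "(\<Prod>i<N. F (i + k)) = (\<Prod>i<N. F i)"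
proof (induction k)
  case (Suc k)
  show ?case
  proof (cases N)
    case (Suc M)
    have "(\<Prod>i<N. F (i + Suc k)) = (\<Prod>i<M. F (Suc i + k)) * F (k + N)"
      by (simp add: Suc add_ac)
    also have "F (k + N) = F (0 + k)" using assms by simp
    also have "(\<Prod>i<M. F (Suc i + k)) * F (0 + k) = (\<Prod>i<N. F (i + k))"
      unfolding Suc prod.lessThan_Suc_shift by (simp add: mult.commute)
    finally show ?thesis using Suc.IH by simp
  qed simp
qed simp

text \<open>Exponents are sorted by residue class modulo \<open>n\<close>; applied to the conjugates
  of \<xi>, each class makes up one Gaussian period.\<close>

lemma sum_lessThan_mult:
  fixes F :: "nat \<Rightarrow> 'a::comm_monoid_add"
  shows "(\<Sum>i<n * h. F i) = (\<Sum>k<n. \<Sum>r<h. F (k + n * r))"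
proof -
  have "(\<Sum>i<n * h. F i) = (\<Sum>r<h. \<Sum>k<n. F (k + n * r))"
  proof (induction h)
    case (Suc h)
    have "{..<n * Suc h} = {..<n * h} \<union> {n * h..<n * h + n}" by auto
    then have "(\<Sum>i<n * Suc h. F i) = (\<Sum>i<n * h. F i) + (\<Sum>i\<in>{n * h..<n * h + n}. F i)"
      by (simp add: sum.union_disjoint ivl_disj_int)
    also have "(\<Sum>i\<in>{n * h..<n * h + n}. F i) = (\<Sum>k<n. F (k + n * h))"
      using sum.shift_bounds_nat_ivl[of F 0 "n * h" n] by (simp add: atLeast0LessThan add.commute)
    finally show ?case using Suc by simp
  qed simp
  also have "\<dots> = (\<Sum>k<n. \<Sum>r<h. F (k + n * r))" by (rule sum.swap)
  finally show ?thesis .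
qed

lemma prod_lessThan_mult:
  fixes F :: "nat \<Rightarrow> 'a::comm_monoid_mult"
  shows "(\<Prod>i<n * h. F i) = (\<Prod>k<n. \<Prod>r<h. F (k + n * r))"
proof -
  have "(\<Prod>i<n * h. F i) = (\<Prod>r<h. \<Prod>k<n. F (k + n * r))"
  proof (induction h)
    case (Suc h)
    have "{..<n * Suc h} = {..<n * h} \<union> {n * h..<n * h + n}" by auto
    then have "(\<Prod>i<n * Suc h. F i) = (\<Prod>i<n * h. F i) * (\<Prod>i\<in>{n * h..<n * h + n}. F i)"
      by (simp add: prod.union_disjoint ivl_disj_int)
    also have "(\<Prod>i\<in>{n * h..<n * h + n}. F i) = (\<Prod>k<n. F (k + n * h))"
      using prod.shift_bounds_nat_ivl[of F 0 "n * h" n] by (simp add: atLeast0LessThan add.commute)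
    finally show ?case using Suc by simp
  qed simp
  also have "\<dots> = (\<Prod>k<n. \<Prod>r<h. F (k + n * r))" by (rule prod.swap)
  finally show ?thesis .
qed

abbreviation ratpoly :: "rat poly \<Rightarrow> complex \<Rightarrow> complex" where
  "ratpoly f x \<equiv> poly (map_poly of_rat f) x"

locale prime_cyclotomic_field =
  fixes p g :: nat and \<xi> :: complex
  assumes prime_p: "prime p" and primroot: "residue_primroot p g"
    and primitive: "primitive_root_of_unity p \<xi>"
begin

lemma p_ge_2: "p \<ge> 2"
  using prime_p by (rule prime_ge_2_nat)

lemma xi_pow_p: "\<xi> ^ p = 1"
  using primitive by (simp add: primitive_root_of_unity_def)

lemma xi_cong: "[a = b] (mod p) \<Longrightarrow> \<xi> ^ a = \<xi> ^ b"
proof -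
  have "\<xi> ^ a = \<xi> ^ (a mod p)" for a
    using power_add[of \<xi> "a mod p" "p * (a div p)"] by (simp add: power_mult xi_pow_p)
  from this[of a] this[of b] show "[a = b] (mod p) \<Longrightarrow> \<xi> ^ a = \<xi> ^ b"
    by (simp add: cong_def)
qed

lemma xi_pow_eq_1_iff: "\<xi> ^ a = 1 \<longleftrightarrow> p dvd a"
proof -
  have "\<xi> ^ a = \<xi> ^ (a mod p)" by (rule xi_cong) (simp add: cong_def)
  moreover have "a mod p < p" using p_ge_2 by simp
  ultimately show ?thesis
    using primitive unfolding primitive_root_of_unity_def
    by (metis dvd_eq_mod_eq_0 neq0_conv power_0)
qed

lemma xi_ne_1: "\<xi> \<noteq> 1"
  using xi_pow_eq_1_iff[of 1] p_ge_2 by auto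

lemma xi_ne_0: "\<xi> \<noteq> 0"
  using xi_pow_p p_ge_2 by (metis power_0_left zero_neq_one not_numeral_le_zero)

section \<open>The field generated by \<xi>, its integers and its automorphisms\<close>

definition K :: "complex set" where "K = range (\<lambda>f. ratpoly f \<xi>)"

definition R :: "complex set" where "R = range (\<lambda>f. poly (of_int_poly f) \<xi>)"

text \<open>The automorphism \<open>\<xi> \<mapsto> \<xi> ^ t\<close>, meaningful on
  \<open>K\<close> and for \<open>t\<close> prime to \<open>p\<close>. The representing polynomial
  is an arbitrary choice; \<open>sig_ratpoly\<close> shows that it does not matter.\<close>

definition sig :: "nat \<Rightarrow> complex \<Rightarrow> complex" where
  "sig t x = ratpoly (SOME f. ratpoly f \<xi> = x) (\<xi> ^ t)"

lemma K_cases: assumes "x \<in> K" obtains f where "x = ratpoly f \<xi>"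
  using assms unfolding K_def by blast

lemma ratpoly_simps:
  "ratpoly (f + f') x = ratpoly f x + ratpoly f' x" "ratpoly (f - f') x = ratpoly f x - ratpoly f' x"
  "ratpoly (f * f') x = ratpoly f x * ratpoly f' x" "ratpoly [:c:] x = of_rat c" "ratpoly 1 x = 1"
  "ratpoly 0 x = 0"
  by (simp_all only: of_rat_hom.map_poly_hom_add of_rat_poly_hom.hom_mult of_rat_poly_hom.hom_minus
    of_rat_hom.map_poly_pCons_hom of_rat_poly_hom.hom_one of_rat_poly_hom.hom_zero) simp_all

lemma ratpoly_prime_cyclotomic: "\<not> p dvd t \<Longrightarrow> ratpoly (prime_cyclotomic p) (\<xi> ^ t) = 0"
proof -
  assume t: "\<not> p dvd t"
  have "map_poly of_rat (prime_cyclotomic p) = (prime_cyclotomic p :: complex poly)"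
    by (rule poly_eqI) (simp add: coeff_prime_cyclotomic)
  moreover have "(\<xi> ^ t) ^ p = 1" by (metis mult.commute power_mult power_one xi_pow_p)
  ultimately show ?thesis
    using power_diff_1_eq[of "\<xi> ^ t" p] t xi_pow_eq_1_iff[of t] by (simp add: poly_prime_cyclotomic)
qed

lemma ratpoly_root_dvd: "ratpoly f \<xi> = 0 \<Longrightarrow> prime_cyclotomic p dvd f"
  by (rule prime_cyclotomic_dvd[OF prime_p xi_pow_p xi_ne_1])

text \<open>Two polynomials with the same value at \<xi> differ by a multiple of the cyclotomic
  polynomial, which vanishes at \<open>\<xi> ^ t\<close> too.\<close>

lemma sig_ratpoly:
  assumes "\<not> p dvd t"
  shows "sig t (ratpoly f \<xi>) = ratpoly f (\<xi> ^ t)"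
proof -
  let ?f = "SOME f'. ratpoly f' \<xi> = ratpoly f \<xi>"
  have "ratpoly ?f \<xi> = ratpoly f \<xi>" by (rule someI_ex) blast
  then have "prime_cyclotomic p dvd ?f - f"
    by (intro ratpoly_root_dvd) (simp add: ratpoly_simps)
  then obtain q where "?f - f = prime_cyclotomic p * q" by (rule dvdE)
  then have "ratpoly (?f - f) (\<xi> ^ t) = 0"
    using ratpoly_prime_cyclotomic[OF assms] by (simp add: ratpoly_simps)
  then show ?thesis by (simp add: sig_def ratpoly_simps)
qed

lemma K_closed [simp, intro]:
  "x \<in> K \<Longrightarrow> y \<in> K \<Longrightarrow> x + y \<in> K" "x \<in> K \<Longrightarrow> y \<in> K \<Longrightarrow> x - y \<in> K"
  "x \<in> K \<Longrightarrow> y \<in> K \<Longrightarrow> x * y \<in> K" "1 \<in> K" "0 \<in> K" "of_rat c \<in> K"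
proof -
  show "x \<in> K \<Longrightarrow> y \<in> K \<Longrightarrow> x + y \<in> K" unfolding K_def by (auto simp flip: ratpoly_simps(1))
  show "x \<in> K \<Longrightarrow> y \<in> K \<Longrightarrow> x - y \<in> K" unfolding K_def by (auto simp flip: ratpoly_simps(2))
  show "x \<in> K \<Longrightarrow> y \<in> K \<Longrightarrow> x * y \<in> K" unfolding K_def by (auto simp flip: ratpoly_simps(3))
  show c: "of_rat c \<in> K" for c unfolding K_def ratpoly_simps(4)[of c \<xi>, symmetric] by (rule rangeI)
  show "1 \<in> K" "0 \<in> K" using c[of 1] c[of 0] by simp_all
qed

lemma R_closed [simp, intro]:
  "x \<in> R \<Longrightarrow> y \<in> R \<Longrightarrow> x + y \<in> R" "x \<in> R \<Longrightarrow> y \<in> R \<Longrightarrow> x - y \<in> R"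
  "x \<in> R \<Longrightarrow> y \<in> R \<Longrightarrow> x * y \<in> R" "1 \<in> R" "0 \<in> R" "of_int c \<in> R" "\<xi> \<in> R" "of_nat m \<in> R"
proof -
  have "poly (of_int_poly [:c:]) \<xi> = of_int c" for c
    by (cases "c = 0") (simp_all add: map_poly_pCons)
  then show 1: "of_int c \<in> R" for c unfolding R_def by (metis rangeI)
  from 1[of 0] 1[of 1] 1[of "int m"] show "1 \<in> R" "0 \<in> R" "of_nat m \<in> R" by simp_all
  have "poly (of_int_poly [:0, 1:]) \<xi> = \<xi>" by (simp add: map_poly_pCons)
  then show "\<xi> \<in> R" unfolding R_def by (metis rangeI)
  have "poly (of_int_poly f) \<xi> + poly (of_int_poly f') \<xi> = poly (of_int_poly (f + f')) \<xi>"
    "poly (of_int_poly f) \<xi> - poly (of_int_poly f') \<xi> = poly (of_int_poly (f - f')) \<xi>"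
    "poly (of_int_poly f) \<xi> * poly (of_int_poly f') \<xi> = poly (of_int_poly (f * f')) \<xi>" for f f'
    by (simp_all add: of_int_poly_hom.hom_add of_int_poly_hom.hom_minus of_int_poly_hom.hom_mult)
  then show "x \<in> R \<Longrightarrow> y \<in> R \<Longrightarrow> x + y \<in> R" "x \<in> R \<Longrightarrow> y \<in> R \<Longrightarrow> x - y \<in> R"
    "x \<in> R \<Longrightarrow> y \<in> R \<Longrightarrow> x * y \<in> R"
    unfolding R_def by auto
qed

lemma R_subset_K: "R \<subseteq> K"
proof
  fix x assume "x \<in> R"
  then obtain f where "x = poly (of_int_poly f) \<xi>" unfolding R_def by blast
  moreover have "map_poly of_rat (of_int_poly f) = (of_int_poly f :: complex poly)"
    by (rule poly_eqI) simp
  ultimately show "x \<in> K" unfolding K_def by (metis rangeI)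
qed

lemma R_power [simp, intro]: "x \<in> R \<Longrightarrow> x ^ k \<in> R"
  by (induction k) auto

lemma R_sum [intro]: "(\<And>i. i \<in> A \<Longrightarrow> f i \<in> R) \<Longrightarrow> sum f A \<in> R"
  by (induction A rule: infinite_finite_induct) auto

lemma R_prod [intro]: "(\<And>i. i \<in> A \<Longrightarrow> f i \<in> R) \<Longrightarrow> prod f A \<in> R"
  by (induction A rule: infinite_finite_induct) auto

lemma sig_hom:
  assumes "\<not> p dvd t"
  shows "x \<in> K \<Longrightarrow> y \<in> K \<Longrightarrow> sig t (x + y) = sig t x + sig t y"
    and "x \<in> K \<Longrightarrow> y \<in> K \<Longrightarrow> sig t (x - y) = sig t x - sig t y"
    and "x \<in> K \<Longrightarrow> y \<in> K \<Longrightarrow> sig t (x * y) = sig t x * sig t y"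
    and "sig t (of_rat c) = of_rat c" and "sig t 1 = 1" and "sig t 0 = 0"
    and "x \<in> K \<Longrightarrow> sig t x \<in> K" and "x \<in> R \<Longrightarrow> sig t x \<in> R" and "sig t (\<xi> ^ a) = \<xi> ^ (a * t)"
    and "sig t (of_int m) = of_int m"
proof -
  note s = sig_ratpoly[OF assms]
  show "x \<in> K \<Longrightarrow> y \<in> K \<Longrightarrow> sig t (x + y) = sig t x + sig t y"
    "x \<in> K \<Longrightarrow> y \<in> K \<Longrightarrow> sig t (x - y) = sig t x - sig t y"
    "x \<in> K \<Longrightarrow> y \<in> K \<Longrightarrow> sig t (x * y) = sig t x * sig t y"
    unfolding K_def by (auto simp flip: ratpoly_simps simp: s)
  show c: "sig t (of_rat c) = of_rat c" for c using s[of "[:c:]"] by (simp add: ratpoly_simps)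
  show "sig t 1 = 1" "sig t 0 = 0" "sig t (of_int m) = of_int m"
    using c[of 1] c[of 0] c[of "of_int m"] by simp_all
  have pc: "ratpoly f (\<xi> ^ t) = ratpoly (pcompose f (monom 1 t)) \<xi>" for f
    by (simp add: of_rat_hom.map_poly_pcompose poly_pcompose poly_monom)
  show "x \<in> K \<Longrightarrow> sig t x \<in> K"
    unfolding K_def using s pc by auto
  have pi: "poly (of_int_poly f) (\<xi> ^ t) = poly (of_int_poly (pcompose f (monom 1 t))) \<xi>" for f
    by (simp add: of_int_hom.map_poly_pcompose poly_pcompose poly_monom)
  show "sig t x \<in> R" if xR: "x \<in> R"
  proof -
    obtain f where f: "x = poly (of_int_poly f) \<xi>" using xR unfolding R_def by blast
    have "map_poly of_rat (of_int_poly f) = (of_int_poly f :: complex poly)"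
      by (rule poly_eqI) simp
    then have "sig t x = poly (of_int_poly f) (\<xi> ^ t)" using s[of "of_int_poly f"] f by simp
    then show ?thesis unfolding pi R_def by blast
  qed
  show "sig t (\<xi> ^ a) = \<xi> ^ (a * t)"
    using s[of "monom 1 a"] by (simp add: poly_monom power_mult[symmetric] mult.commute)
qed

lemma sig_sum:
  assumes "\<not> p dvd t" "\<And>i. i \<in> A \<Longrightarrow> f i \<in> K"
  shows "sig t (sum f A) = (\<Sum>i\<in>A. sig t (f i)) \<and> sum f A \<in> K"
  using assms(2) by (induction A rule: infinite_finite_induct) (auto simp: sig_hom[OF assms(1)])

lemma sig_prod:
  assumes "\<not> p dvd t" "\<And>i. i \<in> A \<Longrightarrow> f i \<in> K"
  shows "sig t (prod f A) = (\<Prod>i\<in>A. sig t (f i)) \<and> prod f A \<in> K"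
  using assms(2) by (induction A rule: infinite_finite_induct) (auto simp: sig_hom[OF assms(1)])

lemma sig_power: "\<not> p dvd t \<Longrightarrow> x \<in> K \<Longrightarrow> sig t (x ^ k) = sig t x ^ k \<and> x ^ k \<in> K"
  by (induction k) (auto simp: sig_hom)

lemma sig_sig:
  assumes "\<not> p dvd s" "\<not> p dvd t" "x \<in> K"
  shows "sig s (sig t x) = sig (t * s) x"
proof -
  obtain f where f: "x = ratpoly f \<xi>" using assms(3) by (rule K_cases)
  have pc: "ratpoly f (y ^ t) = ratpoly (pcompose f (monom 1 t)) y" for f y
    by (simp add: of_rat_hom.map_poly_pcompose poly_pcompose poly_monom)
  have "\<not> p dvd t * s" using assms prime_p by (simp add: prime_dvd_mult_iff)
  then have "sig (t * s) x = ratpoly f (\<xi> ^ (t * s))" unfolding f by (rule sig_ratpoly)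
  also have "\<xi> ^ (t * s) = (\<xi> ^ s) ^ t" by (metis mult.commute power_mult)
  also have "ratpoly f ((\<xi> ^ s) ^ t) = sig s (ratpoly (pcompose f (monom 1 t)) \<xi>)"
    unfolding pc by (rule sig_ratpoly[OF assms(1), symmetric])
  also have "ratpoly (pcompose f (monom 1 t)) \<xi> = sig t x"
    unfolding f sig_ratpoly[OF assms(2)] by (rule pc[symmetric])
  finally show ?thesis by simp
qed

lemma sig_cong: "[s = t] (mod p) \<Longrightarrow> sig s x = sig t x"
  using xi_cong[of s t] by (simp add: sig_def)

lemma sig_1: "x \<in> K \<Longrightarrow> sig 1 x = x"
  using sig_ratpoly[of 1] p_ge_2 by (auto elim: K_cases)

text \<open>Let \<open>d\<close> be the gcd of a representing polynomial and the cyclotomic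
  polynomial. It does not vanish at \<xi>, so its cofactor does and is divisible by the whole
  cyclotomic polynomial; hence \<open>d\<close> is constant and Bezout gives the inverse.\<close>

lemma K_inverse:
  assumes "x \<in> K" shows "inverse x \<in> K"
proof (cases "x = 0")
  case False
  obtain f where f: "x = ratpoly f \<xi>" using assms by (rule K_cases)
  let ?P = "prime_cyclotomic p :: rat poly"
  define d where "d = gcd f ?P"
  have P0: "?P \<noteq> 0" using p_ge_2 coeff_prime_cyclotomic[of p 0] by (metis coeff_0 not_numeral_le_zero neq0_conv zero_neq_one)
  obtain e where e: "?P = d * e" unfolding d_def by (metis dvdE gcd_dvd2)
  obtain f' where f': "f = d * f'" unfolding d_def by (metis dvdE gcd_dvd1)
  have "ratpoly d \<xi> \<noteq> 0" using f f' False by (auto simp: ratpoly_simps)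
  moreover have "\<not> p dvd 1" using p_ge_2 by auto
  ultimately have "ratpoly e \<xi> = 0"
    using ratpoly_prime_cyclotomic[of 1] e by (auto simp: ratpoly_simps)
  then have "?P dvd e" by (rule ratpoly_root_dvd)
  then have "degree ?P \<le> degree e" using e P0 by (intro dvd_imp_degree_le) auto
  moreover have "degree ?P = degree d + degree e" using e P0 by (metis degree_mult_eq mult_eq_0_iff)
  ultimately have "degree d = 0" by simp
  then obtain c where c: "d = [:c:]" by (rule degree_eq_zeroE)
  have "c \<noteq> 0" using c e P0 by auto
  obtain a b where "a * f + b * ?P = d" unfolding d_def by (metis bezout_coefficients prod.exhaust)
  then have "ratpoly a \<xi> * x = of_rat c"
    using ratpoly_prime_cyclotomic[of 1] \<open>\<not> p dvd 1\<close> c f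
    by (metis add.right_neutral mult_zero_right power_one_right ratpoly_simps(1,3,4))
  then have "inverse x = ratpoly a \<xi> * of_rat (inverse c)"
    using False \<open>c \<noteq> 0\<close> unfolding of_rat_inverse by (simp add: divide_simps)
  then show ?thesis by (auto simp: K_def[symmetric] intro!: K_closed) (simp add: K_def)
qed simp

lemma K_subfield: "is_subfield K"
  by (auto simp: is_subfield_def K_inverse)

section \<open>Powers of the primitive root and the conjugates of \<xi>\<close>

lemma not_dvd_g_power: "\<not> p dvd g ^ i"
proof -
  have "coprime p g" using primroot by (simp add: residue_primroot_def)
  then have "\<not> p dvd g" using coprime_absorb_left[of p g] p_ge_2 by auto
  then show ?thesis using prime_p prime_dvd_power by blast
qed

lemma g_power_period: "[g ^ (i + (p - 1)) = g ^ i] (mod p)"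
proof -
  have "[g ^ (p - 1) = 1] (mod p)"
    using fermat_theorem[OF prime_p] not_dvd_g_power[of 1] by simp
  then show ?thesis unfolding power_add by (metis cong_scalar_left mult.right_neutral)
qed

lemma g_power_bij: "bij_betw (\<lambda>i. g ^ i mod p) {..<p - 1} {0<..<p}"
  using residue_primroot_is_generator[OF _ primroot] p_ge_2 prime_p
  by (simp add: totient_prime totatives_prime)

lemma g_power_surj:
  assumes "\<not> p dvd t" obtains i where "i < p - 1" "[g ^ i = t] (mod p)"
proof -
  have "t mod p \<in> {0<..<p}" using assms p_ge_2 by (auto simp: dvd_eq_mod_eq_0)
  then obtain i where "i < p - 1" "g ^ i mod p = t mod p"
    using g_power_bij unfolding bij_betw_def by (metis (no_types, lifting) imageE lessThan_iff)
  then show thesis using that by (auto simp: cong_def)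
qed

lemma g_power_cong_1_iff: "[g ^ i = 1] (mod p) \<longleftrightarrow> p - 1 dvd i"
  using primroot prime_p ord_divides[of g i p] by (simp add: residue_primroot_def totient_prime)

text \<open>Indexing the conjugates of \<xi> by the discrete logarithm turns
  \<open>sig (g ^ j)\<close> into the shift \<open>i \<mapsto> i + j\<close>, with period p -
  1.\<close>

definition e :: "nat \<Rightarrow> complex" where "e i = \<xi> ^ (g ^ i)"

lemma e_period: "e (i + (p - 1)) = e i"
  unfolding e_def by (rule xi_cong) (rule g_power_period)

lemma e_in_R [simp]: "e i \<in> R"
  by (simp add: e_def)

lemma e_in_K [simp]: "e i \<in> K"
  using R_subset_K by auto

lemma sig_e: "sig (g ^ j) (e i) = e (i + j)"
  unfolding e_def using sig_hom(9)[OF not_dvd_g_power] by (simp add: power_add)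

text \<open>The \<open>g ^ i\<close> run through the nonzero residues, so this is a full geometric
  sum minus the term 1 of residue 0.\<close>

lemma sum_e_mult: "(\<Sum>i<p - 1. \<xi> ^ (g ^ i * t)) = (if p dvd t then of_nat p - 1 else - 1)"
proof -
  have "(\<Sum>i<p - 1. \<xi> ^ (g ^ i * t)) = (\<Sum>i<p - 1. \<xi> ^ (g ^ i mod p * t))"
    by (intro sum.cong refl xi_cong) (auto simp: cong_def mod_mult_left_eq)
  also have "\<dots> = (\<Sum>j\<in>{0<..<p}. \<xi> ^ (j * t))"
    by (rule sum.reindex_bij_betw[OF g_power_bij])
  also have "\<dots> = (\<Sum>j<p. (\<xi> ^ t) ^ j) - 1"
  proof -
    have "{..<p} = insert 0 {0<..<p}" using p_ge_2 by auto
    then show ?thesis by (simp add: power_mult[symmetric] mult.commute)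
  qed
  also have "\<dots> = (if p dvd t then of_nat p - 1 else - 1)"
  proof (cases "p dvd t")
    case True
    then show ?thesis using xi_pow_eq_1_iff[of t] by simp
  next
    case False
    have "(\<xi> ^ t) ^ p = 1" by (metis mult.commute power_mult power_one xi_pow_p)
    then show ?thesis using power_diff_1_eq[of "\<xi> ^ t" p] False xi_pow_eq_1_iff[of t] by simp
  qed
  finally show ?thesis .
qed

lemma sum_e: "(\<Sum>i<p - 1. e i) = - 1"
  using sum_e_mult[of 1] p_ge_2 by (auto simp: e_def)

text \<open>The conjugates serve as basis because the automorphisms permute them. They span: every
  power of \<xi> other than 1 is some \<open>e i\<close>, and 1 is minus the sum of all of
  them.\<close>

lemma R_basis:
  assumes "x \<in> R"
  obtains d :: "nat \<Rightarrow> int" where "x = (\<Sum>i<p - 1. of_int (d i) * e i)"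
proof -
  define L where "L = {\<Sum>i<p - 1. of_int (d i) * e i | d :: nat \<Rightarrow> int. True}"
  have add: "x + y \<in> L" if xy: "x \<in> L" "y \<in> L" for x y
  proof -
    obtain d d' where "x = (\<Sum>i<p - 1. of_int (d i) * e i)" "y = (\<Sum>i<p - 1. of_int (d' i) * e i)"
      using xy unfolding L_def by blast
    then have "x + y = (\<Sum>i<p - 1. of_int (d i + d' i) * e i)"
      by (simp add: sum.distrib distrib_right)
    then show ?thesis unfolding L_def by (intro CollectI exI conjI TrueI)
  qed
  have scale: "of_int m * x \<in> L" if x: "x \<in> L" for m x
  proof -
    obtain d where "x = (\<Sum>i<p - 1. of_int (d i) * e i)" using x unfolding L_def by blast
    then have "of_int m * x = (\<Sum>i<p - 1. of_int (m * d i) * e i)"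
      by (simp add: sum_distrib_left mult.assoc)
    then show ?thesis unfolding L_def by (intro CollectI exI conjI TrueI)
  qed
  have zero: "0 \<in> L" unfolding L_def by (rule CollectI, rule exI[of _ "\<lambda>_. 0"]) simp
  have ei: "e i \<in> L" if "i < p - 1" for i
    unfolding L_def by (rule CollectI, rule exI[of _ "\<lambda>j. if j = i then 1 else 0"])
      (use that in \<open>simp add: if_distrib[of of_int] if_distrib[of "\<lambda>x. x * _"] cong: if_cong\<close>)
  have "- 1 = (\<Sum>i<p - 1. of_int 1 * e i)" using sum_e by simp
  then have "- 1 \<in> L" unfolding L_def by (intro CollectI exI[of _ "\<lambda>_. 1"] conjI TrueI)
  from scale[OF this, of "- 1"] have one: "1 \<in> L" by simp
  have pow: "\<xi> ^ j \<in> L" for j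
  proof (cases "p dvd j")
    case True
    then show ?thesis using one xi_pow_eq_1_iff[of j] by simp
  next
    case False
    then obtain i where "i < p - 1" "[g ^ i = j] (mod p)" by (rule g_power_surj)
    then show ?thesis using ei[of i] xi_cong by (metis e_def)
  qed
  obtain f where "x = poly (of_int_poly f) \<xi>" using assms unfolding R_def by blast
  then have "x = (\<Sum>j\<le>degree (of_int_poly f :: complex poly). of_int (coeff f j) * \<xi> ^ j)"
    by (simp add: poly_altdef)
  also have "(\<Sum>j\<in>A. of_int (coeff f j) * \<xi> ^ j) \<in> L" for A
    using zero add scale pow by (induction A rule: infinite_finite_induct) auto
  note this[of "{..degree (of_int_poly f :: complex poly)}"]
  finally show thesis using that unfolding L_def by blast
qed

text \<open>Dividing a relation by \<xi> lowers the exponents from residues in 1, ..., p - 1 to the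
  \<open>q i\<close> in 0, ..., p - 2. It becomes an integral polynomial of degree at most p - 2
  with root \<xi>, hence zero.\<close>

lemma e_independent:
  fixes d :: "nat \<Rightarrow> int"
  assumes "(\<Sum>i<p - 1. of_int (d i) * e i) = 0" "j < p - 1"
  shows "d j = 0"
proof -
  define q where "q i = g ^ i mod p - 1" for i
  have q: "q i + 1 = g ^ i mod p" for i
    using not_dvd_g_power[of i] by (auto simp: q_def dvd_eq_mod_eq_0)
  define P where "P = (\<Sum>i<p - 1. monom (d i) (q i))"
  have e_q: "e i = \<xi> ^ q i * \<xi>" for i
  proof -
    have "e i = \<xi> ^ (g ^ i mod p)" unfolding e_def by (rule xi_cong) (simp add: cong_def)
    then show ?thesis unfolding q[symmetric] by simp
  qed
  have "poly (of_int_poly P) \<xi> * \<xi> = (\<Sum>i<p - 1. of_int (d i) * \<xi> ^ q i) * \<xi>"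
    by (simp add: P_def of_int_poly_hom.hom_sum poly_sum poly_monom)
  also have "\<dots> = 0"
    using assms(1) by (simp add: sum_distrib_right e_q mult.assoc)
  finally have root: "poly (of_int_poly P) \<xi> = 0" using xi_ne_0 by simp
  have coeffP: "coeff P k = (\<Sum>i<p - 1. if q i = k then d i else 0)" for k
    by (simp add: P_def coeff_sum)
  have "P = 0"
  proof (rule ccontr)
    assume P: "P \<noteq> 0"
    have "p - 1 \<le> degree P"
      using prime_cyclotomic_dvd_int_degree[OF prime_p xi_pow_p xi_ne_1 root P] .
    moreover have "degree P \<le> p - 2"
    proof (rule degree_le, intro allI impI)
      fix k assume k: "p - 2 < k"
      have "q i \<noteq> k" for i
        using q[of i] mod_less_divisor[of p "g ^ i"] p_ge_2 k by linarith
      then show "coeff P k = 0" by (simp add: coeffP)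
    qed
    ultimately show False using p_ge_2 by linarith
  qed
  then have "0 = (\<Sum>i<p - 1. if q i = q j then d i else 0)"
    using coeffP[of "q j"] by simp
  also have "\<dots> = (\<Sum>i<p - 1. if i = j then d i else 0)"
  proof (intro sum.cong refl)
    fix i assume i: "i \<in> {..<p - 1}"
    have "q i = q j \<longleftrightarrow> g ^ i mod p = g ^ j mod p"
      using q[of i] q[of j] by linarith
    also have "\<dots> \<longleftrightarrow> i = j"
      using g_power_bij i assms(2) by (auto simp: bij_betw_def inj_on_def)
    finally show "(if q i = q j then d i else 0) = (if i = j then d i else 0)" by simp
  qed
  also have "\<dots> = d j" using assms(2) by simp
  finally show ?thesis by simp
qed

section \<open>Gaussian periods\<close>

definition eta :: "nat \<Rightarrow> nat \<Rightarrow> complex" where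
  "eta n k = (\<Sum>r<(p - 1) div n. e (k + n * r))"

lemma eta_in_R [simp]: "eta n k \<in> R"
  by (auto simp: eta_def)

lemma sig_eta: "sig (g ^ j) (eta n k) = eta n (k + j)"
  unfolding eta_def using sig_sum[OF not_dvd_g_power, of "{..<(p - 1) div n}" "\<lambda>r. e (k + n * r)" j]
  by (simp add: sig_e add_ac)

lemma sum_eta:
  assumes "n dvd p - 1"
  shows "(\<Sum>k<n. eta n k) = - 1"
  unfolding eta_def sum_lessThan_mult[symmetric] using assms sum_e by simp

lemma eta_period:
  assumes "n dvd p - 1"
  shows "eta n (k + n) = eta n k"
proof -
  obtain h where h: "p - 1 = n * h" using assms by (rule dvdE)
  then have "n > 0" using p_ge_2 by (cases "n = 0") auto
  then have "(p - 1) div n = h" using h by simp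
  define F where "F r = e (k + n * r)" for r
  have "F (r + h) = F r" for r
    unfolding F_def using e_period[of "k + n * r"] h by (simp add: algebra_simps)
  then have "(\<Sum>r<h. F (r + 1)) = (\<Sum>r<h. F r)" by (rule sum_periodic_shift)
  then show ?thesis
    unfolding eta_def \<open>(p - 1) div n = h\<close> F_def by (simp add: algebra_simps)
qed

lemma eta_cong:
  assumes "n dvd p - 1" "[k = l] (mod n)"
  shows "eta n k = eta n l"
proof -
  have "eta n (k + n * j) = eta n k" for k j
  proof (induction j)
    case (Suc j)
    then show ?case using eta_period[OF assms(1), of "k + n * j"] by (simp add: ac_simps)
  qed simp
  from this[of "k mod n" "k div n"] this[of "l mod n" "l div n"] show ?thesis
    using assms(2) by (simp add: cong_def)
qed

text \<open>In the basis of conjugates \<open>sig (g ^ n)\<close> shifts the coordinates by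
  \<open>n\<close>. By independence the coordinates of an invariant element are
  \<open>n\<close>-periodic, and collecting equal ones produces the periods.\<close>

lemma fixed_by_sig_power:
  assumes "n dvd p - 1" "x \<in> R" and stable: "sig (g ^ n) x = x"
  obtains c :: "nat \<Rightarrow> int" where "x = (\<Sum>k<n. of_int (c k) * eta n k)"
proof -
  define N where "N = p - 1"
  have N: "N > 0" using p_ge_2 by (simp add: N_def)
  obtain h where h: "N = n * h" using assms(1) unfolding N_def by (rule dvdE)
  have n: "n > 0" "n \<le> N" using N h by (auto intro: dvd_imp_le)
  have h': "(p - 1) div n = h" using h n by (simp add: N_def)
  obtain d0 where d0: "x = (\<Sum>i<N. of_int (d0 i) * e i)"
    using R_basis[OF assms(2)] unfolding N_def by blast
  define d where "d i = d0 (i mod N)" for i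
  have d: "x = (\<Sum>i<N. of_int (d i) * e i)" unfolding d0 by (simp add: d_def)
  have dper: "d (i + N) = d i" for i by (simp add: d_def)
  have eper: "e (i + N) = e i" for i using e_period by (simp add: N_def)
  \<comment> \<open>The index \<open>i + (N - n)\<close> stands for i - n modulo \<open>N\<close>
    without truncated subtraction.\<close>
  define F where "F i = of_int (d (i + (N - n))) * e i" for i
  have Fn: "F (i + n) = of_int (d i) * e (i + n)" for i
    using dper[of i] n by (simp add: F_def algebra_simps)
  have "F (i + N) = F i" for i
    using dper[of "i + (N - n)"] eper[of i] by (simp add: F_def add_ac)
  then have "(\<Sum>i<N. F (i + n)) = (\<Sum>i<N. F i)" by (rule sum_periodic_shift)
  moreover have "x = (\<Sum>i<N. F (i + n))"
  proof -
    have oi: "of_int m \<in> K" for m using R_subset_K by auto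
    have "sig (g ^ n) x = (\<Sum>i<N. sig (g ^ n) (of_int (d i) * e i))"
      unfolding d using sig_sum[OF not_dvd_g_power, of "{..<N}" "\<lambda>i. of_int (d i) * e i" n] oi by simp
    also have "\<dots> = (\<Sum>i<N. F (i + n))"
      using oi by (simp add: Fn sig_hom[OF not_dvd_g_power] sig_e)
    finally show ?thesis using stable by simp
  qed
  ultimately have "(\<Sum>i<N. of_int (d i) * e i) = (\<Sum>i<N. of_int (d (i + (N - n))) * e i)"
    unfolding d F_def by simp
  then have "(\<Sum>i<p - 1. of_int (d i - d (i + (N - n))) * e i) = 0"
    by (simp add: N_def sum_subtractf left_diff_distrib)
  from e_independent[OF this] have *: "d i = d (i + (N - n))" if "i < N" for i
    using that by (simp add: N_def)
  have **: "d i = d (i + (N - n))" for i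
    using *[of "i mod N"] N by (simp add: d_def mod_add_left_eq)
  have dn: "d (i + n) = d i" for i
    using **[of "i + n"] dper[of i] n by simp
  have dnr: "d (k + n * r) = d k" for k r
  proof (induction r)
    case (Suc r)
    then show ?case using dn[of "k + n * r"] by (simp add: ac_simps)
  qed simp
  have "x = (\<Sum>k<n. \<Sum>r<h. of_int (d (k + n * r)) * e (k + n * r))"
    unfolding d h by (rule sum_lessThan_mult)
  also have "\<dots> = (\<Sum>k<n. of_int (d k) * eta n k)"
    unfolding eta_def h' by (simp add: dnr sum_distrib_left)
  finally show thesis by (rule that)
qed

text \<open>This is the case \<open>n = 1\<close> of the preceding lemma: the only period is the sum
  of all conjugates, which is -1.\<close>

lemma fixed_by_sig_int:
  assumes "x \<in> R" "sig g x = x"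
  obtains m :: int where "x = of_int m"
proof -
  obtain c :: "nat \<Rightarrow> int" where "x = (\<Sum>k<1. of_int (c k) * eta 1 k)"
    by (rule fixed_by_sig_power[of 1 x]) (use assms in auto)
  moreover have "eta 1 0 = - 1" using sum_eta[of 1] by simp
  ultimately have "x = of_int (- c 0)" by simp
  then show thesis by (rule that)
qed

lemma rational_in_R:
  assumes "x \<in> R" "x \<in> \<rat>"
  obtains m :: int where "x = of_int m"
proof -
  obtain c where "x = of_rat c" using assms(2) by (rule Rats_cases)
  then have "sig g x = x" using sig_hom(4)[OF not_dvd_g_power[of 1]] by simp
  then show thesis using fixed_by_sig_int assms(1) that by blast
qed

lemma K_denominator:
  assumes "x \<in> K"
  obtains m where "m > (0::int)" "of_int m * x \<in> R"
proof -
  obtain f where f: "x = ratpoly f \<xi>" using assms by (rule K_cases)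
  obtain m F where mF: "m > (0::int)" "smult (of_int m) f = of_int_poly F"
    by (rule rat_poly_clear_denominators)
  have "map_poly of_rat (of_int_poly F) = (of_int_poly F :: complex poly)"
    by (rule poly_eqI) simp
  moreover have "map_poly of_rat (smult (of_int m) f) = smult (of_int m) (map_poly of_rat f :: complex poly)"
    by (simp add: of_rat_hom.map_poly_hom_smult)
  ultimately have "smult (of_int m) (map_poly of_rat f :: complex poly) = of_int_poly F"
    by (simp only: mF(2))
  then have "of_int m * x = poly (of_int_poly F) \<xi>" unfolding f by (metis poly_smult)
  then have "of_int m * x \<in> R" unfolding R_def by blast
  then show thesis using that mF(1) by blast
qed

text \<open>The trace form on the periods is \<open>p\<close> times a permutation matrix minus \<open>(p - 1) / n\<close>
  times the all-ones matrix.\<close>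

lemma eta_trace_form:
  assumes "n dvd p - 1"
  obtains i0 where "\<And>m. \<not> n dvd m \<Longrightarrow> (\<Sum>k<n. eta n k * (eta n (k + i0) - eta n (k + i0 + m))) = of_nat p"
proof -
  define N where "N = p - 1"
  have N: "N > 0" using p_ge_2 by (simp add: N_def)
  obtain h where h: "N = n * h" using assms(1) unfolding N_def by (rule dvdE)
  have n: "n > 0" "n \<le> N" using N h by (auto intro: dvd_imp_le)
  have h': "(p - 1) div n = h" using h n by (simp add: N_def)
  have hpos: "h > 0" using N h by (cases h) auto
  have "\<not> p dvd p - 1"
    using p_ge_2 by (auto dest: dvd_imp_le)
  \<comment> \<open>\<open>i0\<close> is the discrete logarithm of -1: two conjugates of \<xi> have
    product 1 exactly when their indices differ by \<open>i0\<close> modulo p - 1, and only such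
    products contribute a \<open>p\<close> to the trace.\<close>
  then obtain i0 where i0: "i0 < p - 1" "[g ^ i0 = p - 1] (mod p)" by (rule g_power_surj)
  have minus1: "p dvd 1 + g ^ i \<longleftrightarrow> [i = i0] (mod N)" for i
  proof -
    have "p dvd 1 + g ^ i \<longleftrightarrow> [1 + g ^ i = 1 + (p - 1)] (mod p)"
      using p_ge_2 by (simp add: cong_def dvd_eq_mod_eq_0)
    also have "\<dots> \<longleftrightarrow> [g ^ i = p - 1] (mod p)" by (rule cong_add_lcancel_nat)
    also have "\<dots> \<longleftrightarrow> [g ^ i = g ^ i0] (mod p)" using i0(2) by (auto simp: cong_def)
    also have "\<dots> \<longleftrightarrow> [i = i0] (mod N)"
      using order_divides_expdiff[of p g i i0] primroot prime_p
      by (simp add: residue_primroot_def totient_prime N_def)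
    finally show ?thesis .
  qed
  define T where "T j = (\<Sum>k<n. eta n k * eta n (k + j))" for j
  have T: "T j = (\<Sum>s<h. if [j + n * s = i0] (mod N) then of_nat p else 0) - of_nat h" for j
  proof -
    have "eta n k * eta n (k + j) = (\<Sum>r<h. \<Sum>s<h. \<xi> ^ (g ^ (k + n * r) * (1 + g ^ (j + n * s))))" for k
    proof -
      \<comment> \<open>Starting the second period at \<open>k + n * r + j\<close> changes nothing
        modulo \<open>n\<close>. Then \<open>g ^ (k + n * r)\<close> factors out of the exponent,
        and the sums over \<open>k\<close> and \<open>r\<close> merge into one over all powers of
        \<open>g\<close>.\<close>
      have shift: "eta n (k + j) = (\<Sum>s<h. e (k + n * r + (j + n * s)))" for r
      proof -
        have "eta n (k + j) = eta n (k + n * r + j)"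
        proof (rule eta_cong[OF assms])
          have "k + n * r + j = (k + j) + n * r" by simp
          then show "[k + j = k + n * r + j] (mod n)" by (simp only: cong_def mod_mult_self2)
        qed
        then show ?thesis unfolding eta_def h' by (simp only: add_ac)
      qed
      have "eta n k * eta n (k + j) = (\<Sum>r<h. e (k + n * r) * eta n (k + j))"
        unfolding eta_def h' by (rule sum_distrib_right)
      also have "\<dots> = (\<Sum>r<h. \<Sum>s<h. e (k + n * r) * e (k + n * r + (j + n * s)))"
        by (intro sum.cong refl) (subst shift, simp add: sum_distrib_left)
      also have "\<dots> = (\<Sum>r<h. \<Sum>s<h. \<xi> ^ (g ^ (k + n * r) * (1 + g ^ (j + n * s))))"
        by (intro sum.cong refl) (simp only: e_def power_add[of \<xi>] distrib_left mult_1_right power_add[of g "_ + _" "_ + _"])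
      finally show ?thesis .
    qed
    then have "T j = (\<Sum>k<n. \<Sum>r<h. \<Sum>s<h. \<xi> ^ (g ^ (k + n * r) * (1 + g ^ (j + n * s))))"
      by (simp add: T_def)
    also have "\<dots> = (\<Sum>i<N. \<Sum>s<h. \<xi> ^ (g ^ i * (1 + g ^ (j + n * s))))"
      unfolding h by (rule sum_lessThan_mult[symmetric])
    also have "\<dots> = (\<Sum>s<h. \<Sum>i<N. \<xi> ^ (g ^ i * (1 + g ^ (j + n * s))))" by (rule sum.swap)
    also have "\<dots> = (\<Sum>s<h. (if [j + n * s = i0] (mod N) then of_nat p else 0) - 1)"
      unfolding N_def sum_e_mult minus1[unfolded N_def] by (intro sum.cong refl) simp
    finally show ?thesis by (simp add: sum_subtractf)
  qed
  have T0: "T i0 = of_nat p - of_nat h"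
  proof -
    have "[i0 + n * s = i0] (mod N) \<longleftrightarrow> s = 0" if "s < h" for s
    proof -
      have "[i0 + n * s = i0] (mod N) \<longleftrightarrow> n * h dvd n * s"
        unfolding h by (simp only: cong_add_lcancel_0_nat cong_0_iff)
      also have "\<dots> \<longleftrightarrow> s = 0" using n that by (auto dest: dvd_imp_le)
      finally show ?thesis .
    qed
    then have "(\<Sum>s<h. if [i0 + n * s = i0] (mod N) then of_nat p else 0) = (\<Sum>s<h. if s = 0 then of_nat p else (0::complex))"
      by (intro sum.cong) auto
    then show ?thesis using T[of i0] hpos by simp
  qed
  have Tm: "T (i0 + m) = - of_nat h" if "\<not> n dvd m" for m
  proof -
    have "\<not> [i0 + m + n * s = i0] (mod N)" for s
    proof
      assume "[i0 + m + n * s = i0] (mod N)"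
      then have "[i0 + (m + n * s) = i0] (mod n)"
        unfolding h add.assoc by (rule cong_modulus_mult_nat)
      then have "n dvd m + n * s" by (simp only: cong_add_lcancel_0_nat cong_0_iff)
      then show False using that by (simp add: dvd_add_left_iff)
    qed
    then show ?thesis using T[of "i0 + m"] by simp
  qed
  have "(\<Sum>k<n. eta n k * (eta n (k + i0) - eta n (k + i0 + m))) = of_nat p" if "\<not> n dvd m" for m
  proof -
    have "(\<Sum>k<n. eta n k * (eta n (k + i0) - eta n (k + i0 + m))) = T i0 - T (i0 + m)"
      by (simp add: T_def right_diff_distrib sum_subtractf add.assoc)
    then show ?thesis using T0 Tm[OF that] by simp
  qed
  then show thesis by (rule that)
qed

section \<open>Divisibility in the cyclotomic integers and the prime above p\<close>

definition dvR :: "complex \<Rightarrow> complex \<Rightarrow> bool" where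
  "dvR a x \<longleftrightarrow> (\<exists>y\<in>R. x = a * y)"

lemma dvRI: "x = a * y \<Longrightarrow> y \<in> R \<Longrightarrow> dvR a x"
  by (auto simp: dvR_def)

lemma dvR_0 [simp]: "dvR a 0"
  by (rule dvRI[of _ _ 0]) auto

lemma dvR_add: "dvR a x \<Longrightarrow> dvR a y \<Longrightarrow> dvR a (x + y)"
  by (auto simp: dvR_def simp flip: distrib_left)

lemma dvR_diff: "dvR a x \<Longrightarrow> dvR a y \<Longrightarrow> dvR a (x - y)"
  by (auto simp: dvR_def simp flip: right_diff_distrib)

lemma dvR_mult: "dvR a x \<Longrightarrow> dvR b y \<Longrightarrow> dvR (a * b) (x * y)"
proof -
  assume "dvR a x" "dvR b y"
  then obtain x' y' where "x' \<in> R" "y' \<in> R" "x = a * x'" "y = b * y'" by (auto simp: dvR_def)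
  then show "dvR (a * b) (x * y)" by (intro dvRI[of _ _ "x' * y'"]) auto
qed

lemma dvR_1: "x \<in> R \<Longrightarrow> dvR 1 x"
  by (rule dvRI[of _ _ x]) auto

lemma dvR_mult_right: "dvR a x \<Longrightarrow> y \<in> R \<Longrightarrow> dvR a (x * y)"
  using dvR_mult[OF _ dvR_1] by fastforce

lemma dvR_trans: "dvR a b \<Longrightarrow> dvR b c \<Longrightarrow> dvR a c"
  unfolding dvR_def by (metis R_closed(3) mult.assoc)

lemma dvR_sum: "(\<And>i. i \<in> A \<Longrightarrow> dvR a (f i)) \<Longrightarrow> dvR a (sum f A)"
  by (induction A rule: infinite_finite_induct) (auto intro: dvR_add)

lemma dvR_prod: "(\<And>i. i \<in> A \<Longrightarrow> dvR (a i) (f i)) \<Longrightarrow> dvR (prod a A) (prod f A)"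
  by (induction A rule: infinite_finite_induct) (auto intro: dvR_mult dvR_1)

lemma dvR_power: "dvR a x \<Longrightarrow> dvR (a ^ k) (x ^ k)"
  by (induction k) (auto intro: dvR_mult dvR_1)

lemma dvR_power_le:
  assumes "a \<in> R" "i \<le> j" shows "dvR (a ^ i) (a ^ j)"
  by (rule dvRI[of _ _ "a ^ (j - i)"]) (use assms in \<open>auto simp flip: power_add\<close>)

text \<open>A uniformizer at \<open>p\<close>: \<open>pi1 ^ (p - 1)\<close> and \<open>p\<close>
  divide each other in \<open>R\<close>. Valuations are expressed as divisibility by powers of
  \<open>pi1\<close>.\<close>

definition pi1 :: complex where "pi1 = 1 - \<xi>"

lemma pi1_in_R [simp]: "pi1 \<in> R"
  by (simp add: pi1_def)

lemma pi1_ne_0: "pi1 \<noteq> 0"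
  using xi_ne_1 by (simp add: pi1_def)

lemma xi_pow_in_R [simp]: "\<xi> ^ a \<in> R"
  by auto

lemma one_minus_xi_pow_dvR: "dvR (1 - \<xi> ^ a) (1 - \<xi> ^ (a * c))"
proof (rule dvRI)
  show "1 - \<xi> ^ (a * c) = (1 - \<xi> ^ a) * (\<Sum>i<c. \<xi> ^ (a * i))"
    unfolding power_mult using power_diff_1_eq[of "\<xi> ^ a" c] by (simp add: algebra_simps)
  show "(\<Sum>i<c. \<xi> ^ (a * i)) \<in> R" by auto
qed

lemma pi1_dvR_one_minus: "dvR pi1 (1 - \<xi> ^ a)"
  using one_minus_xi_pow_dvR[of 1 a] by (simp add: pi1_def)

text \<open>\<xi> is itself a power of \<open>\<xi> ^ a\<close>, with exponent an inverse of
  \<open>a\<close> modulo \<open>p\<close>. Hence all the \<open>1 - e i\<close> are associated to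
  \<open>pi1\<close>.\<close>

lemma one_minus_dvR_pi1:
  assumes "\<not> p dvd a" shows "dvR (1 - \<xi> ^ a) pi1"
proof -
  have "coprime a p" using assms prime_p by (metis coprime_commute prime_imp_coprime)
  then obtain c where "[a * c = 1] (mod p)" using cong_solve_coprime_nat by auto
  from xi_cong[OF this] show ?thesis
    using one_minus_xi_pow_dvR[of a c] by (simp add: pi1_def)
qed

text \<open>Both sides are monic of degree p - 1 and vanish at the \<open>e i\<close>, which are
  distinct because they are linearly independent.\<close>

lemma prime_cyclotomic_eq_prod: "prime_cyclotomic p = (\<Prod>i<p - 1. [:- e i, 1:])"
proof -
  let ?P = "prime_cyclotomic p :: complex poly"
  let ?Q = "\<Prod>i<p - 1. [:- e i, 1:]"
  have inj: "inj_on e {..<p - 1}"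
  proof (rule inj_onI, rule ccontr)
    fix i j assume ij: "i \<in> {..<p - 1}" "j \<in> {..<p - 1}" "e i = e j" "i \<noteq> j"
    define d where "d k = (if k = i then 1 else if k = j then - 1 else (0::int))" for k
    have "(\<Sum>k<p - 1. of_int (d k) * e k) = (\<Sum>k\<in>{i, j}. of_int (d k) * e k)"
      by (rule sum.mono_neutral_right) (use ij in \<open>auto simp: d_def\<close>)
    also have "\<dots> = 0" using ij by (simp add: d_def)
    finally have "d i = 0" using e_independent ij by blast
    then show False by (simp add: d_def)
  qed
  have degP: "degree ?P = p - 1" using p_ge_2 by (intro degree_prime_cyclotomic) auto
  have degQ: "degree ?Q = p - 1" by (subst degree_prod_eq_sum_degree) auto
  show "?P = ?Q"
  proof (rule poly_eqI_degree_lead_coeff[of ?P "p - 1" ?Q "e ` {..<p - 1}"])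
    show "degree ?P \<le> p - 1" "degree ?Q \<le> p - 1" using degP degQ by auto
    have "lead_coeff ?Q = 1" by (simp add: lead_coeff_prod)
    then show "coeff ?P (p - 1) = coeff ?Q (p - 1)"
      unfolding degQ using p_ge_2 by (simp add: coeff_prime_cyclotomic)
    show "card (e ` {..<p - 1}) \<ge> p - 1" using inj by (simp add: card_image)
    fix x assume "x \<in> e ` {..<p - 1}"
    then obtain i where i: "i < p - 1" "x = e i" by auto
    have "map_poly of_rat (prime_cyclotomic p) = ?P"
      by (rule poly_eqI) (simp add: coeff_prime_cyclotomic)
    then have "poly ?P x = 0"
      using ratpoly_prime_cyclotomic[OF not_dvd_g_power[of i]] i by (simp add: e_def)
    moreover have "poly ?Q x = 0" using i by (auto simp: poly_prod)
    ultimately show "poly ?P x = poly ?Q x" by simp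
  qed
qed

lemma prod_one_minus_e: "(\<Prod>i<p - 1. 1 - e i) = of_nat p"
  using arg_cong[OF prime_cyclotomic_eq_prod, of "\<lambda>f. poly f 1"]
  by (simp add: poly_prime_cyclotomic poly_prod)

text \<open>The conductor is expressed through \<open>cis (2 * pi / real p)\<close>, whereas \<xi>
  is an arbitrary primitive root of unity; this puts the former into \<open>R\<close>.\<close>

lemma root_of_unity_in_R:
  assumes "z ^ p = 1" shows "z \<in> R"
proof (cases "z = 1")
  case False
  then have "(\<Sum>i<p. z ^ i) = 0" using power_diff_1_eq[of z p] assms by simp
  then have "(\<Prod>i<p - 1. z - e i) = 0"
    using arg_cong[OF prime_cyclotomic_eq_prod, of "\<lambda>f. poly f z"]
    by (simp add: poly_prime_cyclotomic poly_prod)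
  then show ?thesis by auto
qed simp

lemma pi1_power_dvR_p: "dvR (pi1 ^ (p - 1)) (of_nat p)"
  unfolding prod_one_minus_e[symmetric] e_def
  using dvR_prod[of "{..<p - 1}" "\<lambda>_. pi1"] pi1_dvR_one_minus by simp

lemma p_dvR_pi1_power: "dvR (of_nat p) (pi1 ^ (p - 1))"
  unfolding prod_one_minus_e[symmetric] e_def
  using dvR_prod[of "{..<p - 1}" _ "\<lambda>_. pi1"] one_minus_dvR_pi1[OF not_dvd_g_power] by simp

text \<open>Multiply the conjugates of \<open>m = pi1 * y\<close>: the left side becomes
  \<open>m ^ (p - 1)\<close>, the right side \<open>p\<close> times an integer, because the product
  of the conjugates of \<open>y\<close> is fixed by \<open>sig g\<close>.\<close>

lemma pi1_dvR_int:
  assumes "dvR pi1 (of_int m)" shows "int p dvd m"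
proof -
  obtain y where y: "y \<in> R" "of_int m = pi1 * y" using assms by (auto simp: dvR_def)
  have yK: "y \<in> K" and piK: "pi1 \<in> K" using y R_subset_K by auto
  define N where "N = (\<Prod>i<p - 1. sig (g ^ i) y)"
  note hom = sig_hom[OF not_dvd_g_power]
  have N: "N \<in> R" using y by (auto simp: N_def intro!: hom)
  have "sig g N = (\<Prod>i<p - 1. sig (g ^ 1) (sig (g ^ i) y))"
    unfolding N_def using sig_prod[OF not_dvd_g_power[of 1], of "{..<p - 1}" "\<lambda>i. sig (g ^ i) y"] yK hom(7)
    by simp
  also have "\<dots> = (\<Prod>i<p - 1. sig (g ^ (i + 1)) y)"
    using sig_sig[OF not_dvd_g_power not_dvd_g_power yK] by (simp only: power_add)
  also have "\<dots> = N"
    unfolding N_def by (rule prod_periodic_shift) (rule sig_cong[OF g_power_period])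
  finally obtain N' where N': "N = of_int N'" using fixed_by_sig_int N by blast
  have "sig (g ^ i) (of_int m) = (1 - e i) * sig (g ^ i) y" for i
  proof -
    have "sig (g ^ i) (1 - \<xi> ^ 1) = 1 - e i"
      using hom(2)[of 1 "\<xi> ^ 1" i] hom(5)[of i] hom(9)[of i 1] R_subset_K R_closed(7)
      by (auto simp: e_def)
    then show ?thesis unfolding y(2) using hom(3)[OF piK yK] by (simp add: pi1_def)
  qed
  then have "(\<Prod>i<p - 1. of_int m) = (\<Prod>i<p - 1. (1 - e i) * sig (g ^ i) y)"
    using hom(10) by simp
  also have "\<dots> = of_nat p * of_int N'"
    by (simp only: prod.distrib prod_one_minus_e N_def[symmetric] N')
  finally have "of_int (m ^ (p - 1)) = (of_int (int p * N') :: complex)" by simp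
  then have "m ^ (p - 1) = int p * N'" by (simp only: of_int_eq_iff)
  then have "int p dvd m ^ (p - 1)" by simp
  then show ?thesis using prime_p prime_dvd_power[of "int p"] by auto
qed

text \<open>Each \<open>e i\<close> is congruent to 1, so an element is congruent to the sum of its
  coordinates: the residue field is the prime field.\<close>

lemma residue_mod_pi1:
  assumes "x \<in> R" obtains m where "dvR pi1 (x - of_int m)"
proof -
  obtain d where d: "x = (\<Sum>i<p - 1. of_int (d i) * e i)" using assms by (rule R_basis)
  have "dvR pi1 (\<Sum>i<p - 1. (1 - e i) * of_int (- d i))"
    unfolding e_def by (intro dvR_sum dvR_mult_right pi1_dvR_one_minus) (rule R_closed)
  also have "(\<Sum>i<p - 1. (1 - e i) * of_int (- d i)) = x - of_int (\<Sum>i<p - 1. d i)"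
    by (simp add: d algebra_simps sum_subtractf sum_negf)
  finally show thesis by (rule that)
qed

lemma sig_mod_pi1:
  assumes "x \<in> R" shows "dvR pi1 (sig (g ^ j) x - x)"
proof -
  obtain d where d: "x = (\<Sum>i<p - 1. of_int (d i) * e i)" using assms by (rule R_basis)
  have oi: "of_int m \<in> K" for m using R_subset_K by auto
  have "sig (g ^ j) x = (\<Sum>i<p - 1. sig (g ^ j) (of_int (d i) * e i))"
    unfolding d using sig_sum[OF not_dvd_g_power, of "{..<p - 1}" "\<lambda>i. of_int (d i) * e i" j] oi by simp
  also have "\<dots> = (\<Sum>i<p - 1. of_int (d i) * e (i + j))"
    using oi by (simp add: sig_hom[OF not_dvd_g_power] sig_e)
  finally have "sig (g ^ j) x - x = (\<Sum>i<p - 1. ((1 - e i) - (1 - e (i + j))) * of_int (d i))"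
    by (simp add: d algebra_simps sum_subtractf)
  also have "dvR pi1 \<dots>"
    unfolding e_def by (intro dvR_sum dvR_mult_right dvR_diff pi1_dvR_one_minus) auto
  finally show ?thesis .
qed

text \<open>An element fixed by the subgroup of index \<open>n\<close> has valuation divisible by \<open>(p - 1) / n\<close>:
  the automorphism \<open>sig (g ^ n)\<close> multiplies the leading coefficient of \<open>\<pi>\<^sup>k w\<close> by \<open>g\<^sup>n\<^sup>k\<close>.\<close>

lemma fixed_valuation_step:
  assumes n: "n dvd p - 1" and z: "z \<in> R" "sig (g ^ n) z = z" and k: "\<not> (p - 1) div n dvd k"
    and dv: "dvR (pi1 ^ k) z"
  shows "dvR (pi1 ^ Suc k) z"
proof -
  obtain h where h: "p - 1 = n * h" using n by (rule dvdE)
  have npos: "n > 0" using h p_ge_2 by (cases "n = 0") auto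
  have h': "(p - 1) div n = h" using h npos by simp
  obtain w where w: "w \<in> R" "z = pi1 ^ k * w" using dv by (auto simp: dvR_def)
  note hom = sig_hom[OF not_dvd_g_power]
  have wK: "w \<in> K" and piK: "pi1 \<in> K" using w R_subset_K by auto
  define t where "t = g ^ n"
  \<comment> \<open>The quotient of \<open>sig t pi1\<close> by \<open>pi1\<close>; it is congruent
    to \<open>t\<close> modulo \<open>pi1\<close> because each of its \<open>t\<close> terms is
    congruent to 1.\<close>
  define s where "s = (\<Sum>i<t. \<xi> ^ i)"
  have sR: "s \<in> R" by (auto simp: s_def)
  have sigpi: "sig t pi1 = pi1 * s"
  proof -
    have "sig t (1 - \<xi> ^ 1) = 1 - \<xi> ^ t"
      unfolding t_def using hom(2)[of 1 "\<xi> ^ 1"] hom(5) hom(9)[of n 1] R_subset_K R_closed(7) by auto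
    also have "\<dots> = pi1 * s"
      using power_diff_1_eq[of \<xi> t] by (simp add: pi1_def s_def algebra_simps)
    finally show ?thesis by (simp add: pi1_def)
  qed
  have "z = sig t (pi1 ^ k * w)" using z w by (simp add: t_def)
  also have "\<dots> = sig t pi1 ^ k * sig t w"
    using hom(3)[of "pi1 ^ k" w n] sig_power[OF not_dvd_g_power[of n] piK, of k] wK
    by (simp add: t_def)
  finally have "pi1 ^ k * w = pi1 ^ k * (s ^ k * sig t w)"
    using w by (simp add: sigpi power_mult_distrib mult.assoc)
  then have weq: "w = s ^ k * sig t w" using pi1_ne_0 by simp
  have swR: "sig t w \<in> R" unfolding t_def using hom(8) w by blast
  have "dvR pi1 (s - of_nat t)"
  proof -
    have "s - of_nat t = (\<Sum>i<t. (1 - \<xi> ^ i) * (- 1))" by (simp add: s_def sum_subtractf)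
    moreover have "- 1 \<in> R" using R_closed(6)[of "- 1"] by simp
    then have "dvR pi1 (\<Sum>i<t. (1 - \<xi> ^ i) * (- 1))"
      by (intro dvR_sum dvR_mult_right pi1_dvR_one_minus)
    ultimately show ?thesis by simp
  qed
  then have "dvR pi1 ((s - of_nat t) * (\<Sum>i<k. of_nat t ^ (k - Suc i) * s ^ i))"
    using sR by (intro dvR_mult_right) auto
  then have sk: "dvR pi1 (s ^ k - of_nat t ^ k)" by (simp only: power_diff_sumr2)
  have "dvR pi1 ((s ^ k - of_nat t ^ k) * sig t w + (sig t w - w) * of_nat t ^ k)"
    using sk swR sig_mod_pi1[OF w(1), of n] by (intro dvR_add dvR_mult_right) (auto simp: t_def)
  also have "(s ^ k - of_nat t ^ k) * sig t w + (sig t w - w) * of_nat t ^ k = w * (1 - of_nat t ^ k)"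
    using weq by (simp add: algebra_simps)
  finally have 1: "dvR pi1 (w * (1 - of_nat t ^ k))" .
  \<comment> \<open>For the residue \<open>m\<close> of \<open>w\<close> the relation becomes m (1 -
    t^k) \<equiv> 0 modulo \<open>p\<close>, and \<open>t ^ k = g ^ (n * k)\<close> is 1 modulo
    \<open>p\<close> only if \<open>(p - 1) div n\<close> divides \<open>k\<close>. So
    \<open>p\<close> divides \<open>m\<close> and \<open>pi1\<close> divides
    \<open>w\<close>.\<close>
  obtain m where m: "dvR pi1 (w - of_int m)" using residue_mod_pi1 w by blast
  have "1 - of_nat t ^ k \<in> R" by auto
  from dvR_diff[OF 1 dvR_mult_right[OF m this]]
  have "dvR pi1 (of_int (m * (1 - int t ^ k)))" by (simp add: algebra_simps)
  then have "int p dvd m * (1 - int t ^ k)" by (rule pi1_dvR_int)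
  moreover have "\<not> int p dvd 1 - int t ^ k"
  proof
    assume "int p dvd 1 - int t ^ k"
    then have "[1 = int (t ^ k)] (mod int p)" by (simp add: cong_iff_dvd_diff)
    then have "[g ^ (n * k) = 1] (mod p)"
      unfolding t_def by (metis cong_int_iff cong_sym of_nat_1 power_mult)
    then have "n * h dvd n * k" unfolding g_power_cong_1_iff h .
    then show False using k npos h' by simp
  qed
  ultimately have "int p dvd m" using prime_p by (simp add: prime_dvd_mult_iff)
  then obtain m' where m': "m = int p * m'" by (rule dvdE)
  have "dvR (pi1 ^ 1) (pi1 ^ (p - 1))" using p_ge_2 by (intro dvR_power_le) auto
  from dvR_trans[OF this pi1_power_dvR_p] have "dvR pi1 (of_nat p * of_int m')"
    by (intro dvR_mult_right) auto
  from dvR_add[OF m this] have "dvR pi1 w" by (simp add: m')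
  then have "dvR (pi1 ^ k * pi1) z"
    unfolding w(2) by (intro dvR_mult) (auto intro: dvRI[of _ _ 1])
  then show ?thesis by (simp add: mult.commute)
qed

text \<open>No exponent strictly between 0 and \<open>(p - 1) div n\<close> is a multiple of the
  latter, so the preceding step can be repeated.\<close>

lemma fixed_valuation:
  assumes n: "n dvd p - 1" and z: "z \<in> R" "sig (g ^ n) z = z" and "dvR pi1 z"
  shows "dvR (pi1 ^ ((p - 1) div n)) z"
proof -
  define h where "h = (p - 1) div n"
  have "dvR (pi1 ^ Suc j) z" if "Suc j \<le> h" for j
    using that
  proof (induction j)
    case 0
    then show ?case using assms by simp
  next
    case (Suc j)
    then have "\<not> h dvd Suc j" by (auto dest: dvd_imp_le)
    then show ?case using Suc fixed_valuation_step[OF n z, of "Suc j"] by (simp add: h_def)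
  qed
  moreover have "h > 0"
    unfolding h_def using n p_ge_2 by (simp add: div_greater_zero_iff dvd_imp_le dvd_pos_nat[OF _ n])
  ultimately show ?thesis unfolding h_def[symmetric] by (cases h) auto
qed

text \<open>The product of the images of \<open>1 - e k\<close> under the subgroup generated by
  \<open>sig (g ^ n)\<close>, that is, its norm to the field of periods; \<open>beta n 0\<close> is
  the \<beta> of the construction.\<close>

definition beta :: "nat \<Rightarrow> nat \<Rightarrow> complex" where
  "beta n k = (\<Prod>r<(p - 1) div n. 1 - e (k + n * r))"

lemma beta_in_R [simp]: "beta n k \<in> R"
  by (auto simp: beta_def)

lemma sig_beta: "sig (g ^ j) (beta n k) = beta n (k + j)"
proof -
  note hom = sig_hom[OF not_dvd_g_power]
  have "1 - e i \<in> K" for i by auto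
  then have "sig (g ^ j) (beta n k) = (\<Prod>r<(p - 1) div n. sig (g ^ j) (1 - e (k + n * r)))"
    unfolding beta_def using sig_prod[OF not_dvd_g_power, of _ "\<lambda>r. 1 - e (k + n * r)" j] by blast
  also have "\<dots> = beta n (k + j)"
    unfolding beta_def by (intro prod.cong refl) (simp add: hom(2) hom(5) sig_e add_ac)
  finally show ?thesis .
qed

lemma prod_beta:
  assumes "n dvd p - 1" shows "(\<Prod>k<n. beta n k) = of_nat p"
  unfolding beta_def prod_lessThan_mult[of "\<lambda>i. 1 - e i", symmetric] using assms prod_one_minus_e by simp

lemma pi1_power_dvR_beta: "dvR (pi1 ^ ((p - 1) div n)) (beta n k)"
  unfolding beta_def e_def
  using dvR_prod[of "{..<(p - 1) div n}" "\<lambda>_. pi1"] pi1_dvR_one_minus by simp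

lemma beta_period:
  assumes "n dvd p - 1" shows "beta n (k + n) = beta n k"
proof -
  obtain h where h: "p - 1 = n * h" using assms by (rule dvdE)
  then have "n > 0" using p_ge_2 by (cases "n = 0") auto
  then have h': "(p - 1) div n = h" using h by simp
  define F where "F r = 1 - e (k + n * r)" for r
  have "F (r + h) = F r" for r
    unfolding F_def using e_period[of "k + n * r"] h by (simp add: algebra_simps)
  then have "(\<Prod>r<h. F (r + 1)) = (\<Prod>r<h. F r)" by (rule prod_periodic_shift)
  then show ?thesis unfolding beta_def h' F_def by (simp add: algebra_simps)
qed

end

section \<open>Cyclic subfields of prime degree\<close>

global_interpretation ratv: vector_space "\<lambda>(c::rat) (x::complex). of_rat c * x"
  by unfold_locales (simp_all add: of_rat_add of_rat_mult algebra_simps)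

text \<open>\<open>S_order\<close> appears as an assumption because \<open>cyclic_field\<close> does
  not state the order of \<open>S\<close>; the algebra supplies it through the centrality of
  \<open>u ^ n\<close>.\<close>

locale prime_cyclic_subfield = prime_cyclotomic_field +
  fixes n :: nat and Z :: "complex set" and S :: "complex \<Rightarrow> complex"
  assumes prime_n: "prime n" and n_dvd: "n dvd p - 1" and cyclic: "cyclic_field n Z S"
    and Z_subset_K: "Z \<subseteq> K" and S_order: "z \<in> Z \<Longrightarrow> (S ^^ n) z = z"
begin

lemma n_ge_2: "n \<ge> 2"
  using prime_n by (rule prime_ge_2_nat)

lemma Z_closed [simp, intro]:
  "1 \<in> Z" "0 \<in> Z" "x \<in> Z \<Longrightarrow> y \<in> Z \<Longrightarrow> x - y \<in> Z" "x \<in> Z \<Longrightarrow> y \<in> Z \<Longrightarrow> x * y \<in> Z"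
  "x \<in> Z \<Longrightarrow> inverse x \<in> Z" "x \<in> Z \<Longrightarrow> - x \<in> Z" "x \<in> Z \<Longrightarrow> y \<in> Z \<Longrightarrow> x + y \<in> Z"
proof -
  have sf: "is_subfield Z" using cyclic by (simp add: cyclic_field_def)
  then show 1: "1 \<in> Z" and 2: "\<And>x y. x \<in> Z \<Longrightarrow> y \<in> Z \<Longrightarrow> x - y \<in> Z"
    and "\<And>x y. x \<in> Z \<Longrightarrow> y \<in> Z \<Longrightarrow> x * y \<in> Z" "\<And>x. x \<in> Z \<Longrightarrow> inverse x \<in> Z"
    by (auto simp: is_subfield_def)
  show 3: "0 \<in> Z" using 2[OF 1 1] by simp
  show 4: "\<And>x. x \<in> Z \<Longrightarrow> - x \<in> Z" using 2[OF 3] by simp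
  show "\<And>x y. x \<in> Z \<Longrightarrow> y \<in> Z \<Longrightarrow> x + y \<in> Z" using 2 4 by fastforce
qed

lemma Rats_subset_Z: "\<rat> \<subseteq> Z"
  using cyclic by (auto simp: cyclic_field_def)

lemma of_rat_in_Z [simp]: "of_rat c \<in> Z"
  using Rats_subset_Z by auto

lemma of_int_in_Z [simp]: "of_int c \<in> Z"
  using Rats_subset_Z by auto

lemma of_nat_in_Z [simp]: "of_nat c \<in> Z"
  using Rats_subset_Z by auto

lemma Z_power [simp, intro]: "x \<in> Z \<Longrightarrow> x ^ k \<in> Z"
  by (induction k) auto

lemma Z_sum [intro]: "(\<And>i. i \<in> A \<Longrightarrow> f i \<in> Z) \<Longrightarrow> sum f A \<in> Z"
  by (induction A rule: infinite_finite_induct) auto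

lemma Z_prod [intro]: "(\<And>i. i \<in> A \<Longrightarrow> f i \<in> Z) \<Longrightarrow> prod f A \<in> Z"
  by (induction A rule: infinite_finite_induct) auto

lemma S_gal: "S \<in> gal Z"
  using cyclic by (simp add: cyclic_field_def)

lemma S_rat [simp]: "c \<in> \<rat> \<Longrightarrow> S c = c"
  using cyclic S_gal by (auto simp: cyclic_field_def)

lemma S_hom:
  "x \<in> Z \<Longrightarrow> S x \<in> Z" "x \<in> Z \<Longrightarrow> y \<in> Z \<Longrightarrow> S (x + y) = S x + S y"
  "x \<in> Z \<Longrightarrow> y \<in> Z \<Longrightarrow> S (x * y) = S x * S y" "x \<in> Z \<Longrightarrow> S (- x) = - S x"
  "x \<in> Z \<Longrightarrow> y \<in> Z \<Longrightarrow> S (x - y) = S x - S y"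
proof -
  have g: "bij_betw S Z Z" "\<And>x y. x \<in> Z \<Longrightarrow> y \<in> Z \<Longrightarrow> S (x + y) = S x + S y"
    "\<And>x y. x \<in> Z \<Longrightarrow> y \<in> Z \<Longrightarrow> S (x * y) = S x * S y"
    using S_gal by (auto simp: gal_def)
  show "x \<in> Z \<Longrightarrow> S x \<in> Z" using g(1) by (auto simp: bij_betw_def)
  show 2: "\<And>x y. x \<in> Z \<Longrightarrow> y \<in> Z \<Longrightarrow> S (x + y) = S x + S y"
    and "\<And>x y. x \<in> Z \<Longrightarrow> y \<in> Z \<Longrightarrow> S (x * y) = S x * S y" by (fact g)+
  have "S 0 = 0" using S_rat[of 0] by simp
  then show 3: "S (- x) = - S x" if "x \<in> Z" for x
    using 2[of x "- x"] that by (auto simp: eq_neg_iff_add_eq_0 add.commute)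
  show "x \<in> Z \<Longrightarrow> y \<in> Z \<Longrightarrow> S (x - y) = S x - S y"
    using 2[of x "- y"] 3 by simp
qed

lemma S_pow_in_Z [simp]: "x \<in> Z \<Longrightarrow> (S ^^ k) x \<in> Z"
  by (induction k) (auto simp: S_hom)

lemma S_pow_hom:
  "x \<in> Z \<Longrightarrow> y \<in> Z \<Longrightarrow> (S ^^ k) (x + y) = (S ^^ k) x + (S ^^ k) y"
  "x \<in> Z \<Longrightarrow> y \<in> Z \<Longrightarrow> (S ^^ k) (x - y) = (S ^^ k) x - (S ^^ k) y"
  "x \<in> Z \<Longrightarrow> y \<in> Z \<Longrightarrow> (S ^^ k) (x * y) = (S ^^ k) x * (S ^^ k) y"
  by (induction k) (simp_all add: S_hom)

lemma S_pow_mod: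
  assumes "z \<in> Z" shows "(S ^^ k) z = (S ^^ (k mod n)) z"
proof -
  have "(S ^^ (n * q)) y = y" if "y \<in> Z" for q y
    using that by (induction q) (simp_all add: funpow_add S_order)
  from this[of "(S ^^ (k mod n)) z" "k div n"]
  have "(S ^^ (n * (k div n) + k mod n)) z = (S ^^ (k mod n)) z"
    using assms by (simp only: funpow_add o_apply S_pow_in_Z)
  then show ?thesis by simp
qed

lemma S_fixed_rational:
  assumes "z \<in> Z" "S z = z" shows "z \<in> \<rat>"
proof -
  have "(S ^^ k) z = z" for k by (induction k) (simp_all add: assms)
  then have "f z = z" if "f \<in> gal Z" for f
    using cyclic that assms(1) unfolding cyclic_field_def by metis
  then show ?thesis using cyclic assms(1) unfolding cyclic_field_def by blast
qed

text \<open>\<open>S\<close> permutes the linear factors cyclically and so fixes the coefficients.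
  The partial products \<open>L m j\<close> make this an induction on the number of factors:
  applying \<open>S\<close> to the coefficients raises the offset \<open>j\<close> by one.\<close>

lemma orbit_poly_rational:
  assumes z: "z \<in> Z"
  shows "coeff (\<Prod>i<n. [:- (S ^^ i) z, 1:]) k \<in> \<rat>"
proof -
  define L where "L m j = (\<Prod>i<m. [:- (S ^^ (i + j)) z, 1:])" for m j
  have L: "coeff (L m j) k \<in> Z \<and> S (coeff (L m j) k) = coeff (L m (Suc j)) k" for m j k
  proof (induction m arbitrary: k)
    case 0
    then show ?case by (auto simp: L_def)
  next
    case (Suc m)
    have coeffs: "coeff (L (Suc m) j) k =
        (if k = 0 then 0 else coeff (L m j) (k - 1)) + - (S ^^ (m + j)) z * coeff (L m j) k" for j k
      by (auto simp: L_def coeff_pCons mult.commute split: nat.split)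
    have "(S ^^ (m + Suc j)) z = S ((S ^^ (m + j)) z)" by simp
    note coeffs_Suc = coeffs[of "Suc j" k, unfolded this]
    have "(S ^^ (m + j)) z \<in> Z" using z by simp
    with Suc show ?case unfolding coeffs_Suc unfolding coeffs by (simp add: S_hom del: S_pow_in_Z)
  qed
  have "L n (Suc 0) = L n 0"
    unfolding L_def
  proof (rule prod_periodic_shift[of "\<lambda>i. [:- (S ^^ i) z, 1:]" n, unfolded add_0_right, THEN trans])
    show "[:- (S ^^ (i + n)) z, 1:] = [:- (S ^^ i) z, 1:]" for i
      using z by (simp add: funpow_add S_order)
  qed simp
  with L[of n 0 k] have "coeff (L n 0) k \<in> Z" "S (coeff (L n 0) k) = coeff (L n 0) k" by auto
  then show ?thesis using S_fixed_rational by (simp add: L_def)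
qed

section \<open>Identification of S with a cyclotomic automorphism\<close>

lemma sig_rat: "c \<in> \<rat> \<Longrightarrow> sig (g ^ j) c = c"
  by (elim Rats_cases) (simp add: sig_hom[OF not_dvd_g_power])

text \<open>The orbit polynomial of \<open>z\<close> has rational coefficients, so
  \<open>sig g\<close> sends its root \<open>z\<close> to another root. In particular
  \<open>Z\<close> is stable under \<open>sig g\<close>.\<close>

lemma sig_orbit:
  assumes z: "z \<in> Z" obtains i where "i < n" "sig g z = (S ^^ i) z"
proof -
  let ?F = "\<Prod>i<n. [:- (S ^^ i) z, 1:]"
  have zK: "z \<in> K" using z Z_subset_K by auto
  have g1: "\<not> p dvd g" using not_dvd_g_power[of 1] by simp
  have cK: "coeff ?F k \<in> K" and sc: "sig g (coeff ?F k) = coeff ?F k" for k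
    using orbit_poly_rational[OF z, of k] Rats_subset_Z Z_subset_K sig_rat[of _ 1] by auto
  have "poly ?F z = 0" using n_ge_2 by (auto simp: poly_prod intro!: bexI[of _ 0])
  then have "0 = sig g (\<Sum>k\<le>degree ?F. coeff ?F k * z ^ k)"
    using sig_hom(6)[OF g1] by (simp add: poly_altdef)
  also have "\<dots> = (\<Sum>k\<le>degree ?F. sig g (coeff ?F k * z ^ k))"
    using sig_sum[OF g1, of _ "\<lambda>k. coeff ?F k * z ^ k"] cK sig_power[OF g1 zK] by blast
  also have "\<dots> = poly ?F (sig g z)"
    unfolding poly_altdef using cK sc sig_power[OF g1 zK] by (intro sum.cong refl) (simp add: sig_hom(3)[OF g1])
  finally have "(\<Prod>i<n. sig g z - (S ^^ i) z) = 0" by (simp add: poly_prod)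
  then show thesis using that by auto
qed

lemma sig_in_Z: "z \<in> Z \<Longrightarrow> sig (g ^ j) z \<in> Z"
proof (induction j)
  case 0
  then show ?case using sig_1 Z_subset_K by auto
next
  case (Suc j)
  have "sig (g ^ Suc j) z = sig (g ^ 1) (sig (g ^ j) z)"
    using Suc.prems Z_subset_K sig_sig[OF not_dvd_g_power not_dvd_g_power, of z 1 j]
    by (auto simp: mult.commute)
  then show ?case using Suc by (metis S_pow_in_Z power_one_right sig_orbit)
qed

lemma sig_pow_inverse: "x \<in> K \<Longrightarrow> sig (g ^ 1) (sig (g ^ (p - 2)) x) = x \<and> sig (g ^ (p - 2)) (sig (g ^ 1) x) = x"
proof -
  assume x: "x \<in> K"
  have "Suc (p - 2) = p - 1" using p_ge_2 by simp
  moreover have "sig (g ^ (p - 1)) x = x"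
    using sig_cong[OF g_power_period[of 0], of x] sig_1[OF x] by simp
  ultimately show ?thesis
    using sig_sig[OF not_dvd_g_power not_dvd_g_power x, of 1 "p - 2"]
      sig_sig[OF not_dvd_g_power not_dvd_g_power x, of "p - 2" 1]
    by (metis mult.commute power_Suc power_one_right)
qed

lemma sig_eq_S_pow: obtains k where "\<And>z. z \<in> Z \<Longrightarrow> sig g z = (S ^^ k) z"
proof -
  have K: "z \<in> K" if "z \<in> Z" for z using that Z_subset_K by auto
  have g1: "\<not> p dvd g" using not_dvd_g_power[of 1] by simp
  have "bij_betw (sig g) Z Z"
    by (rule bij_betw_byWitness[of _ "sig (g ^ (p - 2))"])
      (use sig_pow_inverse K sig_in_Z sig_in_Z[of _ 1] in auto)
  then have "restrict (sig g) Z \<in> gal Z"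
    by (auto simp: gal_def sig_hom[OF g1] K bij_betw_restrict_eq)
  then obtain k where "\<forall>z\<in>Z. restrict (sig g) Z z = (S ^^ k) z"
    using cyclic unfolding cyclic_field_def by blast
  then show thesis using that by auto
qed

lemma sig_fixed_Z_rational:
  assumes "z \<in> Z" "sig g z = z" shows "z \<in> \<rat>"
proof -
  have zK: "z \<in> K" using assms Z_subset_K by auto
  have g1: "\<not> p dvd g" using not_dvd_g_power[of 1] by simp
  obtain m where m: "m > 0" "of_int m * z \<in> R" using K_denominator[OF zK] by blast
  have "of_int m \<in> K" using R_subset_K by auto
  then have "sig g (of_int m * z) = of_int m * z"
    using assms zK by (simp add: sig_hom[OF g1])
  then obtain m' where "of_int m * z = of_int m'" using fixed_by_sig_int m by blast
  then have "z = of_int m' / of_int m" using m by (simp add: field_simps)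
  then show ?thesis by simp
qed

lemma dim_Z: "ratv.dim Z = n"
  using cyclic by (simp add: cyclic_field_def field_degree_def)

lemma Z_ne_Rats: "\<not> Z \<subseteq> \<rat>"
proof
  assume "Z \<subseteq> \<rat>"
  also have "\<rat> \<subseteq> ratv.span {1}"
  proof
    fix x :: complex assume "x \<in> \<rat>"
    then obtain c where "x = of_rat c * 1" by (auto elim: Rats_cases)
    then show "x \<in> ratv.span {1}" by (metis ratv.span_base ratv.span_scale singletonI)
  qed
  finally have "ratv.dim Z \<le> card {1::complex}" by (rule ratv.dim_le_card) simp
  then show False using dim_Z n_ge_2 by simp
qed

text \<open>On \<open>Z\<close> the map \<open>sig g\<close> is some \<open>S ^^ k\<close>. If
  \<open>n\<close> divided \<open>k\<close>, all of \<open>Z\<close> would be fixed by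
  \<open>sig g\<close> and hence rational, against its degree. As \<open>n\<close> is prime,
  \<open>k\<close> has an inverse \<open>j\<close> modulo \<open>n\<close>, and \<open>S\<close> is
  the restriction of \<open>sig (g ^ j)\<close>.\<close>

lemma S_eq_sig:
  obtains j where "\<not> n dvd j" "\<And>z i. z \<in> Z \<Longrightarrow> (S ^^ i) z = sig (g ^ (j * i)) z"
    "\<And>z. z \<in> Z \<Longrightarrow> sig (g ^ n) z = z"
    "\<And>z i. z \<in> Z \<Longrightarrow> \<exists>l<n. sig (g ^ i) z = (S ^^ l) z"
proof -
  obtain k where k: "\<And>z. z \<in> Z \<Longrightarrow> sig g z = (S ^^ k) z" using sig_eq_S_pow by blast
  have pow: "sig (g ^ i) z = (S ^^ (k * i)) z" if "z \<in> Z" for i z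
  proof (induction i)
    case 0
    then show ?case using sig_1[of z] that Z_subset_K by auto
  next
    case (Suc i)
    have "sig (g ^ Suc i) z = sig (g ^ 1) (sig (g ^ i) z)"
      using that Z_subset_K sig_sig[OF not_dvd_g_power not_dvd_g_power, of z 1 i]
      by (auto simp: mult.commute)
    then show ?case using Suc k that by (simp add: funpow_add)
  qed
  have "\<not> n dvd k"
  proof
    assume "n dvd k"
    then have "sig g z = z" if "z \<in> Z" for z
      using k[OF that] S_pow_mod[OF that, of k] by simp
    then show False using sig_fixed_Z_rational Z_ne_Rats by blast
  qed
  then have "coprime k n" using prime_n by (metis coprime_commute prime_imp_coprime)
  then obtain j where j: "[k * j = 1] (mod n)" using cong_solve_coprime_nat by auto
  have Sj: "(S ^^ i) z = sig (g ^ (j * i)) z" if "z \<in> Z" for z i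
  proof -
    have "[k * j * i = 1 * i] (mod n)" using j by (rule cong_scalar_right)
    then have "k * (j * i) mod n = i mod n" by (simp add: cong_def mult.assoc)
    then show ?thesis
      using pow[OF that, of "j * i"] S_pow_mod[OF that, of "k * (j * i)"] S_pow_mod[OF that, of i] by simp
  qed
  have "\<not> n dvd j"
  proof
    assume "n dvd j"
    then have "n dvd 1" using j by (metis cong_dvd_iff dvd_mult)
    then show False using n_ge_2 by simp
  qed
  moreover have "sig (g ^ n) z = z" if "z \<in> Z" for z
    using pow[OF that, of n] S_pow_mod[OF that, of "k * n"] by simp
  moreover have "\<exists>l<n. sig (g ^ i) z = (S ^^ l) z" if "z \<in> Z" for z i
    using pow[OF that, of i] S_pow_mod[OF that, of "k * i"] n_ge_2
    by (intro exI[of _ "k * i mod n"]) simp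
  ultimately show thesis using Sj that by blast
qed

lemma sig_n_fixed: "z \<in> Z \<Longrightarrow> sig (g ^ n) z = z"
  using S_eq_sig by metis

text \<open>Elements of \<open>Z\<close> are fixed by \<open>sig (g ^ n)\<close>, so
  \<open>Z\<close> lies in the rational span of the \<open>n\<close> periods. As \<open>Z\<close>
  has dimension \<open>n\<close> too, a period outside \<open>Z\<close> would yield n + 1
  independent vectors in that span.\<close>

lemma eta_in_Z: "eta n k \<in> Z"
proof -
  let ?E = "eta n ` {..<n}"
  have sub: "ratv.subspace Z"
    by (rule ratv.subspaceI) auto
  have ZE: "Z \<subseteq> ratv.span ?E"
  proof
    fix z assume z: "z \<in> Z"
    have zK: "z \<in> K" using z Z_subset_K by auto
    obtain m where m: "m > 0" "of_int m * z \<in> R" using K_denominator[OF zK] by blast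
    have "sig (g ^ n) (of_int m * z) = of_int m * z" using z by (intro sig_n_fixed) auto
    then obtain c :: "nat \<Rightarrow> int" where c: "of_int m * z = (\<Sum>k<n. of_int (c k) * eta n k)"
      using fixed_by_sig_power[OF n_dvd m(2)] by blast
    have "z = (\<Sum>k<n. of_rat (of_int (c k) / of_int m) * eta n k)"
      using c m by (simp add: of_rat_divide sum_divide_distrib[symmetric] field_simps)
    also have "\<dots> \<in> ratv.span ?E"
      by (intro ratv.span_sum ratv.span_scale ratv.span_base) auto
    finally show "z \<in> ratv.span ?E" .
  qed
  obtain B where B: "B \<subseteq> Z" "ratv.independent B" "Z \<subseteq> ratv.span B" "card B = n"
    using ratv.basis_exists[of Z] dim_Z by metis
  have finB: "finite B" using B(4) n_ge_2 by (metis card.infinite not_numeral_le_zero)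
  have "eta n k \<in> ratv.span B" if "k < n" for k
  proof (rule ccontr)
    assume notin: "eta n k \<notin> ratv.span B"
    then have ind: "ratv.independent (insert (eta n k) B)" using B(2) by (simp add: ratv.independent_insertI)
    have "insert (eta n k) B \<subseteq> ratv.span ?E"
      using that B(1) ZE by (auto intro: ratv.span_base)
    then have "card (insert (eta n k) B) \<le> card ?E"
      using ratv.independent_span_bound[OF _ ind] by blast
    also have "\<dots> \<le> n" using card_image_le[of "{..<n}" "eta n"] by simp
    finally show False using finB B(4) notin ratv.span_base[of "eta n k" B] by (simp add: card_insert_if split: if_splits)
  qed
  moreover have "ratv.span B \<subseteq> Z" using B(1) sub by (rule ratv.span_minimal)
  moreover have "eta n k = eta n (k mod n)"
    by (rule eta_cong[OF n_dvd]) (simp add: cong_def)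
  moreover have "k mod n < n" using n_ge_2 by simp
  ultimately show ?thesis by (metis subsetD)
qed

text \<open>The integers of \<open>Z\<close>, taken inside the cyclotomic integers, so that no
  minimal polynomials are involved.\<close>

definition OZ :: "complex set" where "OZ = R \<inter> Z"

lemma OZ_closed [simp, intro]:
  "1 \<in> OZ" "0 \<in> OZ" "x \<in> OZ \<Longrightarrow> y \<in> OZ \<Longrightarrow> x - y \<in> OZ" "x \<in> OZ \<Longrightarrow> y \<in> OZ \<Longrightarrow> x * y \<in> OZ"
  "x \<in> OZ \<Longrightarrow> y \<in> OZ \<Longrightarrow> x + y \<in> OZ" "of_int m \<in> OZ" "x \<in> OZ \<Longrightarrow> x ^ i \<in> OZ" "of_nat i \<in> OZ"
  "x \<in> OZ \<Longrightarrow> - x \<in> OZ" "eta n i \<in> OZ"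
proof -
  have "- x = 0 - x" for x :: complex by simp
  then show "x \<in> OZ \<Longrightarrow> - x \<in> OZ" unfolding OZ_def by (metis IntE IntI R_closed(2,5) Z_closed(6))
qed (auto simp: OZ_def eta_in_Z)

lemma OZ_sum [intro]: "(\<And>i. i \<in> A \<Longrightarrow> f i \<in> OZ) \<Longrightarrow> sum f A \<in> OZ"
  by (induction A rule: infinite_finite_induct) auto

lemma OZ_prod [intro]: "(\<And>i. i \<in> A \<Longrightarrow> f i \<in> OZ) \<Longrightarrow> prod f A \<in> OZ"
  by (induction A rule: infinite_finite_induct) auto

lemma S_pow_OZ [simp]: "x \<in> OZ \<Longrightarrow> (S ^^ k) x \<in> OZ"
  using S_eq_sig sig_hom(8)[OF not_dvd_g_power] unfolding OZ_def by (metis IntE IntI S_pow_in_Z)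

lemma OZ_in_Z [simp]: "x \<in> OZ \<Longrightarrow> x \<in> Z"
  by (simp add: OZ_def)

lemma OZ_in_R [simp]: "x \<in> OZ \<Longrightarrow> x \<in> R"
  by (simp add: OZ_def)

text \<open>Invariance under \<open>sig (g ^ n)\<close> gives integral combinations of periods, and
  the periods are the \<open>S\<close>-conjugates of \<open>eta n 0\<close> in another
  order.\<close>

lemma OZ_eq: "OZ = {\<Sum>k<n. of_int (c k) * (S ^^ k) (eta n 0) | c :: nat \<Rightarrow> int. True}" (is "_ = ?L")
proof
  show "?L \<subseteq> OZ" by auto
  show "OZ \<subseteq> ?L"
  proof
    fix x assume x: "x \<in> OZ"
    have add: "x + y \<in> ?L" if xy: "x \<in> ?L" "y \<in> ?L" for x y
    proof -
      obtain c d :: "nat \<Rightarrow> int" where "x = (\<Sum>k<n. of_int (c k) * (S ^^ k) (eta n 0))"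
        "y = (\<Sum>k<n. of_int (d k) * (S ^^ k) (eta n 0))"
        using xy by blast
      then have "x + y = (\<Sum>k<n. of_int (c k + d k) * (S ^^ k) (eta n 0))"
        by (simp add: sum.distrib distrib_right)
      then show ?thesis by (intro CollectI exI conjI TrueI)
    qed
    have zero: "0 \<in> ?L" by (rule CollectI, rule exI[of _ "\<lambda>_. 0"]) simp
    have single: "of_int m * eta n k \<in> ?L" for m k
    proof -
      have "eta n k = sig (g ^ k) (eta n 0)" by (simp add: sig_eta)
      then obtain l where l: "l < n" "eta n k = (S ^^ l) (eta n 0)"
        using S_eq_sig eta_in_Z by metis
      have "of_int m * eta n k = (\<Sum>k<n. if k = l then of_int m * (S ^^ k) (eta n 0) else 0)"
        using l by simp
      also have "\<dots> = (\<Sum>k<n. of_int (if k = l then m else 0) * (S ^^ k) (eta n 0))"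
        by (intro sum.cong) auto
      finally show ?thesis by (intro CollectI exI conjI TrueI)
    qed
    obtain c :: "nat \<Rightarrow> int" where "x = (\<Sum>k<n. of_int (c k) * eta n k)"
      using fixed_by_sig_power[OF n_dvd _ sig_n_fixed] x by (metis OZ_in_R OZ_in_Z)
    moreover have "(\<Sum>k\<in>A. of_int (c k) * eta n k) \<in> ?L" for A
      using zero single add by (induction A rule: infinite_finite_induct) auto
    ultimately show "x \<in> ?L" by simp
  qed
qed

lemma S_pow_eq_sig: "\<exists>j. \<not> n dvd j \<and> (\<forall>z\<in>Z. \<forall>i. (S ^^ i) z = sig (g ^ (j * i)) z)"
  by (rule S_eq_sig) blast

lemma R_fixed_OZ:
  assumes "x \<in> R" "sig (g ^ n) x = x" shows "x \<in> OZ"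
proof -
  obtain c :: "nat \<Rightarrow> int" where "x = (\<Sum>k<n. of_int (c k) * eta n k)"
    using n_dvd assms by (rule fixed_by_sig_power)
  then show ?thesis by auto
qed

section \<open>The conjugates of \<beta> and integrality at p\<close>

lemma beta_in_OZ [simp]: "beta n k \<in> OZ"
  by (rule R_fixed_OZ) (simp_all add: sig_beta beta_period[OF n_dvd])

lemma period_count: "(p - 1) div n * n = p - 1" "(p - 1) div n > 0"
  using n_dvd p_ge_2 n_ge_2 by (auto simp: div_greater_zero_iff dvd_imp_le)

lemma beta_complement:
  obtains \<gamma> where "\<gamma> \<in> OZ" "beta n 0 * \<gamma> = of_nat p"
proof -
  have "{..<n} = insert 0 {1..<n}" using n_ge_2 by auto
  then have "beta n 0 * (\<Prod>k\<in>{1..<n}. beta n k) = of_nat p"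
    using prod_beta[OF n_dvd] by simp
  then show thesis by (intro that[of "\<Prod>k\<in>{1..<n}. beta n k"]) auto
qed

text \<open>\<open>S\<close> shifts the index by some \<open>j\<close> prime to \<open>n\<close>,
  and \<open>i \<mapsto> j * i mod n\<close> is a permutation. Products and sums over the
  \<open>S\<close>-orbit thus become those over the period index.\<close>

lemma S_pow_reindex:
  fixes F :: "nat \<Rightarrow> complex"
  assumes F: "\<And>k. F (k + n) = F k" and sig: "\<And>i k. sig (g ^ i) (F k) = F (k + i)" and Z: "\<And>k. F k \<in> Z"
  obtains s where "bij_betw s {..<n} {..<n}" "\<And>i. i < n \<Longrightarrow> (S ^^ i) (F 0) = F (s i)"
proof -
  obtain j where j: "\<not> n dvd j" and S: "\<And>z i. z \<in> Z \<Longrightarrow> (S ^^ i) z = sig (g ^ (j * i)) z"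
    using S_pow_eq_sig by blast
  define s where "s i = j * i mod n" for i
  have co: "coprime j n" using j prime_n by (metis coprime_commute prime_imp_coprime)
  have "inj_on s {..<n}"
  proof (rule inj_onI)
    fix a beta_quot assume ab: "a \<in> {..<n}" "beta_quot \<in> {..<n}" "s a = s beta_quot"
    then have "[j * a = j * beta_quot] (mod n)" by (simp add: s_def cong_def)
    then have "[a = beta_quot] (mod n)" using co by (simp add: cong_mult_lcancel_nat)
    then show "a = beta_quot" using ab by (simp add: cong_def)
  qed
  moreover have "s ` {..<n} \<subseteq> {..<n}" using n_ge_2 by (auto simp: s_def)
  ultimately have "bij_betw s {..<n} {..<n}"
    by (simp add: bij_betw_def endo_inj_surj)
  moreover have "(S ^^ i) (F 0) = F (s i)" for i
  proof -
    have per: "F (k + n * m) = F k" for k m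
    proof (induction m)
      case (Suc m)
      then show ?case using F[of "k + n * m"] by (simp add: ac_simps)
    qed simp
    have "(S ^^ i) (F 0) = F (j * i)" using S[OF Z] sig by simp
    also have "\<dots> = F (s i)" using per[of "j * i mod n" "j * i div n"] by (simp add: s_def)
    finally show ?thesis .
  qed
  ultimately show thesis by (rule that)
qed

lemma prod_S_beta: "(\<Prod>i<n. (S ^^ i) (beta n 0)) = of_nat p"
proof -
  obtain s where s: "bij_betw s {..<n} {..<n}" "\<And>i. i < n \<Longrightarrow> (S ^^ i) (beta n 0) = beta n (s i)"
    by (rule S_pow_reindex[of "beta n"]) (auto simp: beta_period[OF n_dvd] sig_beta)
  have "(\<Prod>i<n. (S ^^ i) (beta n 0)) = (\<Prod>i<n. beta n (s i))"
    using s(2) by simp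
  also have "\<dots> = (\<Prod>k<n. beta n k)" by (rule prod.reindex_bij_betw[OF s(1)])
  finally show ?thesis using prod_beta[OF n_dvd] by simp
qed

lemma sum_S_eta: "(\<Sum>i<n. (S ^^ i) (eta n 0)) = - 1"
proof -
  obtain s where s: "bij_betw s {..<n} {..<n}" "\<And>i. i < n \<Longrightarrow> (S ^^ i) (eta n 0) = eta n (s i)"
    by (rule S_pow_reindex[of "eta n"]) (auto simp: eta_period[OF n_dvd] sig_eta eta_in_Z)
  have "(\<Sum>i<n. (S ^^ i) (eta n 0)) = (\<Sum>i<n. eta n (s i))"
    using s(2) by simp
  also have "\<dots> = (\<Sum>k<n. eta n k)" by (rule sum.reindex_bij_betw[OF s(1)])
  finally show ?thesis using sum_eta[OF n_dvd] by simp
qed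

lemma S_pow_1: "(S ^^ i) 1 = 1"
  by (induction i) simp_all

lemma S_pow_rat: "c \<in> \<rat> \<Longrightarrow> (S ^^ i) c = c"
  by (induction i) simp_all

lemma S_pow_power: "z \<in> Z \<Longrightarrow> (S ^^ i) (z ^ k) = (S ^^ i) z ^ k"
  by (induction k) (simp_all add: S_pow_hom S_pow_1)

lemma S_pow_sum: "(\<And>a. a \<in> A \<Longrightarrow> f a \<in> Z) \<Longrightarrow> (S ^^ i) (sum f A) = (\<Sum>a\<in>A. (S ^^ i) (f a))"
  by (induction A rule: infinite_finite_induct) (auto simp: S_pow_hom S_pow_rat Z_sum)

text \<open>The element \<open>beta_quot = \<beta>\<^sup>n\<^sup>-\<^sup>1 / p\<close>, a unit times \<open>1 / \<beta>\<close>, satisfies \<open>y = (\<lambda> - u) beta_quot\<close>.\<close>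

definition beta_quot :: complex where "beta_quot = beta n 0 ^ (n - 1) / of_nat p"

lemma beta_quot_in_Z [simp]: "beta_quot \<in> Z"
proof -
  have "beta n 0 ^ (n - 1) * inverse (of_nat p) \<in> Z" by (intro Z_closed) auto
  then show ?thesis by (simp add: beta_quot_def divide_inverse)
qed

lemma p_ne_0: "of_nat p \<noteq> (0::complex)"
  using p_ge_2 by simp

lemma dvR_p_imp: "dvR (of_nat p) x \<Longrightarrow> x / of_nat p \<in> R"
  using p_ne_0 by (auto simp: dvR_def)

lemma S_pow_beta_quot: "(S ^^ i) beta_quot = (S ^^ i) (beta n 0) ^ (n - 1) / of_nat p"
proof -
  have "(S ^^ i) (beta_quot * of_nat p) = (S ^^ i) beta_quot * of_nat p"
    by (simp add: S_pow_hom S_pow_rat)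
  moreover have "beta_quot * of_nat p = beta n 0 ^ (n - 1)" using p_ne_0 by (simp add: beta_quot_def)
  ultimately show ?thesis using p_ne_0 by (simp add: S_pow_power field_simps)
qed

lemma prod_S_beta_quot: "(\<Prod>i<n. (S ^^ i) beta_quot) = 1 / of_nat p"
proof -
  have "(\<Prod>i<n. (S ^^ i) beta_quot) = of_nat p ^ (n - 1) / of_nat p ^ n"
    by (simp add: S_pow_beta_quot prod_dividef prod_power_distrib[symmetric] prod_S_beta)
  also have "of_nat p ^ n = (of_nat p * of_nat p ^ (n - 1) :: complex)"
  proof -
    have "Suc (n - 1) = n" using n_ge_2 by simp
    then show ?thesis by (metis power_Suc)
  qed
  finally show ?thesis using p_ne_0 by simp
qed

text \<open>Write h for \<open>(p - 1) div n\<close>. Every conjugate of \<beta> is divisible by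
  \<open>pi1 ^ h\<close>, so together with the h factors of \<open>x\<close> the numerator collects
  h n = p - 1 factors \<open>pi1\<close>, which is an associate of the denominator
  \<open>p\<close>.\<close>

lemma pi1_power_times_beta_quot:
  assumes "dvR (pi1 ^ ((p - 1) div n)) x"
  shows "x * (S ^^ i) beta_quot \<in> R"
proof -
  let ?h = "(p - 1) div n"
  obtain j where "(S ^^ i) (beta n 0) = sig (g ^ (j * i)) (beta n 0)"
    using S_pow_eq_sig OZ_in_Z[OF beta_in_OZ[of 0]] by blast
  then have "(S ^^ i) (beta n 0) = beta n (j * i)" by (simp add: sig_beta)
  then have "dvR (pi1 ^ ?h * (pi1 ^ ?h) ^ (n - 1)) (x * (S ^^ i) (beta n 0) ^ (n - 1))"
    using assms pi1_power_dvR_beta by (intro dvR_mult dvR_power) auto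
  also have "pi1 ^ ?h * (pi1 ^ ?h) ^ (n - 1) = pi1 ^ (?h * n)"
  proof -
    have "Suc (n - 1) = n" using n_ge_2 by simp
    then show ?thesis by (metis power_Suc power_mult)
  qed
  finally have "dvR (of_nat p) (x * (S ^^ i) (beta n 0) ^ (n - 1))"
    unfolding period_count(1) using dvR_trans[OF p_dvR_pi1_power] by blast
  from dvR_p_imp[OF this] show ?thesis by (simp add: S_pow_beta_quot)
qed

text \<open>The automorphisms act trivially modulo \<open>pi1\<close>, so \<open>pi1\<close> divides
  \<open>z - S z\<close>. This difference lies in \<open>Z\<close>, so its valuation jumps to
  \<open>(p - 1) div n\<close>, enough to cancel the denominator of
  \<open>beta_quot\<close>.\<close>

lemma S_diff_times_beta_quot:
  assumes z: "z \<in> OZ" shows "(z - S z) * beta_quot \<in> OZ"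
proof -
  obtain j where "\<forall>z\<in>Z. \<forall>i. (S ^^ i) z = sig (g ^ (j * i)) z" using S_pow_eq_sig by blast
  from this[rule_format, of z 1] z have j: "S z = sig (g ^ j) z" by simp
  have Sz: "S z \<in> OZ" using S_pow_OZ[OF z, of 1] by simp
  have "dvR pi1 (0 - (sig (g ^ j) z - z))"
    by (intro dvR_diff sig_mod_pi1) (use z in auto)
  then have "dvR pi1 (z - S z)" by (simp add: j)
  then have "dvR (pi1 ^ ((p - 1) div n)) (z - S z)"
    using z Sz by (intro fixed_valuation[OF n_dvd] sig_n_fixed) auto
  from pi1_power_times_beta_quot[OF this, of 0] have "(z - S z) * beta_quot \<in> R" by simp
  moreover have "(z - S z) * beta_quot \<in> Z" using z Sz by (intro Z_closed) auto
  ultimately show ?thesis unfolding OZ_def by (rule IntI)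
qed

lemma coeff_linear_prod_Suc:
  "coeff (\<Prod>i<Suc m. [:- a i, 1:]) k =
    (if k = 0 then 0 else coeff (\<Prod>i<m. [:- a i, 1:]) (k - 1)) - a m * coeff (\<Prod>i<m. [:- a i, 1:]) k"
  for a :: "nat \<Rightarrow> 'b::comm_ring_1"
  by (simp add: coeff_pCons mult.commute split: nat.split)

lemma coeff_linear_prod_gt: "m < k \<Longrightarrow> coeff (\<Prod>i<m. [:- a i, 1:]) k = 0"
  for a :: "nat \<Rightarrow> 'b::comm_ring_1"
  by (induction m arbitrary: k) (simp_all only: coeff_linear_prod_Suc, auto)

lemma coeff_linear_prod_top: "coeff (\<Prod>i<m. [:- a i, 1:]) m = 1"
  for a :: "nat \<Rightarrow> 'b::comm_ring_1"
  by (induction m) (simp_all only: coeff_linear_prod_Suc coeff_linear_prod_gt, auto)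

lemma coeff_linear_prod_0: "coeff (\<Prod>i<m. [:- a i, 1:]) 0 = (\<Prod>i<m. - a i)"
  for a :: "nat \<Rightarrow> 'b::comm_ring_1"
  by (induction m) (simp_all only: coeff_linear_prod_Suc, auto)

text \<open>Each \<open>S\<^sup>i beta_quot\<close> has \<open>\<pi>\<close>-adic valuation \<open>-(p - 1) / n\<close>, so the middle coefficients have valuation
  bigger than that of \<open>1 / p\<close>; being rational they are integers.\<close>

lemma middle_coeff_integral:
  fixes l :: int
  assumes "0 < j" "j < n"
  obtains m :: int where "coeff (\<Prod>i<n. [:- (of_int l * (S ^^ i) beta_quot), 1:]) j = of_int m"
proof -
  define h where "h = (p - 1) div n"
  define a where "a i = of_int l * (S ^^ i) beta_quot" for i
  define c where "c m k = coeff (\<Prod>i<m. [:- a i, 1:]) k" for m k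
  have aR: "pi1 ^ h * a i \<in> R" for i
  proof -
    have "dvR (pi1 ^ h) (pi1 ^ h * of_int l)" by (intro dvRI) auto
    from pi1_power_times_beta_quot[OF this[unfolded h_def], of i] show ?thesis
      by (simp add: a_def h_def mult.assoc)
  qed
  \<comment> \<open>The coefficient of X^k in a product of \<open>m\<close> factors has degree m - k
    in the roots, and each root costs one factor \<open>pi1 ^ h\<close>.\<close>
  have cR: "pi1 ^ (h * (m - k)) * c m k \<in> R" for m k
  proof (induction m arbitrary: k)
    case 0
    then show ?case by (auto simp: c_def)
  next
    case (Suc m)
    have cS: "c (Suc m) k = (if k = 0 then 0 else c m (k - 1)) - a m * c m k"
      unfolding c_def by (rule coeff_linear_prod_Suc)
    show ?case
    proof (cases "k \<le> m")
      case True
      have "pi1 ^ (h * (Suc m - k)) * (a m * c m k) = (pi1 ^ h * a m) * (pi1 ^ (h * (m - k)) * c m k)"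
        using True by (simp add: Suc_diff_le power_add)
      also have "\<dots> \<in> R" by (rule R_closed(3)[OF aR Suc])
      finally have 1: "pi1 ^ (h * (Suc m - k)) * (a m * c m k) \<in> R" .
      have "pi1 ^ (h * (Suc m - k)) * (if k = 0 then 0 else c m (k - 1)) \<in> R"
        using Suc[of "k - 1"] by auto
      from R_closed(2)[OF this 1] show ?thesis
        unfolding cS by (simp only: right_diff_distrib)
    next
      case False
      then have "c m k = 0" unfolding c_def by (intro coeff_linear_prod_gt) simp
      then have "c (Suc m) k = c m (k - 1)" using False cS by auto
      then show ?thesis using False Suc[of "k - 1"] by simp
    qed
  qed
  have "a i = (S ^^ i) (of_int l * beta_quot)" for i by (simp add: a_def S_pow_hom S_pow_rat)
  then have rat: "c n j \<in> \<rat>"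
    unfolding c_def using orbit_poly_rational[of "of_int l * beta_quot" j] by simp
  have "h * n = p - 1" "h > 0" using period_count by (simp_all add: h_def)
  have "h * (n - j) + h * j = h * n"
    unfolding add_mult_distrib2[symmetric] using assms by simp
  moreover have "h * j > 0" using \<open>h > 0\<close> assms by simp
  \<comment> \<open>Clearing the denominator uses \<open>h * (n - j)\<close> of the p - 1 factors
    \<open>pi1\<close> of \<open>p\<close>; since \<open>j\<close> is positive, one more can be set
    aside. So \<open>p\<close> times the coefficient is an integer divisible by \<open>pi1\<close>,
    hence by \<open>p\<close>.\<close>
  ultimately have exps: "h * (n - j) + (h * j - 1) + 1 = p - 1"
    using \<open>h * n = p - 1\<close> by linarith
  obtain e' where e': "e' \<in> R" "of_nat p = pi1 ^ (p - 1) * e'"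
    using pi1_power_dvR_p by (auto simp: dvR_def)
  have "of_nat p * c n j = pi1 * ((pi1 ^ (h * (n - j)) * c n j) * (pi1 ^ (h * j - 1) * e'))"
    unfolding e'(2) exps[symmetric] power_add by simp
  moreover have "(pi1 ^ (h * (n - j)) * c n j) * (pi1 ^ (h * j - 1) * e') \<in> R"
    by (intro R_closed(3)[OF cR] R_closed(3)[OF _ e'(1)]) auto
  ultimately have dv: "dvR pi1 (of_nat p * c n j)" by (intro dvRI)
  then have "of_nat p * c n j \<in> R" by (auto simp: dvR_def)
  then obtain M where M: "of_nat p * c n j = of_int M"
    using rational_in_R rat by (metis Rats_mult Rats_of_nat)
  have "int p dvd M" by (rule pi1_dvR_int) (use dv M in simp)
  then obtain m where "M = int p * m" by (rule dvdE)
  then have "c n j = of_int m" using M p_ne_0 by simp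
  then show thesis using that unfolding c_def a_def by blast
qed

text \<open>\<open>S ^^ i\<close> shifts the periods by a multiple of \<open>i\<close> not divisible
  by \<open>n\<close>, so the trace form applies. The identity will turn a sum of commutators
  involving the i-th power of \<open>u\<close> into a multiple by \<open>p\<close>.\<close>

lemma trace_form_S:
  assumes "\<not> n dvd i"
  obtains w z where "\<And>k. w k \<in> OZ" "\<And>k. z k \<in> OZ"
    "(\<Sum>k<n. w k * (z k - (S ^^ i) (z k))) = of_nat p"
proof -
  obtain j where j: "\<not> n dvd j" "\<And>z i. z \<in> Z \<Longrightarrow> (S ^^ i) z = sig (g ^ (j * i)) z"
    using S_pow_eq_sig by blast
  have nd: "\<not> n dvd j * i" using assms j prime_n by (simp add: prime_dvd_mult_iff)
  obtain i0 where i0: "\<And>m. \<not> n dvd m \<Longrightarrow>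
      (\<Sum>k<n. eta n k * (eta n (k + i0) - eta n (k + i0 + m))) = of_nat p"
    using eta_trace_form[OF n_dvd] by blast
  note i0[OF nd]
  moreover have "(S ^^ i) (eta n k) = eta n (k + j * i)" for k
    using j(2)[OF eta_in_Z] by (simp add: sig_eta)
  ultimately show thesis by (intro that[of "eta n" "\<lambda>k. eta n (k + i0)"]) auto
qed

lemma cube_of_sum:
  fixes m :: nat
  assumes "\<And>i. i < m \<Longrightarrow> a i \<in> OZ"
  obtains y where "y \<in> OZ" "(\<Sum>i<m. a i) ^ 3 = (\<Sum>i<m. a i ^ 3) + 3 * y"
proof -
  have "\<exists>y\<in>OZ. (\<Sum>i<m. a i) ^ 3 = (\<Sum>i<m. a i ^ 3) + 3 * y"
    using assms
  proof (induction m)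
    case 0
    then show ?case by (intro bexI[of _ 0]) auto
  next
    case (Suc m)
    then obtain y where y: "y \<in> OZ" "(\<Sum>i<m. a i) ^ 3 = (\<Sum>i<m. a i ^ 3) + 3 * y" by auto
    let ?s = "\<Sum>i<m. a i"
    have s: "?s \<in> OZ" "a m \<in> OZ" using Suc.prems by auto
    have "(?s + a m) ^ 3 = ?s ^ 3 + a m ^ 3 + 3 * (?s * a m * (?s + a m))"
      by (simp add: power3_eq_cube algebra_simps)
    then have "(\<Sum>i<Suc m. a i) ^ 3 = (\<Sum>i<Suc m. a i ^ 3) + 3 * (y + ?s * a m * (?s + a m))"
      unfolding sum.lessThan_Suc using y(2) by (simp add: algebra_simps)
    then show ?case using s y(1) by (intro bexI[of _ "y + ?s * a m * (?s + a m)"]) auto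
  qed
  then show thesis using that by blast
qed

text \<open>All conjugates of \<eta> have trace -1, so the trace of the cube is minus the sum of the
  \<open>c k\<close>. Comparison with the cube of the trace gives -1 = - sum c + 3 y, where
  \<open>y\<close> is rational and in \<open>R\<close>, hence an integer.\<close>

lemma eta_cube:
  obtains c :: "nat \<Rightarrow> int" and t :: int
  where "eta n 0 ^ 3 = (\<Sum>k<n. of_int (c k) * (S ^^ k) (eta n 0))" "(\<Sum>k<n. c k) = 1 + 3 * t"
proof -
  have "eta n 0 ^ 3 \<in> OZ" by simp
  then obtain c :: "nat \<Rightarrow> int" where c: "eta n 0 ^ 3 = (\<Sum>k<n. of_int (c k) * (S ^^ k) (eta n 0))"
    unfolding OZ_eq by blast
  obtain y where y: "y \<in> OZ"
    "(\<Sum>i<n. (S ^^ i) (eta n 0)) ^ 3 = (\<Sum>i<n. (S ^^ i) (eta n 0) ^ 3) + 3 * y"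
    by (rule cube_of_sum[of n "\<lambda>i. (S ^^ i) (eta n 0)"]) auto
  have tr: "(\<Sum>i<n. (S ^^ i) ((S ^^ k) (eta n 0))) = - 1" for k
  proof -
    have "(\<Sum>i<n. (S ^^ i) ((S ^^ k) (eta n 0))) = (\<Sum>i<n. (S ^^ (i + k)) (eta n 0))"
      by (simp add: funpow_add)
    also have "\<dots> = (\<Sum>i<n. (S ^^ i) (eta n 0))"
      by (rule sum_periodic_shift) (simp add: funpow_add S_order eta_in_Z)
    finally show ?thesis by (simp add: sum_S_eta)
  qed
  have "(\<Sum>i<n. (S ^^ i) (eta n 0) ^ 3) = (\<Sum>i<n. (S ^^ i) (eta n 0 ^ 3))"
    by (simp add: S_pow_power eta_in_Z)
  also have "\<dots> = (\<Sum>i<n. \<Sum>k<n. of_int (c k) * (S ^^ i) ((S ^^ k) (eta n 0)))"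
    unfolding c by (intro sum.cong refl) (subst S_pow_sum, auto simp: S_pow_hom S_pow_rat eta_in_Z)
  also have "\<dots> = (\<Sum>k<n. of_int (c k) * (\<Sum>i<n. (S ^^ i) ((S ^^ k) (eta n 0))))"
    by (subst sum.swap) (simp add: sum_distrib_left)
  also have "\<dots> = - of_int (\<Sum>k<n. c k)" by (simp add: tr sum_negf)
  finally have eq: "3 * y = of_int ((\<Sum>k<n. c k) - 1)"
    using y(2) by (simp add: sum_S_eta algebra_simps)
  have "y = of_int ((\<Sum>k<n. c k) - 1) / 3" unfolding eq[symmetric] by simp
  then have "y \<in> \<rat>" by (metis Rats_divide Rats_number_of Rats_of_int)
  then obtain t where "y = of_int t" using rational_in_R y(1) by (metis OZ_in_R)
  then have "of_int (3 * t) = (of_int ((\<Sum>k<n. c k) - 1) :: complex)" using eq by simp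
  then have "(\<Sum>k<n. c k) = 1 + 3 * t" unfolding of_int_eq_iff by simp
  then show thesis using that c by blast
qed

end

section \<open>The order of Hull\<close>

locale hull_order_construction = prime_cyclic_subfield p g \<xi> n Z S
  for p g :: nat and \<xi> :: complex and n :: nat and Z :: "complex set" and S :: "complex \<Rightarrow> complex" +
  fixes \<iota> :: "complex \<Rightarrow> 'a::{division_ring,ring_char_0}" and u y :: 'a and \<sigma> l :: int
  assumes odd_n: "odd n" and iota_1: "\<iota> 1 = 1"
    and iota_add: "\<And>x y. x \<in> Z \<Longrightarrow> y \<in> Z \<Longrightarrow> \<iota> (x + y) = \<iota> x + \<iota> y"
    and iota_mult: "\<And>x y. x \<in> Z \<Longrightarrow> y \<in> Z \<Longrightarrow> \<iota> (x * y) = \<iota> x * \<iota> y"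
    and iota_u: "\<And>z. z \<in> Z \<Longrightarrow> \<iota> z * u = u * \<iota> (S z)"
    and u_pow_n: "u ^ n = of_int \<sigma>"
    and l_cong: "[l ^ n = \<sigma>] (mod int p)"
    and y_eq: "of_nat p * y = (of_int l - u) * \<iota> (beta n 0 ^ (n - 1))"
begin

section \<open>The embedding of Z and its commutation with u and y\<close>

lemma iota_0: "\<iota> 0 = 0"
  using iota_add[of 0 0] by simp

lemma iota_minus: "x \<in> Z \<Longrightarrow> \<iota> (- x) = - \<iota> x"
  using iota_add[of x "- x"] iota_0 by (simp add: eq_neg_iff_add_eq_0 add.commute)

lemma iota_diff: "x \<in> Z \<Longrightarrow> x' \<in> Z \<Longrightarrow> \<iota> (x - x') = \<iota> x - \<iota> x'"
  using iota_add[of x "- x'"] iota_minus by simp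

lemma iota_of_nat: "\<iota> (of_nat m) = of_nat m"
  by (induction m) (simp_all add: iota_0 iota_1 iota_add)

lemma iota_of_int: "\<iota> (of_int m) = of_int m"
  by (cases m rule: int_cases2) (simp_all add: iota_of_nat iota_minus)

lemma iota_sum: "(\<And>i. i \<in> A \<Longrightarrow> f i \<in> Z) \<Longrightarrow> \<iota> (sum f A) = (\<Sum>i\<in>A. \<iota> (f i))"
  by (induction A rule: infinite_finite_induct) (auto simp: iota_0 iota_add Z_sum)

lemma iota_commute: "x \<in> Z \<Longrightarrow> x' \<in> Z \<Longrightarrow> \<iota> x * \<iota> x' = \<iota> x' * \<iota> x"
  by (metis iota_mult mult.commute)

lemma iota_u_pow: "z \<in> Z \<Longrightarrow> \<iota> z * u ^ k = u ^ k * \<iota> ((S ^^ k) z)"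
proof (induction k arbitrary: z)
  case (Suc k)
  have "\<iota> z * u ^ Suc k = u * (\<iota> (S z) * u ^ k)"
    using Suc.prems by (simp add: mult.assoc[symmetric] iota_u)
  also have "\<dots> = u ^ Suc k * \<iota> ((S ^^ k) (S z))"
    using Suc by (simp add: S_hom mult.assoc)
  finally show ?case by (simp add: funpow_swap1)
qed simp

lemma y_conv: "y = (of_int l - u) * \<iota> beta_quot"
proof -
  have "\<iota> (beta n 0 ^ (n - 1)) = \<iota> (of_nat p * beta_quot)" using p_ne_0 by (simp add: beta_quot_def)
  also have "\<dots> = of_nat p * \<iota> beta_quot" by (simp add: iota_mult iota_of_nat)
  finally have "of_nat p * y = of_nat p * ((of_int l - u) * \<iota> beta_quot)"
    unfolding y_eq by (metis mult.assoc mult_of_nat_commute)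
  moreover have "of_nat p \<noteq> (0::'a)" using p_ge_2 by simp
  ultimately show ?thesis by simp
qed

text \<open>A skew polynomial rule with a correction term: moving \<open>z\<close> past
  \<open>y = (l - u) * beta_quot\<close> leaves \<open>l * ((z - S z) * beta_quot)\<close>, which is
  integral by \<open>S_diff_times_beta_quot\<close>.\<close>

lemma iota_y:
  assumes z: "z \<in> OZ"
  obtains w where "w \<in> OZ" "\<iota> z * y = y * \<iota> (S z) + \<iota> w"
proof (rule that)
  have Z: "z \<in> Z" "S z \<in> Z" using z by (auto simp: S_hom)
  show "of_int l * ((z - S z) * beta_quot) \<in> OZ" using S_diff_times_beta_quot[OF z] by auto
  have c: "\<iota> z * of_int l = of_int l * \<iota> z" by (rule mult_of_int_commute[symmetric])
  have "\<iota> (of_int l * ((z - S z) * beta_quot)) = of_int l * (\<iota> z * \<iota> beta_quot - \<iota> (S z) * \<iota> beta_quot)"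
    using Z by (simp add: iota_mult iota_diff iota_of_int left_diff_distrib)
  moreover have "\<iota> z * y = of_int l * (\<iota> z * \<iota> beta_quot) - u * (\<iota> (S z) * \<iota> beta_quot)"
    unfolding y_conv using Z c by (simp add: right_diff_distrib left_diff_distrib mult.assoc[symmetric] iota_u)
  moreover have "y * \<iota> (S z) = of_int l * (\<iota> (S z) * \<iota> beta_quot) - u * (\<iota> (S z) * \<iota> beta_quot)"
    unfolding y_conv using iota_commute[OF Z(2) beta_quot_in_Z]
    by (simp add: left_diff_distrib mult.assoc)
  ultimately show "\<iota> z * y = y * \<iota> (S z) + \<iota> (of_int l * ((z - S z) * beta_quot))"
    by (simp add: right_diff_distrib)
qed

text \<open>With \<open>b = beta_quot\<close> one has \<open>y u\<^sup>m = u\<^sup>m (\<lambda> S\<^sup>m b) - u\<^sup>m\<^sup>+\<^sup>1 S\<^sup>m b\<close>. Hence the product of the commuting operators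
  \<open>L\<^sub>y - R\<^bsub>\<lambda> S\<^sup>i b\<^esub>\<close> maps \<open>1\<close> to \<open>(-1)\<^sup>m u\<^sup>m\<close> times a scalar.\<close>

lemma y_linear_prod:
  "(\<Sum>k\<le>m. y ^ k * \<iota> (coeff (\<Prod>i<m. [:- (of_int l * (S ^^ i) beta_quot), 1:]) k)) =
    (- 1) ^ m * u ^ m * \<iota> (\<Prod>i<m. (S ^^ i) beta_quot)"
proof (induction m)
  case 0
  then show ?case by (simp add: iota_1)
next
  case (Suc m)
  define a where "a i = of_int l * (S ^^ i) beta_quot" for i
  define c where "c m k = coeff (\<Prod>i<m. [:- a i, 1:]) k" for m k
  define N where "N = (\<Prod>i<m. (S ^^ i) beta_quot)"
  have aZ: "a i \<in> Z" for i by (auto simp: a_def)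
  have NZ: "N \<in> Z" by (auto simp: N_def)
  have cS: "c (Suc m) k = (if k = 0 then 0 else c m (k - 1)) - a m * c m k" for m k
    unfolding c_def by (rule coeff_linear_prod_Suc)
  have cZ: "c m k \<in> Z" for m k
  proof (induction m arbitrary: k)
    case 0
    then show ?case by (auto simp: c_def)
  next
    case (Suc m)
    then show ?case using aZ by (auto simp: cS)
  qed
  have IH: "(\<Sum>k\<le>m. y ^ k * \<iota> (c m k)) = (- 1) ^ m * u ^ m * \<iota> N"
    using Suc by (simp add: a_def c_def N_def)
  have top: "c m (Suc m) = 0" unfolding c_def by (rule coeff_linear_prod_gt) simp
  have "(\<Sum>k\<le>Suc m. y ^ k * \<iota> (c (Suc m) k)) =
      (\<Sum>k\<le>Suc m. y ^ k * \<iota> (if k = 0 then 0 else c m (k - 1))) - (\<Sum>k\<le>Suc m. y ^ k * \<iota> (c m k * a m))"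
    using cZ aZ by (simp add: cS iota_diff right_diff_distrib sum_subtractf mult.commute)
  also have "(\<Sum>k\<le>Suc m. y ^ k * \<iota> (if k = 0 then 0 else c m (k - 1))) = y * (\<Sum>k\<le>m. y ^ k * \<iota> (c m k))"
    by (simp only: sum.atMost_Suc_shift) (simp add: iota_0 sum_distrib_left mult.assoc)
  also have "(\<Sum>k\<le>Suc m. y ^ k * \<iota> (c m k * a m)) = (\<Sum>k\<le>m. y ^ k * \<iota> (c m k)) * \<iota> (a m)"
    using cZ aZ top by (simp add: iota_0 iota_mult sum_distrib_right mult.assoc)
  also have "y * (\<Sum>k\<le>m. y ^ k * \<iota> (c m k)) - (\<Sum>k\<le>m. y ^ k * \<iota> (c m k)) * \<iota> (a m) =
      (- 1) ^ m * (y * u ^ m * \<iota> N - u ^ m * \<iota> N * \<iota> (a m))"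
  proof -
    have "y * ((- 1) ^ m * x) = (- 1) ^ m * (y * x)" for x
      by (cases "even m") simp_all
    then show ?thesis unfolding IH by (simp add: right_diff_distrib mult.assoc)
  qed
  also have "y * u ^ m * \<iota> N - u ^ m * \<iota> N * \<iota> (a m) = - (u ^ Suc m * \<iota> (N * (S ^^ m) beta_quot))"
  proof -
    have "y * u ^ m = (of_int l - u) * (u ^ m * \<iota> ((S ^^ m) beta_quot))"
      unfolding y_conv by (simp add: mult.assoc iota_u_pow)
    also have "\<dots> = of_int l * u ^ m * \<iota> ((S ^^ m) beta_quot) - u ^ Suc m * \<iota> ((S ^^ m) beta_quot)"
      by (simp add: left_diff_distrib mult.assoc)
    also have "of_int l * u ^ m = u ^ m * of_int l" by (rule mult_of_int_commute)
    finally have "y * u ^ m * \<iota> N = u ^ m * (\<iota> (a m) * \<iota> N) - u ^ Suc m * (\<iota> ((S ^^ m) beta_quot) * \<iota> N)"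
      by (simp add: left_diff_distrib mult.assoc a_def iota_mult iota_of_int)
    then show ?thesis
      using iota_commute[OF aZ[of m] NZ] iota_commute[of "(S ^^ m) beta_quot" N] NZ
      by (simp add: mult.assoc iota_mult)
  qed
  finally show ?case
    unfolding c_def a_def N_def by (simp add: mult.assoc)
qed

section \<open>Closure of the order under multiplication\<close>

definition Ord :: "'a set" where
  "Ord = {\<Sum>i<n. y ^ i * \<iota> (w i) | w. \<forall>i. w i \<in> OZ}"

lemma Ord_I: "(\<And>i. i < n \<Longrightarrow> w i \<in> OZ) \<Longrightarrow> (\<Sum>i<n. y ^ i * \<iota> (w i)) \<in> Ord"
  unfolding Ord_def
  by (rule CollectI, rule exI[of _ "\<lambda>i. if i < n then w i else 0"]) auto

lemma Ord_E:
  assumes "x \<in> Ord" obtains w where "\<And>i. w i \<in> OZ" "x = (\<Sum>i<n. y ^ i * \<iota> (w i))"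
  using assms unfolding Ord_def by blast

lemma Ord_monom: "i < n \<Longrightarrow> w \<in> OZ \<Longrightarrow> y ^ i * \<iota> w \<in> Ord"
proof -
  assume i: "i < n" and w: "w \<in> OZ"
  have "(\<Sum>k<n. y ^ k * \<iota> (if k = i then w else 0)) = (\<Sum>k<n. if k = i then y ^ k * \<iota> w else 0)"
    by (intro sum.cong) (auto simp: iota_0)
  also have "\<dots> = y ^ i * \<iota> w" using i by simp
  finally show ?thesis using Ord_I[of "\<lambda>k. if k = i then w else 0"] w by simp
qed

lemma Ord_iota: "w \<in> OZ \<Longrightarrow> \<iota> w \<in> Ord"
  using Ord_monom[of 0 w] n_ge_2 by simp

lemma Ord_add: "x \<in> Ord \<Longrightarrow> x' \<in> Ord \<Longrightarrow> x + x' \<in> Ord"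
proof (elim Ord_E)
  fix w w' assume w: "\<And>i. w i \<in> OZ" "\<And>i. w' i \<in> OZ"
    and x: "x = (\<Sum>i<n. y ^ i * \<iota> (w i))" "x' = (\<Sum>i<n. y ^ i * \<iota> (w' i))"
  have "x + x' = (\<Sum>i<n. y ^ i * \<iota> (w i + w' i))"
    using w by (simp add: x iota_add distrib_left sum.distrib)
  then show ?thesis using w by (auto intro!: Ord_I)
qed

lemma Ord_minus: "x \<in> Ord \<Longrightarrow> - x \<in> Ord"
proof (elim Ord_E)
  fix w assume w: "\<And>i. w i \<in> OZ" and x: "x = (\<Sum>i<n. y ^ i * \<iota> (w i))"
  have "- x = (\<Sum>i<n. y ^ i * \<iota> (- w i))"
    using w by (simp add: x iota_minus sum_negf)
  then show ?thesis using w by (auto intro!: Ord_I)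
qed

lemma Ord_0: "0 \<in> Ord"
  using Ord_iota[of 0] by (simp add: iota_0)

lemma Ord_sum: "(\<And>i. i \<in> A \<Longrightarrow> f i \<in> Ord) \<Longrightarrow> sum f A \<in> Ord"
  by (induction A rule: infinite_finite_induct) (auto intro: Ord_add Ord_0)

lemma Ord_mult_iota: "x \<in> Ord \<Longrightarrow> z \<in> OZ \<Longrightarrow> x * \<iota> z \<in> Ord"
proof (elim Ord_E)
  fix w assume z: "z \<in> OZ" and w: "\<And>i. w i \<in> OZ" and x: "x = (\<Sum>i<n. y ^ i * \<iota> (w i))"
  have "x * \<iota> z = (\<Sum>i<n. y ^ i * \<iota> (w i * z))"
    using w z by (simp add: x iota_mult sum_distrib_right mult.assoc)
  then show ?thesis using w z by (auto intro!: Ord_I)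
qed

text \<open>For \<open>m = n\<close> the identity \<open>y_linear_prod\<close> is a monic equation
  for \<open>y\<close> with right side -\<sigma>/p. Its constant coefficient is -l^n/p, so the two
  fractions combine to the integer (l^n - \<sigma>)/p, which is where the congruence for
  \<open>l\<close> enters; the middle coefficients are integers already.\<close>

lemma y_pow_n_in_Ord: "y ^ n \<in> Ord"
proof -
  define c where "c k = coeff (\<Prod>i<n. [:- (of_int l * (S ^^ i) beta_quot), 1:]) k" for k
  obtain m where m: "n = Suc m" using n_ge_2 by (cases n) auto
  have top: "c n = 1" unfolding c_def by (rule coeff_linear_prod_top)
  have "c 0 = (\<Prod>i<n. - (of_int l * (S ^^ i) beta_quot))" unfolding c_def by (rule coeff_linear_prod_0)
  also have "\<dots> = (- of_int l) ^ n * (\<Prod>i<n. (S ^^ i) beta_quot)"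
    by (simp only: mult_minus_left[symmetric] prod.distrib prod_constant card_lessThan)
  finally have c0: "c 0 = - (of_int l ^ n / of_nat p)" using odd_n by (simp add: prod_S_beta_quot)
  have "int p dvd l ^ n - \<sigma>" using l_cong by (simp add: cong_iff_dvd_diff)
  then obtain t where "l ^ n - \<sigma> = int p * t" by (rule dvdE)
  then have t: "l ^ n = \<sigma> + int p * t" by simp
  have "of_int (l ^ n) = (of_int (\<sigma> + int p * t) :: complex)" by (simp only: t)
  then have "of_int l ^ n = of_int \<sigma> + of_nat p * (of_int t :: complex)" by simp
  then have const: "- c 0 + - (of_int \<sigma> / of_nat p) = of_int t"
    using p_ne_0 by (simp add: c0 add_divide_distrib)
  have cZ: "c 0 \<in> Z" "of_int \<sigma> / of_nat p \<in> Z"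
    unfolding c0 divide_inverse by (intro Z_closed Z_power of_int_in_Z of_nat_in_Z)+
  have "(\<Sum>k\<le>n. y ^ k * \<iota> (c k)) = - (u ^ n * \<iota> (1 / of_nat p))"
    unfolding c_def y_linear_prod using odd_n by (simp add: prod_S_beta_quot)
  also have "u ^ n * \<iota> (1 / of_nat p) = \<iota> (of_int \<sigma> / of_nat p)"
  proof -
    have "1 / of_nat p \<in> Z" unfolding divide_inverse by (intro Z_closed of_nat_in_Z)
    then show ?thesis using iota_mult[of "of_int \<sigma>" "1 / of_nat p"] by (simp add: u_pow_n iota_of_int)
  qed
  also have "(\<Sum>k\<le>n. y ^ k * \<iota> (c k)) = (\<Sum>k<n. y ^ k * \<iota> (c k)) + y ^ n"
    by (simp only: lessThan_Suc_atMost[symmetric] sum.lessThan_Suc top iota_1 mult_1_right)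
  finally have "y ^ n = - \<iota> (of_int \<sigma> / of_nat p) - (\<Sum>k<n. y ^ k * \<iota> (c k))"
    by (simp only: eq_diff_eq add.commute)
  also have "(\<Sum>k<n. y ^ k * \<iota> (c k)) = \<iota> (c 0) + (\<Sum>k<m. y ^ Suc k * \<iota> (c (Suc k)))"
    unfolding m sum.lessThan_Suc_shift by simp
  also have "- \<iota> (of_int \<sigma> / of_nat p) - (\<iota> (c 0) + (\<Sum>k<m. y ^ Suc k * \<iota> (c (Suc k)))) =
      \<iota> (of_int t) + - (\<Sum>k<m. y ^ Suc k * \<iota> (c (Suc k)))"
    unfolding const[symmetric] using cZ by (simp add: iota_add iota_minus iota_diff)
  also have "\<dots> \<in> Ord"
  proof (intro Ord_add Ord_minus Ord_sum Ord_iota)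
    fix k assume k: "k \<in> {..<m}"
    have "0 < Suc k" "Suc k < n" using k m by simp_all
    then have "\<exists>r :: int. c (Suc k) = of_int r"
      unfolding c_def by (rule middle_coeff_integral[of _ l]) blast
    then obtain r :: int where "c (Suc k) = of_int r" by blast
    then have "c (Suc k) \<in> OZ" by simp
    then show "y ^ Suc k * \<iota> (c (Suc k)) \<in> Ord" using k m by (intro Ord_monom) auto
  qed auto
  finally show ?thesis .
qed

lemma y_mult_Ord: "x \<in> Ord \<Longrightarrow> y * x \<in> Ord"
proof (elim Ord_E)
  fix w assume w: "\<And>i. w i \<in> OZ" and x: "x = (\<Sum>i<n. y ^ i * \<iota> (w i))"
  have "y ^ Suc i * \<iota> (w i) \<in> Ord" if "i < n" for i
  proof (cases "Suc i = n")
    case True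
    then show ?thesis using Ord_mult_iota[OF y_pow_n_in_Ord w] by simp
  next
    case False
    then show ?thesis using that by (intro Ord_monom w) simp
  qed
  then show ?thesis by (auto simp: x sum_distrib_left mult.assoc[symmetric] intro!: Ord_sum)
qed

lemma y_pow_mult_Ord: "x \<in> Ord \<Longrightarrow> y ^ i * x \<in> Ord"
  by (induction i) (auto simp: mult.assoc intro: y_mult_Ord)

lemma iota_mult_y_pow: "z \<in> OZ \<Longrightarrow> \<iota> z * y ^ i \<in> Ord"
proof (induction i arbitrary: z)
  case (Suc i)
  obtain w where w: "w \<in> OZ" "\<iota> z * y = y * \<iota> (S z) + \<iota> w" using Suc.prems by (rule iota_y)
  have "\<iota> z * y ^ Suc i = y * (\<iota> (S z) * y ^ i) + \<iota> w * y ^ i"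
    by (simp add: mult.assoc[symmetric] w(2) distrib_right)
  moreover have "S z \<in> OZ" using S_pow_OZ[OF Suc.prems, of 1] by simp
  ultimately show ?case using Suc.IH w(1) by (auto intro!: Ord_add y_mult_Ord)
qed (simp add: Ord_iota)

text \<open>A product of two monomials has an inner part \<open>\<iota> z * y ^ k\<close>, which
  \<open>iota_mult_y_pow\<close> brings into standard form; the powers of \<open>y\<close> on the
  left are absorbed through the equation for \<open>y ^ n\<close>.\<close>

lemma Ord_subring: "subring_set Ord"
  unfolding subring_set_def
proof (intro conjI ballI)
  show "1 \<in> Ord" using Ord_iota[of 1] by (simp add: iota_1)
  fix x x' assume x: "x \<in> Ord" and x': "x' \<in> Ord"
  show "x - x' \<in> Ord" using Ord_add[OF x Ord_minus[OF x']] by simp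
  obtain w where w: "\<And>i. w i \<in> OZ" "x = (\<Sum>i<n. y ^ i * \<iota> (w i))" using x by (rule Ord_E) blast
  obtain w' where w': "\<And>i. w' i \<in> OZ" "x' = (\<Sum>i<n. y ^ i * \<iota> (w' i))" using x' by (rule Ord_E) blast
  have "y ^ i * \<iota> (w i) * (y ^ k * \<iota> (w' k)) = y ^ i * (\<iota> (w i) * y ^ k * \<iota> (w' k))" for i k
    by (simp add: mult.assoc)
  also have "\<dots> i k \<in> Ord" for i k
    by (intro y_pow_mult_Ord Ord_mult_iota iota_mult_y_pow w w')
  finally show "x * x' \<in> Ord"
    unfolding w(2) w'(2) sum_product by (intro Ord_sum)
qed

lemma hull_order_eq: "hull_order n S \<iota> (eta n 0) y = Ord"
proof -
  have OZ_rep: "\<iota> (\<Sum>k<n. of_int (c k) * (S ^^ k) (eta n 0)) = (\<Sum>k<n. of_int (c k) * \<iota> ((S ^^ k) (eta n 0)))"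
    for c :: "nat \<Rightarrow> int"
    by (subst iota_sum) (auto simp: iota_mult iota_of_int eta_in_Z)
  have comm: "y ^ i * (\<Sum>k<n. of_int (c k) * \<iota> ((S ^^ k) (eta n 0))) =
      (\<Sum>k<n. of_int (c k) * (y ^ i * \<iota> ((S ^^ k) (eta n 0))))" for i and c :: "nat \<Rightarrow> int"
    unfolding sum_distrib_left by (intro sum.cong refl) (metis mult.assoc mult_of_int_commute)
  show ?thesis
  proof
    show "hull_order n S \<iota> (eta n 0) y \<subseteq> Ord"
    proof
      fix x assume "x \<in> hull_order n S \<iota> (eta n 0) y"
      then obtain c :: "nat \<Rightarrow> nat \<Rightarrow> int" where
        "x = (\<Sum>i<n. \<Sum>k<n. of_int (c i k) * (y ^ i * \<iota> ((S ^^ k) (eta n 0))))"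
        unfolding hull_order_def by blast
      then have "x = (\<Sum>i<n. y ^ i * \<iota> (\<Sum>k<n. of_int (c i k) * (S ^^ k) (eta n 0)))"
        by (simp add: OZ_rep comm)
      then show "x \<in> Ord" by (auto intro!: Ord_I)
    qed
    show "Ord \<subseteq> hull_order n S \<iota> (eta n 0) y"
    proof
      fix x assume "x \<in> Ord"
      then obtain w where w: "\<And>i. w i \<in> OZ" "x = (\<Sum>i<n. y ^ i * \<iota> (w i))" by (rule Ord_E) blast
      have "\<exists>c :: nat \<Rightarrow> int. w i = (\<Sum>k<n. of_int (c k) * (S ^^ k) (eta n 0))" for i
        using w(1)[of i] unfolding OZ_eq by blast
      then obtain c :: "nat \<Rightarrow> nat \<Rightarrow> int" where "\<And>i. w i = (\<Sum>k<n. of_int (c i k) * (S ^^ k) (eta n 0))"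
        by metis
      then have "x = (\<Sum>i<n. \<Sum>k<n. of_int (c i k) * (y ^ i * \<iota> ((S ^^ k) (eta n 0))))"
        using w(2) by (simp add: OZ_rep comm)
      then show "x \<in> hull_order n S \<iota> (eta n 0) y" unfolding hull_order_def by blast
    qed
  qed
qed

lemmas Ord_closed = subring_setD[OF Ord_subring]

lemma Ord_power: "x \<in> Ord \<Longrightarrow> x ^ k \<in> Ord"
  by (induction k) (auto intro: Ord_closed)

lemma Ord_of_int: "of_int m \<in> Ord"
  using Ord_iota[of "of_int m"] by (simp add: iota_of_int)

text \<open>With \<gamma> the product of the other conjugates of \<beta>, so that \<beta> \<gamma> =
  p, multiplying \<open>y\<close> by \<gamma>^(n-1) replaces \<open>beta_quot\<close> by p^(n-1) / p
  = p^(n-2). The result is \<open>(l - u) * p ^ (n - 2)\<close>.\<close>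

lemma multiple_of_u_in_Ord: "of_nat (p ^ (n - 2)) * u \<in> Ord"
proof -
  obtain \<gamma> where \<gamma>: "\<gamma> \<in> OZ" "beta n 0 * \<gamma> = of_nat p" by (rule beta_complement)
  have n: "n - 1 = Suc (n - 2)" using n_ge_2 by simp
  have "beta_quot * \<gamma> ^ (n - 1) = (beta n 0 * \<gamma>) ^ (n - 1) / of_nat p"
    by (simp add: beta_quot_def power_mult_distrib)
  also have "\<dots> = of_nat (p ^ (n - 2))" unfolding \<gamma>(2) n using p_ne_0 by simp
  finally have b\<gamma>: "beta_quot * \<gamma> ^ (n - 1) = of_nat (p ^ (n - 2))" .
  have "\<iota> beta_quot * \<iota> (\<gamma> ^ (n - 1)) = \<iota> (beta_quot * \<gamma> ^ (n - 1))"
    using \<gamma>(1) by (intro iota_mult[symmetric]) auto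
  also have "\<dots> = of_nat (p ^ (n - 2))" unfolding b\<gamma> by (rule iota_of_nat)
  finally have "y * \<iota> (\<gamma> ^ (n - 1)) = (of_int l - u) * of_nat (p ^ (n - 2))"
    unfolding y_conv by (simp only: mult.assoc)
  also have "\<dots> = of_int l * of_nat (p ^ (n - 2)) - of_nat (p ^ (n - 2)) * u"
    by (simp only: left_diff_distrib mult_of_nat_commute[of "p ^ (n - 2)" u])
  finally have eq: "of_nat (p ^ (n - 2)) * u = of_int l * of_int (int (p ^ (n - 2))) - y * \<iota> (\<gamma> ^ (n - 1))"
    by simp
  show ?thesis
    unfolding eq using \<gamma>(1) by (intro Ord_closed(3,4) Ord_of_int y_mult_Ord Ord_iota) auto
qed

lemma Ord_generated:
  assumes p3: "p \<noteq> 3" and \<sigma>3: "\<not> 3 dvd \<sigma>"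
    and H: "additive_subgroup_set H" and triple: "\<And>x. x \<in> Ord \<Longrightarrow> 3 * x \<in> H"
    and comm: "\<And>x x'. x \<in> Ord \<Longrightarrow> x' \<in> Ord \<Longrightarrow> x * x' - x' * x \<in> H"
    and cube: "\<And>x. x \<in> Ord \<Longrightarrow> x * x * x \<in> H"
  shows "Ord \<subseteq> H"
proof -
  note HD = additive_subgroup_setD[OF H]
  \<comment> \<open>\<open>v\<close> stands in for \<open>u\<close> as an element known to lie in
    the order; the factor \<open>q\<close> is prime to 3.\<close>
  define q where "q = p ^ (n - 2)"
  define v where "v = of_nat q * u"
  have v: "v \<in> Ord" using multiple_of_u_in_Ord by (simp add: v_def q_def)
  have v_pow: "v ^ k = of_nat (q ^ k) * u ^ k" for k
  proof (induction k)
    case (Suc k)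
    have "u * of_nat (q ^ k) = of_nat (q ^ k) * u" by (rule mult_of_nat_commute[symmetric])
    then have "u * (of_nat (q ^ k) * u ^ k) = of_nat (q ^ k) * (u * u ^ k)"
      by (simp only: mult.assoc[symmetric])
    then show ?case using Suc by (simp add: v_def mult.assoc)
  qed simp
  have iota_v_pow: "\<iota> z * v ^ k = v ^ k * \<iota> ((S ^^ k) z)" if "z \<in> Z" for z k
  proof -
    have "\<iota> z * of_nat (q ^ k) = of_nat (q ^ k) * \<iota> z" by (rule mult_of_nat_commute[symmetric])
    then have "\<iota> z * (of_nat (q ^ k) * u ^ k) = of_nat (q ^ k) * (\<iota> z * u ^ k)"
      by (simp only: mult.assoc[symmetric])
    then show ?thesis using that by (simp only: v_pow iota_u_pow mult.assoc)
  qed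
  have cop: "coprime (int p) 3"
    using p3 prime_p by (simp add: primes_coprime)
  have cop\<sigma>: "coprime \<sigma> 3"
    using prime_imp_coprime[of 3 \<sigma>] \<sigma>3 by (simp add: coprime_commute)
  have copq: "coprime (int q) 3" using cop by (simp add: q_def)
  \<comment> \<open>Division by integers prime to 3: write 1 as a combination of \<open>m\<close>
    and 3, and use that \<open>H\<close> contains the triples.\<close>
  have cancel: "x \<in> H" if "x \<in> Ord" "coprime m 3" "of_int m * x \<in> H" for m x
  proof -
    obtain r s where "r * m + s * 3 = gcd m 3" using bezout_int by blast
    then have rs: "r * m + s * 3 = 1" using \<open>coprime m 3\<close> by simp
    have "of_int r * (of_int m * x) + of_int s * (3 * x) = of_int (r * m + s * 3) * x"
      by (simp add: distrib_right mult.assoc)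
    then show ?thesis
      unfolding rs using HD(4)[OF HD(5)[OF that(3), of r] HD(5)[OF triple[OF that(1)], of s]] by simp
  qed
  \<comment> \<open>The commutators of \<open>v ^ k * \<iota> (w' i * w)\<close> with
    \<open>\<iota> (z i)\<close>, summed along the trace form identity, give
    \<open>v ^ k * \<iota> (of_nat p * w)\<close>.\<close>
  have pos: "of_int (int p * int q ^ k) * (u ^ k * \<iota> w) \<in> H" if k: "\<not> n dvd k" and w: "w \<in> OZ" for k w
  proof -
    obtain w' z where wz: "\<And>i. w' i \<in> OZ" "\<And>i. z i \<in> OZ"
      "(\<Sum>i<n. w' i * (z i - (S ^^ k) (z i))) = of_nat p"
      using k by (rule trace_form_S) blast
    define C where "C i = v ^ k * \<iota> (w' i * w) * \<iota> (z i) - \<iota> (z i) * (v ^ k * \<iota> (w' i * w))" for i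
    have "C i \<in> H" for i
      unfolding C_def using wz w by (intro comm Ord_closed(4) Ord_power v Ord_iota) auto
    then have "(\<Sum>i<n. C i) \<in> H" by (intro HD)
    moreover have "C i = v ^ k * \<iota> (w' i * (z i - (S ^^ k) (z i)) * w)" for i
    proof -
      have Z: "w' i \<in> Z" "z i \<in> Z" "w \<in> Z" "(S ^^ k) (z i) \<in> Z" using wz w by auto
      have "\<iota> (z i) * v ^ k = v ^ k * \<iota> ((S ^^ k) (z i))" using Z(2) by (rule iota_v_pow)
      then have "C i = v ^ k * (\<iota> (w' i * w) * \<iota> (z i) - \<iota> ((S ^^ k) (z i)) * \<iota> (w' i * w))"
        unfolding C_def by (simp add: right_diff_distrib mult.assoc[symmetric])
      also have "\<iota> (w' i * w) * \<iota> (z i) - \<iota> ((S ^^ k) (z i)) * \<iota> (w' i * w) =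
          \<iota> (w' i * w * z i - (S ^^ k) (z i) * (w' i * w))"
        using Z by (simp add: iota_mult iota_diff)
      also have "w' i * w * z i - (S ^^ k) (z i) * (w' i * w) = w' i * (z i - (S ^^ k) (z i)) * w"
        by (simp add: algebra_simps)
      finally show ?thesis .
    qed
    moreover have "(\<Sum>i<n. v ^ k * \<iota> (w' i * (z i - (S ^^ k) (z i)) * w)) = v ^ k * \<iota> (of_nat p * w)"
    proof -
      have "of_nat p * w = (\<Sum>i<n. w' i * (z i - (S ^^ k) (z i)) * w)"
        by (simp add: wz(3)[symmetric] sum_distrib_right)
      then have "\<iota> (of_nat p * w) = (\<Sum>i<n. \<iota> (w' i * (z i - (S ^^ k) (z i)) * w))"
        using wz w by (simp add: iota_sum Z_closed)
      then show ?thesis by (simp add: sum_distrib_left)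
    qed
    ultimately have "v ^ k * \<iota> (of_nat p * w) \<in> H" by simp
    also have "v ^ k * \<iota> (of_nat p * w) = of_int (int p * int q ^ k) * (u ^ k * \<iota> w)"
    proof -
      have "\<iota> (of_nat p * w) = of_nat p * \<iota> w" using w by (simp add: iota_mult iota_of_nat)
      moreover have "v ^ k * (of_nat p * \<iota> w) = of_nat p * (v ^ k * \<iota> w)"
        by (metis mult.assoc mult_of_nat_commute)
      ultimately show ?thesis by (simp add: v_pow mult.assoc)
    qed
    finally show ?thesis .
  qed
  have S_diff: "\<iota> (z - S z) \<in> H" if z: "z \<in> OZ" for z
  proof -
    have Sz: "S z \<in> OZ" using S_pow_OZ[OF z, of 1] by simp
    have n1: "Suc (n - 1) = n" using n_ge_2 by simp
    have "(S ^^ (n - 1)) (S z) = (S ^^ Suc (n - 1)) z" by (simp add: funpow_swap1)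
    then have SS: "(S ^^ (n - 1)) (S z) = z" unfolding n1 using S_order z by simp
    \<comment> \<open>As the (n - 1)-st power of \<open>S\<close> sends \<open>S z\<close> back to
      \<open>z\<close>, this commutator is \<open>v ^ n * \<iota> (z - S z)\<close>, and
      \<open>v ^ n\<close> is the integer q^n \<sigma>, which is prime to 3.\<close>
    have "v * \<iota> (S z) * v ^ (n - 1) - v ^ (n - 1) * (v * \<iota> (S z)) \<in> H"
      using Sz by (intro comm Ord_closed(4) Ord_power v Ord_iota) auto
    also have "v * \<iota> (S z) * v ^ (n - 1) = v ^ n * \<iota> z"
    proof -
      have "\<iota> (S z) * v ^ (n - 1) = v ^ (n - 1) * \<iota> z"
        using iota_v_pow[of "S z" "n - 1"] Sz SS by simp
      then have "v * \<iota> (S z) * v ^ (n - 1) = v ^ Suc (n - 1) * \<iota> z" by (simp add: mult.assoc)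
      then show ?thesis by (simp only: n1)
    qed
    also have "v ^ (n - 1) * (v * \<iota> (S z)) = v ^ n * \<iota> (S z)"
    proof -
      have "v ^ (n - 1) * (v * \<iota> (S z)) = v ^ Suc (n - 1) * \<iota> (S z)"
        by (simp add: mult.assoc power_Suc2 del: power_Suc)
      then show ?thesis by (simp only: n1)
    qed
    also have "v ^ n * \<iota> z - v ^ n * \<iota> (S z) = of_int (int q ^ n * \<sigma>) * \<iota> (z - S z)"
      using z Sz by (simp add: v_pow u_pow_n iota_diff right_diff_distrib)
    finally have mult: "of_int (int q ^ n * \<sigma>) * \<iota> (z - S z) \<in> H" .
    have "coprime (int q ^ n * \<sigma>) 3" using copq cop\<sigma> by simp
    from cancel[OF Ord_iota[OF OZ_closed(3)[OF z Sz]] this mult] show ?thesis .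
  qed
  have eta0: "eta n 0 \<in> OZ" by simp
  have eta_diff: "\<iota> (eta n 0 - (S ^^ k) (eta n 0)) \<in> H" for k
  proof (induction k)
    case 0
    then show ?case by (simp add: iota_0 HD)
  next
    case (Suc k)
    have eq: "\<iota> (eta n 0 - (S ^^ Suc k) (eta n 0)) =
        \<iota> (eta n 0 - (S ^^ k) (eta n 0)) + \<iota> ((S ^^ k) (eta n 0) - S ((S ^^ k) (eta n 0)))"
      using S_pow_in_Z[OF eta_in_Z, of "Suc k"] S_pow_in_Z[OF eta_in_Z, of k]
      by (subst iota_add[symmetric]) (auto simp: eta_in_Z)
    show ?case unfolding eq using Suc S_diff[OF S_pow_OZ[OF eta0]] by (rule HD(4))
  qed
  have eta_H: "\<iota> (eta n 0) \<in> H"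
  proof -
    obtain c :: "nat \<Rightarrow> int" and t where c: "eta n 0 ^ 3 = (\<Sum>k<n. of_int (c k) * (S ^^ k) (eta n 0))"
      and t: "(\<Sum>k<n. c k) = 1 + 3 * t"
      by (rule eta_cube)
    have "\<iota> (eta n 0) * \<iota> (eta n 0) * \<iota> (eta n 0) \<in> H"
      using eta0 by (intro cube Ord_iota)
    moreover have "\<iota> (eta n 0) * \<iota> (eta n 0) * \<iota> (eta n 0) = \<iota> (eta n 0 ^ 3)"
      using eta_in_Z by (simp add: iota_mult power3_eq_cube)
    ultimately have 1: "\<iota> (eta n 0 ^ 3) \<in> H" by simp
    \<comment> \<open>Adding these differences replaces every conjugate in the expansion of the cube
      by \<open>eta n 0\<close> itself; the total coefficient 1 + 3t is prime to 3.\<close>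
    have "(\<Sum>k<n. of_int (c k) * \<iota> (eta n 0 - (S ^^ k) (eta n 0))) \<in> H"
      by (intro HD(5,6) eta_diff)
    then have "\<iota> (eta n 0 ^ 3) + (\<Sum>k<n. of_int (c k) * \<iota> (eta n 0 - (S ^^ k) (eta n 0))) \<in> H"
      using 1 HD(4) by blast
    also have "\<iota> (eta n 0 ^ 3) = (\<Sum>k<n. of_int (c k) * \<iota> ((S ^^ k) (eta n 0)))"
      unfolding c using eta_in_Z by (subst iota_sum) (auto simp: iota_mult iota_of_int)
    also have "\<dots> + (\<Sum>k<n. of_int (c k) * \<iota> (eta n 0 - (S ^^ k) (eta n 0))) =
        (\<Sum>k<n. of_int (c k) * \<iota> (eta n 0))"
      using eta_in_Z by (simp add: iota_diff right_diff_distrib sum.distrib[symmetric])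
    also have "\<dots> = of_int (1 + 3 * t) * \<iota> (eta n 0)"
      by (simp only: t[symmetric] of_int_sum sum_distrib_right)
    finally have mult: "of_int (1 + 3 * t) * \<iota> (eta n 0) \<in> H" .
    have "coprime (1 + 3 * t) 3"
    proof (rule coprimeI)
      fix d assume "d dvd 1 + 3 * t" "d dvd 3"
      then have "d dvd (1 + 3 * t) - 3 * t" by (intro dvd_diff dvd_mult2)
      then show "d dvd 1" by simp
    qed
    from cancel[OF Ord_iota[OF eta0] this mult] show ?thesis .
  qed
  have iota_H: "\<iota> w \<in> H" if "w \<in> OZ" for w
  proof -
    obtain c :: "nat \<Rightarrow> int" where c: "w = (\<Sum>k<n. of_int (c k) * (S ^^ k) (eta n 0))"
      using \<open>w \<in> OZ\<close> unfolding OZ_eq by blast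
    have "\<iota> ((S ^^ k) (eta n 0)) \<in> H" for k
      using HD(2)[OF eta_H eta_diff[of k]] eta_in_Z by (simp add: iota_diff)
    then have "(\<Sum>k<n. of_int (c k) * \<iota> ((S ^^ k) (eta n 0))) \<in> H" by (intro HD(5,6))
    then show ?thesis unfolding c using eta_in_Z by (subst iota_sum) (auto simp: iota_mult iota_of_int)
  qed
  \<comment> \<open>All elements that reach \<open>H\<close> after multiplication by an integer
    prime to 3. Membership in the order is not asked for, so intermediate products need no check;
    \<open>cancel\<close> brings the final element back to \<open>H\<close>.\<close>
  define H' where "H' = {x. \<exists>m. coprime m 3 \<and> of_int m * x \<in> H}"
  have H'_sum: "of_int r * x + of_int s * x' \<in> H'" if xx: "x \<in> H'" "x' \<in> H'" for r s x x'
  proof -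
    obtain m m' where m: "coprime m 3" "of_int m * x \<in> H" "coprime m' 3" "of_int m' * x' \<in> H"
      using xx by (auto simp: H'_def)
    have "of_int (m' * r) * (of_int m * x) + of_int (m * s) * (of_int m' * x') \<in> H"
      by (rule HD(4)[OF HD(5)[OF m(2)] HD(5)[OF m(4)]])
    also have "of_int (m' * r) * (of_int m * x) + of_int (m * s) * (of_int m' * x') =
        of_int (m * m') * (of_int r * x + of_int s * x')"
      by (simp only: distrib_left mult.assoc[symmetric] of_int_mult[symmetric]) (simp add: mult_ac)
    finally show ?thesis using m unfolding H'_def by (intro CollectI exI[of _ "m * m'"]) simp
  qed
  have u_H': "u ^ k * \<iota> w \<in> H'" if w: "w \<in> OZ" for k w
  proof (cases "n dvd k")
    case True
    then obtain t where "k = n * t" by (rule dvdE)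
    then have "u ^ k = of_int (\<sigma> ^ t)" by (simp add: power_mult u_pow_n)
    then have "of_int 1 * (u ^ k * \<iota> w) \<in> H" using HD(5)[OF iota_H[OF w], of "\<sigma> ^ t"] by simp
    then show ?thesis unfolding H'_def by (intro CollectI exI[of _ 1] conjI) auto
  next
    case False
    then show ?thesis
      unfolding H'_def using pos[OF False w] cop copq
      by (intro CollectI exI[of _ "int p * int q ^ k"] conjI) auto
  qed
  \<comment> \<open>A factor \<open>y\<close> is traded for a factor \<open>p\<close>: the equation
    for \<open>of_nat p * y\<close> leaves terms with one \<open>y\<close> less and at most one
    \<open>u\<close> more. Hence \<open>k\<close> and \<open>w\<close> vary in the
    induction.\<close>
  have y_H': "y ^ i * (u ^ k * \<iota> w) \<in> H'" if w: "w \<in> OZ" for i k w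
    using w
  proof (induction i arbitrary: k w)
    case 0
    then show ?case using u_H' by simp
  next
    case (Suc i)
    define \<alpha> where "\<alpha> = beta n 0 ^ (n - 1)"
    define w' where "w' = (S ^^ k) \<alpha> * w"
    have \<alpha>: "\<alpha> \<in> OZ" by (auto simp: \<alpha>_def)
    then have w': "w' \<in> OZ" using Suc.prems by (auto simp: w'_def)
    have "of_nat p * y * (u ^ k * \<iota> w) = (of_int l - u) * (u ^ k * \<iota> w')"
    proof -
      have "\<iota> \<alpha> * (u ^ k * \<iota> w) = u ^ k * \<iota> w'"
        using iota_u_pow[of \<alpha> k] \<alpha> Suc.prems by (simp add: w'_def iota_mult mult.assoc[symmetric])
      then show ?thesis unfolding y_eq \<alpha>_def by (simp add: mult.assoc)
    qed
    moreover have "of_nat p * y ^ i = y ^ i * of_nat p" by (rule mult_of_nat_commute)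
    then have "of_nat p * (y ^ Suc i * (u ^ k * \<iota> w)) = y ^ i * (of_nat p * y * (u ^ k * \<iota> w))"
      by (simp only: power_Suc2 mult.assoc[symmetric])
    ultimately have "of_nat p * (y ^ Suc i * (u ^ k * \<iota> w)) = y ^ i * ((of_int l - u) * (u ^ k * \<iota> w'))"
      by (simp only:)
    also have "\<dots> = of_int l * (y ^ i * (u ^ k * \<iota> w')) + of_int (- 1) * (y ^ i * (u ^ Suc k * \<iota> w'))"
    proof -
      have "y ^ i * (of_int l * X) = of_int l * (y ^ i * X)" for X
        by (metis mult.assoc mult_of_int_commute)
      then show ?thesis by (simp add: left_diff_distrib right_diff_distrib mult.assoc)
    qed
    also have "\<dots> \<in> H'" using Suc.IH w' by (intro H'_sum)
    finally obtain m where "coprime m 3" "of_int m * (of_nat p * (y ^ Suc i * (u ^ k * \<iota> w))) \<in> H"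
      by (auto simp: H'_def)
    then have "of_int (m * int p) * (y ^ Suc i * (u ^ k * \<iota> w)) \<in> H" "coprime (m * int p) 3"
      using cop by (simp_all add: mult.assoc)
    then show ?case unfolding H'_def by blast
  qed
  show "Ord \<subseteq> H"
  proof
    fix x assume x: "x \<in> Ord"
    obtain w where w: "\<And>i. w i \<in> OZ" "x = (\<Sum>i<n. y ^ i * \<iota> (w i))" using x by (rule Ord_E) blast
    have "(\<Sum>i\<in>A. y ^ i * \<iota> (w i)) \<in> H'" if "finite A" for A
      using that
    proof (induction A rule: finite_induct)
      case empty
      then show ?case using H'_def HD(1) by (auto intro!: exI[of _ 1])
    next
      case (insert i A)
      then show ?case using H'_sum[OF y_H'[OF w(1)[of i], of i 0] insert.IH, of 1 1] by simp
    qed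
    then have "x \<in> H'" unfolding w(2) by simp
    then show "x \<in> H" using cancel[OF x] by (auto simp: H'_def)
  qed
qed

end

theorem theorem5:
  fixes n p g :: nat and \<sigma> :: int and Z :: "complex set" and S :: "complex \<Rightarrow> complex"
    and \<iota> :: "complex \<Rightarrow> 'a::{division_ring,ring_char_0}" and u :: 'a
    and \<xi> \<eta> :: complex and \<O> :: "'a set"
  assumes "prime n" and "odd n"
    and "canonical_generation n p \<sigma> Z S \<iota> u"
    and "associated_order n p \<sigma> S \<iota> u g \<xi> \<O>"
    and "\<eta> = gaussian_period n p g \<xi>"
    and "\<not> 3 dvd \<sigma>"
    and "\<not> (\<exists>k::int. field_norm (rat_adjoin \<eta>) \<eta> = 3 * of_int k)"
  shows "\<forall>r\<ge>2. \<forall>C \<in> matrices_over r \<O>. sum_of_cubes r \<O> C"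
proof -
  obtain l y where ly: "[l ^ n = \<sigma>] (mod int p)"
    "of_nat p * y = (of_int l - u) * \<iota> (period_product n p g \<xi> ^ (n - 1))"
    "\<O> = hull_order n S \<iota> (gaussian_period n p g \<xi>) y"
    and primroot: "residue_primroot p g" and primitive: "primitive_root_of_unity p \<xi>"
    using assms(4) unfolding associated_order_def by blast
  have gen: "cyclic_generation n (of_int \<sigma>) Z S \<iota> u" and p: "prime p" "[p = 1] (mod n)"
    and cond: "has_conductor Z p"
    using assms(3) unfolding canonical_generation_def by blast+
  interpret prime_cyclotomic_field p g \<xi>
    by unfold_locales (fact p primroot primitive)+
  have n_dvd: "n dvd p - 1"
    using p p_ge_2 by (metis One_nat_def Suc_leD cong_altdef_nat cong_sym numeral_2_eq_2)
  have cyc: "cyclic_field n Z S" and \<sigma>0: "of_int \<sigma> \<noteq> (0::rat)" and \<iota>1: "\<iota> 1 = 1"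
    and \<iota>add: "\<And>x y. x \<in> Z \<Longrightarrow> y \<in> Z \<Longrightarrow> \<iota> (x + y) = \<iota> x + \<iota> y"
    and \<iota>mult: "\<And>x y. x \<in> Z \<Longrightarrow> y \<in> Z \<Longrightarrow> \<iota> (x * y) = \<iota> x * \<iota> y"
    and \<iota>u: "\<And>z. z \<in> Z \<Longrightarrow> \<iota> z * u = u * \<iota> (S z)" and un: "u ^ n = rat_embed (of_int \<sigma>)"
    using gen unfolding cyclic_generation_def by blast+
  have un': "u ^ n = of_int \<sigma>" using un by (simp add: rat_embed_def)
  have "rat_adjoin (cis (2 * pi / real p)) \<subseteq> K"
  proof -
    have "cis (2 * pi / real p) ^ p = 1"
      using p_ge_2 by (simp add: Complex.DeMoivre)
    then have "cis (2 * pi / real p) \<in> K" using root_of_unity_in_R R_subset_K by blast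
    then show ?thesis unfolding rat_adjoin_def using K_subfield by blast
  qed
  then have ZK: "Z \<subseteq> K" using cond unfolding has_conductor_def by blast
  have SZ: "S z \<in> Z" if "z \<in> Z" for z
    using cyc that by (auto simp: cyclic_field_def gal_def bij_betw_def)
  have Z: "1 \<in> Z" "x - y \<in> Z" "x * y \<in> Z" "inverse x \<in> Z" if "x \<in> Z" "y \<in> Z" for x y
    using cyc that by (auto simp: cyclic_field_def is_subfield_def)
  \<comment> \<open>Moving \<open>\<iota> z\<close> past \<open>u ^ n\<close> applies
    \<open>S\<close> n times, but \<open>u ^ n\<close> is a nonzero integer and hence central, so
    \<open>\<iota> ((S ^^ n) z) = \<iota> z\<close>. A homomorphism from a field with
    \<open>\<iota> 1 = 1\<close> is injective.\<close>
  have order: "(S ^^ n) z = z" if z: "z \<in> Z" for z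
  proof -
    have pow: "\<iota> z * u ^ k = u ^ k * \<iota> ((S ^^ k) z) \<and> (S ^^ k) z \<in> Z" for k
    proof (induction k)
      case (Suc k)
      have "\<iota> z * u ^ Suc k = \<iota> z * u ^ k * u" by (simp add: power_Suc2 mult.assoc del: power_Suc)
      also have "\<dots> = u ^ k * (\<iota> ((S ^^ k) z) * u)" using Suc by (simp add: mult.assoc)
      also have "\<dots> = u ^ k * u * \<iota> (S ((S ^^ k) z))" using \<iota>u Suc by (simp add: mult.assoc)
      finally show ?case using Suc SZ by (simp add: power_commutes)
    qed (use z in simp)
    have "of_int \<sigma> * \<iota> ((S ^^ n) z) = of_int \<sigma> * \<iota> z"
      using pow[of n] unfolding un' by (metis mult_of_int_commute)
    then have eq: "\<iota> ((S ^^ n) z) = \<iota> z" using \<sigma>0 by simp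
    define d where "d = (S ^^ n) z - z"
    have dZ: "d \<in> Z" unfolding d_def using Z(2) pow z by blast
    have "\<iota> (d + z) = \<iota> d + \<iota> z" using \<iota>add dZ z by blast
    then have "\<iota> d = 0" using eq by (simp add: d_def)
    then have "\<iota> (d * inverse d) = 0" using \<iota>mult Z(4) dZ by simp
    then have "d = 0" using \<iota>1 by (cases "d = 0") auto
    then show ?thesis by (simp add: d_def)
  qed
  have bridge: "gaussian_period n p g \<xi> = eta n 0" "period_product n p g \<xi> = beta n 0"
    by (simp_all add: gaussian_period_def period_product_def eta_def beta_def e_def)
  interpret hull_order_construction p g \<xi> n Z S \<iota> u y \<sigma> l
    by unfold_locales
      (use assms(1,2) n_dvd cyc ZK order \<iota>1 \<iota>add \<iota>mult \<iota>u un' ly(1) ly(2)[unfolded bridge] in auto)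
  have O: "\<O> = Ord" unfolding ly(3) bridge by (rule hull_order_eq)
  \<comment> \<open>For \<open>p = 3\<close> the odd prime \<open>n\<close> would divide 2.\<close>
  have "p \<noteq> 3"
  proof
    assume "p = 3"
    then have "n \<le> 2" using n_dvd by (auto dest: dvd_imp_le)
    then show False using n_ge_2 \<open>odd n\<close> by simp
  qed
  show ?thesis
    unfolding O
  proof (intro allI impI ballI)
    fix r :: nat and C assume "2 \<le> r" "C \<in> matrices_over r Ord"
    then show "sum_of_cubes r Ord C"
    proof (rule all_matrices_sum_of_cubes[OF Ord_subring])
      fix H assume "additive_subgroup_set H" "\<And>x. x \<in> Ord \<Longrightarrow> 3 * x \<in> H"
        "\<And>x y. x \<in> Ord \<Longrightarrow> y \<in> Ord \<Longrightarrow> x * y - y * x \<in> H" "\<And>x. x \<in> Ord \<Longrightarrow> x * x * x \<in> H"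
      with \<open>p \<noteq> 3\<close> assms(6) show "Ord \<subseteq> H" by (rule Ord_generated)
    qed
  qed
qed

end
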